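(* Let $k$ be an integer with $k \ge 2$, and let $G$ be a graph with at least one component isomorphic to $P_3$. Then $G$ is a cograph minimal $(\infty,k)$-polar obstruction if and only if $G \cong P_3 + H$ where one of the following holds: (1) $H \cong P_3 + (k-1)K_2$; (2) $H \cong (k-2)K_2 + (K_1 \oplus 2K_2)$; (3) for some integer $j \in \{1,\dots,k-1\}$, $H \cong (k-j-1)K_2 + H_j$, where $H_j$ is a connected cograph minimal $(1,j)$-polar obstruction that is not a cograph minimal $(1,\infty)$-polar obstruction; (4) $k \ge 3$ and $H$ is any cograph minimal $(1,\infty)$-polar obstruction.
   Context: All graphs are finite and simple. A cograph is a graph with no induced subgraph isomorphic to $P_4$. $G+H$ denotes disjoint union, $G \oplus H$ the join (disjoint union plus all edges between $G$ and $H$), $nG$ the disjoint union of $n$ copies of $G$ ($0G$ is the empty graph); $K_n$, $P_n$ denote the complete graph and path on $n$ vertices. A cluster is a disjoint union of complete graphs. For $s,k \in \mathbb{Z}_{\ge 0}\cup\{\infty\}$, an $(s,k)$-polar partition of $G$ is a partition $(A,B)$ of $V(G)$ (parts may be empty) such that $G[A]$ is a complete multipartite graph with at most $s$ parts and $G[B]$ is a cluster with at most $k$ components; $\infty$ means unbounded. $G$ is $(s,k)$-polar if it has such a partition. A cograph minimal $(s,k)$-polar obstruction is a cograph that is not $(s,k)$-polar but all of whose proper induced subgraphs are $(s,k)$-polar. *)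

theory Defs
  imports "Graph_Theory.Graph_Theory" "HOL-Library.Extended_Nat" "HOL-Library.Disjoint_Sets"
begin

text \<open>
  A finite simple graph is a digraph satisfying \<^locale>\<open>graph\<close> (finite, loop-free, without parallel
  arcs, symmetric); the edge \<open>uv\<close> is the pair of arcs \<open>(u, v)\<close> and \<open>(v, u)\<close>. As the arcs are
  symmetric, the components of such a graph are its strongly connected components, given by
  \<^const>\<open>pre_digraph.sccs\<close> as induced subgraphs.
\<close>

definition path_graph :: "nat \<Rightarrow> nat pair_pre_digraph" where
  "path_graph n = \<lparr> pverts = {..<n}, parcs = {(i, j). i < n \<and> j < n \<and> (j = Suc i \<or> i = Suc j)} \<rparr>"

definition complete_graph :: "nat \<Rightarrow> nat pair_pre_digraph" where
  "complete_graph n = \<lparr> pverts = {..<n}, parcs = {(i, j). i < n \<and> j < n \<and> i \<noteq> j} \<rparr>"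

definition disjoint_union ::
    "'a pair_pre_digraph \<Rightarrow> 'b pair_pre_digraph \<Rightarrow> ('a + 'b) pair_pre_digraph" where
  "disjoint_union G H =
    \<lparr> pverts = pverts G <+> pverts H,
      parcs = {(Inl u, Inl v) | u v. (u, v) \<in> parcs G} \<union> {(Inr u, Inr v) | u v. (u, v) \<in> parcs H} \<rparr>"

definition graph_join ::
    "'a pair_pre_digraph \<Rightarrow> 'b pair_pre_digraph \<Rightarrow> ('a + 'b) pair_pre_digraph" where
  "graph_join G H =
    \<lparr> pverts = pverts G <+> pverts H,
      parcs = parcs (disjoint_union G H)
        \<union> {(Inl u, Inr v) | u v. u \<in> pverts G \<and> v \<in> pverts H}
        \<union> {(Inr v, Inl u) | u v. u \<in> pverts G \<and> v \<in> pverts H} \<rparr>"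

definition copies :: "nat \<Rightarrow> 'a pair_pre_digraph \<Rightarrow> (nat \<times> 'a) pair_pre_digraph" where
  "copies n G =
    \<lparr> pverts = {..<n} \<times> pverts G,
      parcs = {((i, u), (i, v)) | i u v. i < n \<and> (u, v) \<in> parcs G} \<rparr>"

definition cograph :: "('a, 'b) pre_digraph \<Rightarrow> bool" where
  "cograph G \<longleftrightarrow> graph G \<and>
    \<not> (\<exists>H. induced_subgraph H G \<and> digraph_iso H (with_proj (path_graph 4)))"

definition complete_multipartite_at_most :: "enat \<Rightarrow> ('a, 'b) pre_digraph \<Rightarrow> bool" where
  "complete_multipartite_at_most s G \<longleftrightarrow> graph G \<and>
    (\<exists>P. partition_on (verts G) P \<and> enat (card P) \<le> s \<and>
      (\<forall>u\<in>verts G. \<forall>v\<in>verts G. u \<rightarrow>\<^bsub>G\<^esub> v \<longleftrightarrow> \<not> (\<exists>X\<in>P. u \<in> X \<and> v \<in> X)))"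

definition cluster :: "('a, 'b) pre_digraph \<Rightarrow> bool" where
  "cluster G \<longleftrightarrow> graph G \<and> (\<forall>C\<in>pre_digraph.sccs G. \<exists>n. complete_digraph n C)"

definition polar_partition ::
    "enat \<Rightarrow> enat \<Rightarrow> ('a, 'b) pre_digraph \<Rightarrow> 'a set \<Rightarrow> 'a set \<Rightarrow> bool" where
  "polar_partition s k G A B \<longleftrightarrow>
    A \<union> B = verts G \<and> A \<inter> B = {} \<and>
    complete_multipartite_at_most s (G \<restriction> A) \<and>
    cluster (G \<restriction> B) \<and> enat (card (pre_digraph.sccs (G \<restriction> B))) \<le> k"

definition polar :: "enat \<Rightarrow> enat \<Rightarrow> ('a, 'b) pre_digraph \<Rightarrow> bool" where
  "polar s k G \<longleftrightarrow> (\<exists>A B. polar_partition s k G A B)"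

definition cograph_min_polar_obstruction :: "enat \<Rightarrow> enat \<Rightarrow> ('a, 'b) pre_digraph \<Rightarrow> bool" where
  "cograph_min_polar_obstruction s k G \<longleftrightarrow>
    cograph G \<and> \<not> polar s k G \<and>
    (\<forall>H. induced_subgraph H G \<and> H \<noteq> G \<longrightarrow> polar s k H)"

end

theory Submission
  imports Defs
begin

text \<open>
  Let \<open>P\<close> be the component \<open>P\<^sub>3\<close> and \<open>H\<close> the rest of the graph. The multipartite part of an
  \<open>(\<infinity>, k)\<close>-polar partition is independent or lies in one component, and in the second case this
  component is \<open>P\<close>. Hence \<open>P + H\<close> is \<open>(\<infinity>, k)\<close>-polar iff \<open>H\<close> is \<open>(1, k - 1)\<close>-polar or a cluster with
  at most \<open>k\<close> components; in the same way the minimality of \<open>P + H\<close> becomes a condition on \<open>H\<close> alone.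
  The least \<open>i\<close> for which a graph is \<open>(1, i)\<close>-polar is additive over disjoint unions.

  If some \<open>H - v\<close> is a cluster that is not \<open>(1, k - 1)\<close>-polar, it contains \<open>k\<close> independent edges, and
  the absence of an induced \<open>P\<^sub>4\<close> leaves only (1) and (2). Otherwise \<open>H\<close> is a minimal
  \<open>(1, k - 1)\<close>-polar obstruction, and since \<open>H\<close> is \<open>(\<infinity>, k - 1)\<close>-polar, all its components but one are
  edges, which gives (3) and (4). For the converse in case (3), a connected cograph is a join, and in
  a join that is minimal and has a \<open>(1, \<infinity>)\<close>-polar partition, the two parts of the partition are the two
  factors. For the converse in case (4), the only minimal \<open>(1, \<infinity>)\<close>-polar obstructions among cographs are
  \<open>K\<^sub>1 \<oplus> C\<^sub>4\<close>, \<open>K\<^sub>1 \<oplus> (P\<^sub>3 + K\<^sub>2)\<close>, \<open>K\<^sub>2 \<oplus> 2K\<^sub>2\<close> and \<open>(K\<^sub>1 + K\<^sub>2) \<oplus> (K\<^sub>1 + K\<^sub>2)\<close>.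
\<close>

section \<open>Polarity of vertex sets\<close>

text \<open>The two alternatives for \<open>H\<close> arise because the cluster part cannot contain
  all of \<open>P\<close>: a multipartite part with an edge must therefore lie in \<open>P\<close>,
  and then all of \<open>P\<close>, being complete bipartite, may serve as that part. Having two
  alternatives is the main obstacle. Different vertex deletions of \<open>H\<close> may be repaired
  by different alternatives, so \<open>H\<close> need not be a minimal obstruction for either one;
  (1) and (2) are what this produces, both being clusters with \<open>k\<close> components after
  deletion of a suitable vertex. Additivity holds because independent sets and clusters are both
  closed under disjoint union, with component counts adding up. Isolated vertices are then free and
  a clique with an edge costs one, however large, which is why minimality shrinks the surrounding
  cliques to single edges. All counting is done with independent sets. A bound on their size passes
  to vertex subsets and is refuted by a single set, whereas the components themselves change under
  deletion. In the same spirit subgraphs are vertex sets of one fixed relation, so that deleting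
  vertices never creates a new graph.\<close>

definition indep :: "('a \<Rightarrow> 'a \<Rightarrow> bool) \<Rightarrow> 'a set \<Rightarrow> bool" where
  "indep E S \<longleftrightarrow> (\<forall>x\<in>S. \<forall>y\<in>S. \<not> E x y)"

definition p3free :: "('a \<Rightarrow> 'a \<Rightarrow> bool) \<Rightarrow> 'a set \<Rightarrow> bool" where
  "p3free E B \<longleftrightarrow> (\<forall>x\<in>B. \<forall>y\<in>B. \<forall>z\<in>B. E x y \<longrightarrow> E y z \<longrightarrow> x \<noteq> z \<longrightarrow> E x z)"

text \<open>The four vertices are automatically distinct: in a loop-free symmetric relation every
  coincidence contradicts one of the six conditions.\<close>

definition p4free :: "('a \<Rightarrow> 'a \<Rightarrow> bool) \<Rightarrow> 'a set \<Rightarrow> bool" where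
  "p4free E V \<longleftrightarrow> (\<forall>a\<in>V. \<forall>b\<in>V. \<forall>c\<in>V. \<forall>d\<in>V.
     \<not> (E a b \<and> E b c \<and> E c d \<and> \<not> E a c \<and> \<not> E a d \<and> \<not> E b d))"

text \<open>Transitivity of non-adjacency. With symmetry and no loops it is an equivalence whose
  classes are the parts, so this is complete multipartiteness without naming the parts.\<close>

definition comult :: "('a \<Rightarrow> 'a \<Rightarrow> bool) \<Rightarrow> 'a set \<Rightarrow> bool" where
  "comult E A \<longleftrightarrow> (\<forall>x\<in>A. \<forall>y\<in>A. \<forall>z\<in>A. \<not> E x y \<longrightarrow> \<not> E y z \<longrightarrow> \<not> E x z)"

text \<open>Clusters are the \<open>P\<^sub>3\<close>-free graphs, and the number of components of a cluster is the size of its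
  largest independent set.\<close>
definition clus :: "('a \<Rightarrow> 'a \<Rightarrow> bool) \<Rightarrow> nat \<Rightarrow> 'a set \<Rightarrow> bool" where
  "clus E k B \<longleftrightarrow> p3free E B \<and> (\<forall>S\<subseteq>B. indep E S \<longrightarrow> card S \<le> k)"

definition pol1 :: "('a \<Rightarrow> 'a \<Rightarrow> bool) \<Rightarrow> nat \<Rightarrow> 'a set \<Rightarrow> bool" where
  "pol1 E k V \<longleftrightarrow> (\<exists>A\<subseteq>V. indep E A \<and> clus E k (V - A))"

text \<open>The usual name for (1, \<infinity>)-polarity: the number of cliques is not
  bounded.\<close>

definition monopolar :: "('a \<Rightarrow> 'a \<Rightarrow> bool) \<Rightarrow> 'a set \<Rightarrow> bool" where
  "monopolar E V \<longleftrightarrow> (\<exists>A\<subseteq>V. indep E A \<and> p3free E (V - A))"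

definition polinf :: "('a \<Rightarrow> 'a \<Rightarrow> bool) \<Rightarrow> nat \<Rightarrow> 'a set \<Rightarrow> bool" where
  "polinf E k V \<longleftrightarrow> (\<exists>A\<subseteq>V. comult E A \<and> clus E k (V - A))"

text \<open>Disjointness is built in, so that the pair presents \<open>X \<union> Y\<close> as a
  disjoint union of graphs.\<close>

definition nonadj :: "('a \<Rightarrow> 'a \<Rightarrow> bool) \<Rightarrow> 'a set \<Rightarrow> 'a set \<Rightarrow> bool" where
  "nonadj E X Y \<longleftrightarrow> X \<inter> Y = {} \<and> (\<forall>x\<in>X. \<forall>y\<in>Y. \<not> E x y)"

definition alladj :: "('a \<Rightarrow> 'a \<Rightarrow> bool) \<Rightarrow> 'a set \<Rightarrow> 'a set \<Rightarrow> bool" where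
  "alladj E X Y \<longleftrightarrow> X \<inter> Y = {} \<and> (\<forall>x\<in>X. \<forall>y\<in>Y. E x y)"

text \<open>Connectivity by cuts rather than paths, the form that fits the decomposition of
  cographs. The empty set is excluded, as it is for connected digraphs.\<close>

definition conn :: "('a \<Rightarrow> 'a \<Rightarrow> bool) \<Rightarrow> 'a set \<Rightarrow> bool" where
  "conn E V \<longleftrightarrow> V \<noteq> {} \<and> (\<forall>X Y. X \<union> Y = V \<longrightarrow> nonadj E X Y \<longrightarrow> X = {} \<or> Y = {})"

text \<open>The induced graph on \<open>W\<close> is \<open>nK\<^sub>2\<close>: unique neighbours
  make every component an edge, and the size fixes their number.\<close>

definition matching :: "('a \<Rightarrow> 'a \<Rightarrow> bool) \<Rightarrow> nat \<Rightarrow> 'a set \<Rightarrow> bool" where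
  "matching E n W \<longleftrightarrow> finite W \<and> card W = 2 * n \<and>
     (\<forall>x\<in>W. \<exists>y\<in>W. E x y \<and> (\<forall>z\<in>W. E x z \<longrightarrow> z = y))"

section \<open>Heredity\<close>

lemma indep_mono: "indep E T \<Longrightarrow> S \<subseteq> T \<Longrightarrow> indep E S"
  unfolding indep_def by blast

lemma p3free_mono: "p3free E T \<Longrightarrow> S \<subseteq> T \<Longrightarrow> p3free E S"
  unfolding p3free_def by blast

lemma p4free_mono: "p4free E T \<Longrightarrow> S \<subseteq> T \<Longrightarrow> p4free E S"
  unfolding p4free_def by blast

lemma comult_mono: "comult E T \<Longrightarrow> S \<subseteq> T \<Longrightarrow> comult E S"
  unfolding comult_def by blast

lemma clus_mono: "clus E i T \<Longrightarrow> S \<subseteq> T \<Longrightarrow> i \<le> j \<Longrightarrow> clus E j S"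
  unfolding clus_def using p3free_mono by (meson order.trans)

lemma clus_indep_card: "clus E k B \<Longrightarrow> S \<subseteq> B \<Longrightarrow> indep E S \<Longrightarrow> card S \<le> k"
  unfolding clus_def by blast

lemma pol1_mono:
  assumes "pol1 E i T" "S \<subseteq> T" "i \<le> j" shows "pol1 E j S"
proof -
  obtain A where "A \<subseteq> T" "indep E A" "clus E i (T - A)"
    using assms(1) unfolding pol1_def by blast
  then have "indep E (A \<inter> S)" "clus E j (S - A \<inter> S)"
    using assms by (auto elim!: indep_mono clus_mono)
  then show ?thesis unfolding pol1_def by blast
qed

lemma monopolar_mono:
  assumes "monopolar E T" "S \<subseteq> T" shows "monopolar E S"
proof -
  obtain A where "A \<subseteq> T" "indep E A" "p3free E (T - A)"
    using assms(1) unfolding monopolar_def by blast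
  then have "indep E (A \<inter> S)" "p3free E (S - A \<inter> S)"
    using assms by (auto elim!: indep_mono p3free_mono)
  then show ?thesis unfolding monopolar_def by blast
qed

lemma polinf_mono:
  assumes "polinf E i T" "S \<subseteq> T" "i \<le> j" shows "polinf E j S"
proof -
  obtain A where "A \<subseteq> T" "comult E A" "clus E i (T - A)"
    using assms(1) unfolding polinf_def by blast
  then have "comult E (A \<inter> S)" "clus E j (S - A \<inter> S)"
    using assms by (auto elim!: comult_mono clus_mono)
  then show ?thesis unfolding polinf_def by blast
qed

lemma pol1_imp_polinf: "pol1 E k V \<Longrightarrow> polinf E k V"
  unfolding pol1_def polinf_def comult_def indep_def by blast

lemma pol1_imp_monopolar: "pol1 E k V \<Longrightarrow> monopolar E V"
  unfolding pol1_def monopolar_def clus_def by blast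

lemma clus_imp_pol1: "clus E k V \<Longrightarrow> pol1 E k V"
  unfolding pol1_def indep_def by (intro exI[of _ "{}"]) auto

lemma monopolar_imp_pol1:
  assumes "finite V" "monopolar E V" shows "\<exists>k. pol1 E k V"
proof -
  obtain A where A: "A \<subseteq> V" "indep E A" "p3free E (V - A)"
    using assms unfolding monopolar_def by blast
  then have "clus E (card V) (V - A)"
    unfolding clus_def using assms(1) by (meson Diff_subset card_mono order.trans)
  then show ?thesis using A unfolding pol1_def by blast
qed

lemma nonadj_Un_indep:
  assumes "nonadj E X Y" "nonadj E Y X" "indep E A" "indep E B" "A \<subseteq> X" "B \<subseteq> Y"
  shows "indep E (A \<union> B)"
  using assms unfolding nonadj_def indep_def by blast

section \<open>Disjoint unions of loop-free symmetric relations\<close>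

locale sgraph =
  fixes E :: "'a \<Rightarrow> 'a \<Rightarrow> bool"
  assumes sym: "E x y \<Longrightarrow> E y x" and irr: "\<not> E x x"
begin

lemma nonadj_sym: "nonadj E X Y \<Longrightarrow> nonadj E Y X"
  unfolding nonadj_def using sym by blast

lemma indep_Un:
  assumes "nonadj E X Y" "indep E A" "indep E B" "A \<subseteq> X" "B \<subseteq> Y"
  shows "indep E (A \<union> B)"
  using nonadj_Un_indep[OF assms(1) nonadj_sym[OF assms(1)]] assms by blast

lemma p3free_Un:
  assumes "nonadj E X Y" "p3free E X" "p3free E Y"
  shows "p3free E (X \<union> Y)"
  using assms nonadj_sym[OF assms(1)] unfolding nonadj_def p3free_def by blast

lemma clus_Un:
  assumes "finite X" "finite Y" "nonadj E X Y" "clus E i X" "clus E j Y"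
  shows "clus E (i + j) (X \<union> Y)"
  unfolding clus_def
proof (intro conjI allI impI)
  show "p3free E (X \<union> Y)" using assms p3free_Un unfolding clus_def by blast
  fix S assume S: "S \<subseteq> X \<union> Y" "indep E S"
  have "S = (S \<inter> X) \<union> (S \<inter> Y)" using S by blast
  then have "card S \<le> card (S \<inter> X) + card (S \<inter> Y)" by (metis card_Un_le)
  also have "\<dots> \<le> i + j"
    using assms(4,5) S indep_mono[OF S(2)] by (intro add_mono clus_indep_card) auto
  finally show "card S \<le> i + j" .
qed

lemma pol1_Un:
  assumes "finite X" "finite Y" "nonadj E X Y" "pol1 E i X" "pol1 E j Y"
  shows "pol1 E (i + j) (X \<union> Y)"
proof -
  obtain A B where A: "A \<subseteq> X" "indep E A" "clus E i (X - A)"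
    and B: "B \<subseteq> Y" "indep E B" "clus E j (Y - B)"
    using assms unfolding pol1_def by blast
  have eq: "X \<union> Y - (A \<union> B) = (X - A) \<union> (Y - B)"
    using A(1) B(1) assms(3) unfolding nonadj_def by blast
  have "clus E (i + j) (X \<union> Y - (A \<union> B))"
    unfolding eq using A B assms by (intro clus_Un) (auto simp: nonadj_def)
  moreover have "indep E (A \<union> B)" using indep_Un[OF assms(3)] A B by blast
  ultimately show ?thesis using A B unfolding pol1_def by (intro exI[of _ "A \<union> B"]) auto
qed

text \<open>\<open>i\<close> is the largest size of an independent set in \<open>X\<close>. An
  extremal set there extends any independent set of \<open>Y\<close>, which leaves at most
  \<open>n - i\<close> vertices for the latter; the slack goes to \<open>Y\<close>, so the sum is
  exactly \<open>n\<close>.\<close>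

lemma clus_UnD:
  assumes "finite X" "finite Y" "nonadj E X Y" "clus E n (X \<union> Y)"
  shows "\<exists>i j. i + j = n \<and> clus E i X \<and> clus E j Y"
proof -
  define N where "N = card ` {S. S \<subseteq> X \<and> indep E S}"
  have fin: "finite N" unfolding N_def using assms(1) by simp
  have ne: "N \<noteq> {}" unfolding N_def by (auto simp: indep_def)
  obtain S where S: "S \<subseteq> X" "indep E S" "card S = Max N"
    using Max_in[OF fin ne] unfolding N_def by auto
  have X: "clus E (Max N) X" unfolding clus_def
  proof (intro conjI allI impI)
    show "p3free E X" using assms(4) p3free_mono unfolding clus_def by blast
    fix T assume "T \<subseteq> X" "indep E T"
    then show "card T \<le> Max N" by (intro Max_ge[OF fin]) (auto simp: N_def)
  qed
  have le: "Max N + card T \<le> n" if "T \<subseteq> Y" "indep E T" for T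
  proof -
    have "card (S \<union> T) \<le> n"
      using indep_Un[OF assms(3)] S that by (intro clus_indep_card[OF assms(4)]) auto
    moreover have "card (S \<union> T) = card S + card T"
      using S that assms(1,2,3) unfolding nonadj_def
      by (intro card_Un_disjoint) (auto intro: finite_subset)
    ultimately show ?thesis using S by simp
  qed
  have "Max N \<le> n" using le[of "{}"] by (simp add: indep_def)
  moreover have "clus E (n - Max N) Y"
    unfolding clus_def
  proof (intro conjI allI impI)
    show "p3free E Y" using assms(4) p3free_mono unfolding clus_def by blast
    fix T assume "T \<subseteq> Y" "indep E T"
    then show "card T \<le> n - Max N" using le[of T] by simp
  qed
  ultimately show ?thesis using X by (intro exI[of _ "Max N"] exI[of _ "n - Max N"]) auto
qed

lemma pol1_UnD:
  assumes "finite X" "finite Y" "nonadj E X Y" "pol1 E n (X \<union> Y)"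
  shows "\<exists>i j. i + j = n \<and> pol1 E i X \<and> pol1 E j Y"
proof -
  obtain A where A: "A \<subseteq> X \<union> Y" "indep E A" "clus E n (X \<union> Y - A)"
    using assms unfolding pol1_def by blast
  have eq: "X \<union> Y - A = (X - A) \<union> (Y - A)" by blast
  have "nonadj E (X - A) (Y - A)" using assms(3) unfolding nonadj_def by blast
  from clus_UnD[OF _ _ this, of n] A(3)
  obtain i j where "i + j = n" "clus E i (X - A)" "clus E j (Y - A)"
    using assms(1,2) unfolding eq by auto
  moreover have "X - A = X - A \<inter> X" "Y - A = Y - A \<inter> Y" by auto
  ultimately show ?thesis using A indep_mono[OF A(2)] unfolding pol1_def
    by (metis Int_lower1 Int_lower2)
qed

lemma pol1_0: "pol1 E 0 V \<longleftrightarrow> indep E V" if "finite V"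
proof
  assume "pol1 E 0 V"
  then obtain A where A: "A \<subseteq> V" "indep E A" "clus E 0 (V - A)" unfolding pol1_def by blast
  have "x \<in> A" if "x \<in> V" for x
  proof (rule ccontr)
    assume "x \<notin> A"
    then have "card {x} \<le> 0"
      using A(3) that irr by (intro clus_indep_card[of E 0 "V - A"]) (auto simp: indep_def)
    then show False by simp
  qed
  then show "indep E V" using A indep_mono by blast
next
  assume "indep E V"
  then show "pol1 E 0 V" unfolding pol1_def
    by (intro exI[of _ V]) (auto simp: clus_def p3free_def)
qed

lemma clus_clique:
  assumes "\<And>x y. x \<in> K \<Longrightarrow> y \<in> K \<Longrightarrow> x \<noteq> y \<Longrightarrow> E x y"
  shows "clus E 1 K"
  unfolding clus_def
proof (intro conjI allI impI)
  show "p3free E K" unfolding p3free_def using assms by blast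
  fix S assume "S \<subseteq> K" "indep E S"
  then have "x = y" if "x \<in> S" "y \<in> S" for x y
    using assms that unfolding indep_def by blast
  then have "S \<subseteq> {SOME x. x \<in> S}" by (metis singleton_iff some_in_eq empty_iff subsetI)
  from card_mono[OF _ this] show "card S \<le> 1" by simp
qed

lemma clus_1D: "clus E 1 K \<Longrightarrow> x \<in> K \<Longrightarrow> y \<in> K \<Longrightarrow> x \<noteq> y \<Longrightarrow> E x y"
  using clus_indep_card[of E 1 K "{x, y}"] sym irr unfolding indep_def by fastforce

section \<open>Disjoint unions of edges\<close>

lemma matching_0: "matching E 0 W \<longleftrightarrow> W = {}"
  unfolding matching_def by (cases "W = {}") (simp_all add: card_gt_0_iff)

lemma matching_edge:
  assumes "matching E n W" "x \<in> W" "y \<in> W" "E x y"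
  shows "matching E (n - 1) (W - {x, y})" "nonadj E {x, y} (W - {x, y})" "n \<ge> 1"
proof -
  have fin: "finite W" using assms unfolding matching_def by blast
  have xy: "x \<noteq> y" using assms irr by blast
  have U: "z = y" if "z \<in> W" "E x z" for z using assms that unfolding matching_def by metis
  have U': "z = x" if "z \<in> W" "E y z" for z
    using assms that sym unfolding matching_def by metis
  have "card {x, y} \<le> card W" using assms fin by (intro card_mono) auto
  then show "n \<ge> 1" using assms(1) xy unfolding matching_def by simp
  have c: "card (W - {x, y}) = 2 * (n - 1)"
    using assms xy fin unfolding matching_def by (subst card_Diff_subset) auto
  show "nonadj E {x, y} (W - {x, y})" using U U' unfolding nonadj_def by auto
  show "matching E (n - 1) (W - {x, y})"
    unfolding matching_def
  proof (intro conjI ballI)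
    fix z assume z: "z \<in> W - {x, y}"
    then obtain w where w: "w \<in> W" "E z w" "\<forall>u\<in>W. E z u \<longrightarrow> u = w"
      using assms(1) unfolding matching_def by blast
    then have "w \<in> W - {x, y}" using U U' z sym by blast
    then show "\<exists>w\<in>W - {x, y}. E z w \<and> (\<forall>u\<in>W - {x, y}. E z u \<longrightarrow> u = w)" using w by blast
  qed (use c fin in auto)
qed

lemma matching_insert:
  assumes "matching E n W" "nonadj E {x, y} W" "E x y"
  shows "matching E (Suc n) ({x, y} \<union> W)"
proof -
  have xy: "x \<noteq> y" using assms irr by blast
  have fin: "finite W" using assms unfolding matching_def by blast
  have "card ({x, y} \<union> W) = card {x, y} + card W"
    using assms fin unfolding nonadj_def by (intro card_Un_disjoint) auto
  then have "card ({x, y} \<union> W) = 2 * Suc n" using assms(1) xy unfolding matching_def by simp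
  moreover have "\<exists>v\<in>{x, y} \<union> W. E u v \<and> (\<forall>z\<in>{x, y} \<union> W. E u z \<longrightarrow> z = v)" if "u \<in> {x, y} \<union> W" for u
  proof (cases "u \<in> W")
    case True
    then obtain w where w: "w \<in> W" "E u w" "\<forall>z\<in>W. E u z \<longrightarrow> z = w"
      using assms(1) unfolding matching_def by blast
    have "\<not> E u x" "\<not> E u y" using assms(2) True sym unfolding nonadj_def by blast+
    then show ?thesis using w by blast
  next
    case False
    then have "u = x \<or> u = y" using that by blast
    then show ?thesis using assms(2,3) irr[of x] irr[of y] sym[of x y] unfolding nonadj_def by fastforce
  qed
  ultimately show ?thesis using fin unfolding matching_def by blast
qed

lemma matching_induct [consumes 1, case_names empty edge]:
  assumes "matching E n W" "P 0 {}"
    and "\<And>n x y W. matching E n W \<Longrightarrow> P n W \<Longrightarrow> nonadj E {x, y} W \<Longrightarrow> E x y \<Longrightarrow> P (Suc n) ({x, y} \<union> W)"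
  shows "P n W"
  using assms(1)
proof (induction n arbitrary: W)
  case 0
  then show ?case using assms(2) matching_0 by auto
next
  case (Suc n)
  then have "W \<noteq> {}" unfolding matching_def by auto
  then obtain x y where xy: "x \<in> W" "y \<in> W" "E x y" using Suc.prems unfolding matching_def by blast
  note m = matching_edge[OF Suc.prems xy]
  have "P (Suc n) ({x, y} \<union> (W - {x, y}))"
    using m Suc.IH xy by (intro assms(3)) auto
  moreover have "{x, y} \<union> (W - {x, y}) = W" using xy by blast
  ultimately show ?case by simp
qed

lemma matching_finite: "matching E n W \<Longrightarrow> finite W"
  unfolding matching_def by blast

lemma clus_edge: "E x y \<Longrightarrow> clus E 1 {x, y}"
  using sym by (intro clus_clique) auto

lemma pol1_edge_ge: "pol1 E i V \<Longrightarrow> x \<in> V \<Longrightarrow> y \<in> V \<Longrightarrow> E x y \<Longrightarrow> i \<ge> 1"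
  using pol1_0[of "{x, y}"] pol1_mono[of E i V "{x, y}" i] unfolding indep_def
  by (cases i) auto

lemma matching_clus: "matching E n W \<Longrightarrow> clus E n W"
proof (induction rule: matching_induct)
  case empty
  then show ?case by (simp add: clus_def p3free_def)
next
  case (edge n x y W)
  then have "clus E (1 + n) ({x, y} \<union> W)"
    by (intro clus_Un clus_edge) (auto simp: matching_def)
  then show ?case by simp
qed

lemma matching_pol1: "matching E n W \<Longrightarrow> pol1 E i W \<longleftrightarrow> n \<le> i"
proof
  assume "matching E n W" "n \<le> i"
  then show "pol1 E i W" using clus_imp_pol1[OF matching_clus] pol1_mono by blast
next
  assume "matching E n W" "pol1 E i W"
  then show "n \<le> i"
  proof (induction arbitrary: i rule: matching_induct)
    case empty
    then show ?case by simp
  next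
    case (edge n x y W)
    obtain a b where ab: "a + b = i" "pol1 E a {x, y}" "pol1 E b W"
      using pol1_UnD[OF _ _ edge.hyps(2) edge.prems] matching_finite[OF edge.hyps(1)] by auto
    then have "a \<ge> 1" using pol1_edge_ge edge by blast
    then show ?case using ab edge.IH by fastforce
  qed
qed

text \<open>An independent set misses an end of every edge; these ends are chosen.\<close>

lemma matching_indep_avoiding:
  assumes "matching E n W" "indep E A"
  shows "\<exists>S\<subseteq>W - A. indep E S \<and> card S = n"
  using assms(1)
proof (induction rule: matching_induct)
  case empty
  then show ?case by (auto simp: indep_def)
next
  case (edge n x y W)
  then obtain S where S: "S \<subseteq> W - A" "indep E S" "card S = n" by blast
  obtain z where z: "z \<in> {x, y}" "z \<notin> A" using assms(2) edge.hyps unfolding indep_def by blast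
  have "indep E ({z} \<union> S)" using edge S z irr by (intro indep_Un[OF edge.hyps(2)]) (auto simp: indep_def)
  moreover have "card ({z} \<union> S) = Suc n"
    using S z edge.hyps finite_subset[OF S(1)] unfolding nonadj_def matching_def by (auto simp: card_insert_if)
  ultimately show ?case using S z by (intro exI[of _ "{z} \<union> S"]) auto
qed

lemma matching_indep: "matching E n W \<Longrightarrow> \<exists>S\<subseteq>W. indep E S \<and> card S = n"
  using matching_indep_avoiding[of n W "{}"] by (simp add: indep_def)

text \<open>In a cluster, isolated vertices can go to the independent part and a clique with an edge
  costs one. So more than \<open>i\<close> cliques contain an edge, and one edge is taken from
  each.\<close>

lemma p3free_matching:
  assumes "finite Q" "p3free E Q" "\<not> pol1 E i Q"
  shows "\<exists>W\<subseteq>Q. matching E (Suc i) W"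
  using assms
proof (induction i arbitrary: Q)
  case 0
  then obtain x y where xy: "x \<in> Q" "y \<in> Q" "E x y" unfolding pol1_0[OF 0(1)] indep_def by blast
  have "matching E (Suc 0) ({x, y} \<union> {})"
    using xy by (intro matching_insert) (auto simp: matching_0 nonadj_def)
  then show ?case using xy by (intro exI[of _ "{x, y}"]) auto
next
  case (Suc i)
  have "\<not> pol1 E 0 Q" using Suc.prems(3) pol1_mono[of E 0 Q Q "Suc i"] by auto
  then obtain x y where xy: "x \<in> Q" "y \<in> Q" "E x y" unfolding pol1_0[OF Suc.prems(1)] indep_def by blast
  \<comment> \<open>The clique of \<open>x\<close>; removing it lowers the cost by at most one and
    leaves a cluster for the induction.\<close>
  define N where "N = {z \<in> Q. z = x \<or> E x z}"
  have P: "E a c" if "a \<in> Q" "b \<in> Q" "c \<in> Q" "E a b" "E b c" "a \<noteq> c" for a b c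
    using Suc.prems(2) that unfolding p3free_def by blast
  have "E a b" if "a \<in> N" "b \<in> N" "a \<noteq> b" for a b
    using P[of a x b] xy(1) sym[of x a] that unfolding N_def by blast
  then have cl: "pol1 E 1 N" by (intro clus_imp_pol1 clus_clique)
  have na: "nonadj E N (Q - N)" unfolding nonadj_def N_def using P xy by blast
  have "N \<union> (Q - N) = Q" unfolding N_def by blast
  then have "\<not> pol1 E i (Q - N)"
    using pol1_Un[OF _ _ na cl, of i] Suc.prems finite_subset[of _ Q] unfolding N_def by auto
  then obtain W where W: "W \<subseteq> Q - N" "matching E (Suc i) W"
    using Suc.IH[of "Q - N"] Suc.prems p3free_mono by (metis Diff_subset finite_Diff)
  have "nonadj E {x, y} W" using na W xy unfolding nonadj_def N_def by blast
  then have "matching E (Suc (Suc i)) ({x, y} \<union> W)" using W xy matching_insert by blast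
  then show ?case using W xy by (intro exI[of _ "{x, y} \<union> W"]) auto
qed

end

section \<open>Decomposition of cographs\<close>

text \<open>Adding a vertex \<open>v\<close> to a graph without edges between \<open>X\<close> and \<open>Y\<close>: an edge inside \<open>X\<close>
  from a neighbour to a non-neighbour of \<open>v\<close> forbids neighbours of \<open>v\<close> in \<open>Y\<close>.\<close>
lemma (in sgraph) p4free_insert_nonadj:
  assumes p4: "p4free E (insert v V)" and v: "v \<notin> V" and XY: "X \<union> Y = V" "nonadj E X Y" "X \<noteq> {}" "Y \<noteq> {}"
  shows "\<exists>X Y. X \<union> Y = insert v V \<and> X \<noteq> {} \<and> Y \<noteq> {} \<and> (nonadj E X Y \<or> alladj E X Y)"
proof -
  have P: "False" if "{a, b, c, d} \<subseteq> insert v V"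
     "E a b" "E b c" "E c d" "\<not> E a c" "\<not> E a d" "\<not> E b d" for a b c d
    using p4 that unfolding p4free_def by blast
  have side: ?thesis if XY: "X \<union> Y = V" "nonadj E X Y" "Y \<noteq> {}"
    and ab: "a \<in> X" "b \<in> X" "E v a" "\<not> E v b" "E a b" for X Y a b
  proof -
    have "\<not> E v y" if "y \<in> Y" for y
      using P[of y v a b] ab XY that sym nonadj_sym[OF XY(2)] unfolding nonadj_def by blast
    then have "nonadj E (insert v X) Y" using XY v unfolding nonadj_def by blast
    then show ?thesis using XY(1,3) by (intro exI[of _ "insert v X"] exI[of _ Y]) auto
  qed
  consider a b where "a \<in> V" "b \<in> V" "E v a" "\<not> E v b" "E a b"
    | "\<And>a b. a \<in> V \<Longrightarrow> b \<in> V \<Longrightarrow> E v a \<Longrightarrow> \<not> E v b \<Longrightarrow> \<not> E a b" by blast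
  then show ?thesis
  proof cases
    case 1
    then have "(a \<in> X \<and> b \<in> X) \<or> (a \<in> Y \<and> b \<in> Y)" using XY nonadj_sym unfolding nonadj_def by blast
    then show ?thesis
      using side[of X Y a b] side[of Y X a b] 1 XY nonadj_sym[OF XY(2)] by blast
  next
    case 2
    \<comment> \<open>The non-neighbours of \<open>v\<close>. No edge joins them to a neighbour of
      \<open>v\<close>, so they split off from everything else, unless there are none and
      \<open>v\<close> is joined to all of \<open>V\<close>.\<close>
    define U where "U = {x \<in> V. \<not> E v x}"
    show ?thesis
    proof (cases "U = {}")
      case True
      then have "alladj E {v} V" using v unfolding alladj_def U_def by blast
      then show ?thesis using XY by (intro exI[of _ "{v}"] exI[of _ V]) auto
    next
      case False
      have "nonadj E (insert v (V - U)) U" using v 2 unfolding nonadj_def U_def by blast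
      then show ?thesis using False by (intro exI[of _ "insert v (V - U)"] exI[of _ U]) (auto simp: U_def)
    qed
  qed
qed

definition compl :: "('a \<Rightarrow> 'a \<Rightarrow> bool) \<Rightarrow> 'a \<Rightarrow> 'a \<Rightarrow> bool" where
  "compl E x y \<longleftrightarrow> x \<noteq> y \<and> \<not> E x y"

context sgraph begin

lemma sgraph_compl: "sgraph (compl E)"
  by standard (auto simp: compl_def sym)

text \<open>\<open>P\<^sub>4\<close> is self-complementary: a path \<open>a b c d\<close> in the
  complement is the path \<open>b d a c\<close> in the graph.\<close>

lemma p4free_compl: 
  assumes "p4free E V" shows "p4free (compl E) V"
  unfolding p4free_def
proof (intro ballI notI)
  fix a b c d assume V: "a \<in> V" "b \<in> V" "c \<in> V" "d \<in> V"
    and "compl E a b \<and> compl E b c \<and> compl E c d \<and> \<not> compl E a c \<and> \<not> compl E a d \<and> \<not> compl E b d"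
  then have "E b d" "E d a" "E a c" "\<not> E b a" "\<not> E b c" "\<not> E d c"
    unfolding compl_def using sym by metis+
  then show False using assms V unfolding p4free_def by blast
qed

lemma nonadj_compl: "nonadj (compl E) X Y \<longleftrightarrow> alladj E X Y"
  unfolding nonadj_def alladj_def compl_def disjoint_iff by metis

lemma alladj_compl: "alladj (compl E) X Y \<longleftrightarrow> nonadj E X Y"
  unfolding nonadj_def alladj_def compl_def disjoint_iff by metis

lemma alladj_sym: "alladj E X Y \<Longrightarrow> alladj E Y X"
  unfolding alladj_def using sym by blast

text \<open>Seinsche's theorem: a cograph with at least two vertices, or its complement, is
  disconnected. One vertex is added to an already split set. If the old split is a join, it is a
  disjoint union in the complement, so one extension lemma serves both kinds.\<close>

theorem p4free_decomp:
  assumes "finite V" "p4free E V" "x \<in> V" "y \<in> V" "x \<noteq> y"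
  shows "\<exists>X Y. X \<union> Y = V \<and> X \<noteq> {} \<and> Y \<noteq> {} \<and> (nonadj E X Y \<or> alladj E X Y)"
  using assms
proof (induction V arbitrary: x y rule: finite_induct)
  case empty
  then show ?case by simp
next
  case (insert v V)
  show ?case
  proof (cases "\<exists>x\<in>V. \<exists>y\<in>V. x \<noteq> y")
    case True
    then obtain X Y where XY: "X \<union> Y = V" "X \<noteq> {}" "Y \<noteq> {}" "nonadj E X Y \<or> alladj E X Y"
      using insert.IH p4free_mono[OF insert.prems(1)] by (metis subset_insertI)
    show ?thesis
    proof (cases "nonadj E X Y")
      case True
      show ?thesis using p4free_insert_nonadj[OF insert.prems(1) insert.hyps(2) XY(1) True XY(2,3)] .
    next
      case False
      then have "nonadj (compl E) X Y" using XY nonadj_compl by blast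
      from sgraph.p4free_insert_nonadj[OF sgraph_compl p4free_compl[OF insert.prems(1)] insert.hyps(2) XY(1) this XY(2,3)]
      show ?thesis unfolding nonadj_compl alladj_compl by blast
    qed
  next
    case False
    then obtain w where w: "V = {w}" using insert.prems by blast
    then have "nonadj E {v} {w} \<or> alladj E {v} {w}" using insert.hyps unfolding nonadj_def alladj_def by blast
    then show ?thesis using w by (intro exI[of _ "{v}"] exI[of _ V]) auto
  qed
qed

lemma conn_p4free_join:
  assumes "finite V" "p4free E V" "conn E V" "x \<in> V" "y \<in> V" "x \<noteq> y"
  shows "\<exists>X Y. X \<union> Y = V \<and> X \<noteq> {} \<and> Y \<noteq> {} \<and> alladj E X Y"
  using p4free_decomp[OF assms(1,2,4-6)] assms(3) unfolding conn_def by blast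

end

section \<open>Removing the component \<open>P\<^sub>3\<close>\<close>

definition min_obs :: "('a set \<Rightarrow> bool) \<Rightarrow> 'a set \<Rightarrow> bool" where
  "min_obs P V \<longleftrightarrow> \<not> P V \<and> (\<forall>W. W \<subset> V \<longrightarrow> P W)"

lemma min_obs_iff:
  assumes "\<And>S T. P T \<Longrightarrow> S \<subseteq> T \<Longrightarrow> P S"
  shows "min_obs P V \<longleftrightarrow> \<not> P V \<and> (\<forall>v\<in>V. P (V - {v}))"
proof -
  have "P W" if a: "\<forall>v\<in>V. P (V - {v})" "W \<subset> V" for W
  proof -
    obtain v where v: "v \<in> V" "v \<notin> W" using a(2) by blast
    then have "W \<subseteq> V - {v}" using a(2) by blast
    then show ?thesis using assms a(1) v(1) by blast
  qed
  moreover have "V - {v} \<subset> V" if "v \<in> V" for v using that by blast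
  ultimately show ?thesis unfolding min_obs_def by blast
qed

text \<open>What remains of the minimality of \<open>P\<^sub>3 + H\<close>: the first two conditions say that it is not polar, and
  the others come from deleting a vertex of \<open>H\<close>, an end of \<open>P\<^sub>3\<close>, and the middle of \<open>P\<^sub>3\<close>.\<close>
definition good :: "('a \<Rightarrow> 'a \<Rightarrow> bool) \<Rightarrow> nat \<Rightarrow> 'a set \<Rightarrow> bool" where
  "good E k H \<longleftrightarrow> \<not> pol1 E (k - 1) H \<and> \<not> clus E k H
     \<and> (\<forall>v\<in>H. pol1 E (k - 1) (H - {v}) \<or> clus E k (H - {v}))
     \<and> polinf E (k - 1) H \<and> (pol1 E k H \<or> polinf E (k - 2) H)"

context sgraph begin

text \<open>If \<open>z\<close> were non-adjacent to both ends, transitivity would make the ends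
  non-adjacent too. This confines a multipartite part with an edge to a single component.\<close>

lemma comult_edge: "comult E A \<Longrightarrow> a \<in> A \<Longrightarrow> b \<in> A \<Longrightarrow> E a b \<Longrightarrow> z \<in> A \<Longrightarrow> E a z \<or> E b z"
  unfolding comult_def using sym by metis

text \<open>The three outcomes are: an independent multipartite part; one with an edge inside
  \<open>X\<close>, which leaves \<open>Y\<close> to the cluster; one with an edge inside
  \<open>Y\<close>, which leaves \<open>X\<close> to it.\<close>

lemma polinf_UnD:
  assumes "nonadj E X Y" "polinf E k (X \<union> Y)"
  shows "pol1 E k (X \<union> Y) \<or> clus E k Y \<or> (\<exists>A\<subseteq>Y. comult E A \<and> clus E k (X \<union> (Y - A)))"
proof -
  obtain A where A: "A \<subseteq> X \<union> Y" "comult E A" "clus E k (X \<union> Y - A)"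
    using assms(2) unfolding polinf_def by blast
  show ?thesis
  proof (cases "indep E A")
    case True
    then show ?thesis using A unfolding pol1_def by blast
  next
    case False
    then obtain a b where ab: "a \<in> A" "b \<in> A" "E a b" unfolding indep_def by blast
    have *: "E a z \<or> E b z" if "z \<in> A" for z using comult_edge[OF A(2) ab that] .
    have na: "\<not> E x y" "\<not> E y x" if "x \<in> X" "y \<in> Y" for x y
      using assms(1) nonadj_sym[OF assms(1)] that unfolding nonadj_def by blast+
    have disj: "X \<inter> Y = {}" using assms(1) unfolding nonadj_def by blast
    show ?thesis
    proof (cases "a \<in> X")
      case True
      then have "b \<in> X" using na(1)[of a b] A(1) ab by blast
      have "A \<subseteq> X"
      proof
        fix z assume "z \<in> A"
        then show "z \<in> X" using *[of z] na(1)[of a z] na(1)[of b z] True \<open>b \<in> X\<close> A(1) by blast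
      qed
      then have "Y \<subseteq> X \<union> Y - A" using disj by blast
      then show ?thesis using clus_mono[OF A(3) _ order_refl] by blast
    next
      case False
      then have "a \<in> Y" using A(1) ab(1) by blast
      then have "b \<in> Y" using na(2)[of b a] A(1) ab by blast
      have AY: "A \<subseteq> Y"
      proof
        fix z assume "z \<in> A"
        then show "z \<in> Y" using *[of z] na(2)[of z a] na(2)[of z b] \<open>a \<in> Y\<close> \<open>b \<in> Y\<close> A(1) by blast
      qed
      then have "X \<union> Y - A = X \<union> (Y - A)" using disj by blast
      then show ?thesis using A AY by metis
    qed
  qed
qed

lemma clus_ne: "clus E i X \<Longrightarrow> x \<in> X \<Longrightarrow> i \<ge> 1"
  using clus_indep_card[of E i X "{x}"] irr unfolding indep_def by auto

lemma clus_ne2: "clus E i X \<Longrightarrow> x \<in> X \<Longrightarrow> y \<in> X \<Longrightarrow> x \<noteq> y \<Longrightarrow> \<not> E x y \<Longrightarrow> i \<ge> 2"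
  using clus_indep_card[of E i X "{x, y}"] irr sym unfolding indep_def by fastforce

lemma clus_card: "finite X \<Longrightarrow> indep E X \<Longrightarrow> clus E (card X) X"
  unfolding clus_def p3free_def indep_def by (auto intro: card_mono)

context
  fixes a b c P H
  assumes P: "P = {a, b, c}" and e: "E a b" "E b c" "\<not> E a c" "a \<noteq> c"
  and fin: "finite H" and na: "nonadj E P H"
begin

lemma not_p3free_P3: "P \<subseteq> V \<Longrightarrow> \<not> clus E k V"
  unfolding clus_def p3free_def using P e by blast

lemma indep_ends: "indep E {a, c}"
  unfolding indep_def using e irr sym by blast

lemma pol1_P3: "pol1 E i P \<longleftrightarrow> 1 \<le> i"
proof
  assume "pol1 E i P"
  then show "1 \<le> i" using pol1_edge_ge[of i P a b] P e by blast
next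
  assume "1 \<le> i"
  have "P - {a, c} \<subseteq> {b}" using P by blast
  moreover have "clus E 1 {b}" by (rule clus_clique) auto
  ultimately have "clus E i (P - {a, c})" using clus_mono[of E 1 "{b}"] \<open>1 \<le> i\<close> by blast
  then show "pol1 E i P" unfolding pol1_def using indep_ends P by (intro exI[of _ "{a, c}"]) auto
qed

lemma comult_P3: "comult E P"
proof -
  have "\<not> E c a" "E b a" "E c b" using e sym by blast+
  then show ?thesis unfolding comult_def P using e irr by auto
qed

lemma polinf_P3_Un:
  assumes "k \<ge> 1" "H' \<subseteq> H"
  shows "polinf E k (P \<union> H') \<longleftrightarrow> pol1 E (k - 1) H' \<or> clus E k H'"
proof
  have na': "nonadj E P H'" using na assms(2) unfolding nonadj_def by blast
  have fin': "finite H'" "finite P" using fin assms(2) P finite_subset by auto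
  {
    assume "polinf E k (P \<union> H')"
    from polinf_UnD[OF na' this] not_p3free_P3
    consider "pol1 E k (P \<union> H')" | "clus E k H'" by blast
    then show "pol1 E (k - 1) H' \<or> clus E k H'"
    proof cases
      case 1
      then obtain i j where ij: "i + j = k" "pol1 E i P" "pol1 E j H'"
        using pol1_UnD[OF fin'(2,1) na'] by blast
      \<comment> \<open>\<open>P\<close> contains an edge and so uses up at least one of the
        \<open>k\<close> cliques.\<close>
      then have "j \<le> k - 1" using pol1_P3 by auto
      then show ?thesis using pol1_mono[OF ij(3) subset_refl] by blast
    qed simp
  }
  assume "pol1 E (k - 1) H' \<or> clus E k H'"
  then show "polinf E k (P \<union> H')"
  proof
    assume "pol1 E (k - 1) H'"
    then have "pol1 E (1 + (k - 1)) (P \<union> H')" using pol1_P3 by (intro pol1_Un fin' na') auto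
    then show ?thesis using assms(1) pol1_imp_polinf by simp
  next
    assume "clus E k H'"
    moreover have "P \<union> H' - P = H'" using na' unfolding nonadj_def by blast
    ultimately show ?thesis unfolding polinf_def using comult_P3 by (intro exI[of _ P]) auto
  qed
qed

end

text \<open>Deleting an end of \<open>P\<^sub>3\<close> leaves an edge, which costs one clique when
  the multipartite part lies in \<open>H\<close> or is independent. A multipartite part containing
  the edge would leave \<open>H\<close> to the cluster, which the last hypothesis forbids.\<close>

lemma polinf_edge_Un:
  assumes "E x y" "finite H" "nonadj E {x, y} H" "k \<ge> 1" "\<not> clus E k H"
  shows "polinf E k ({x, y} \<union> H) \<longleftrightarrow> polinf E (k - 1) H"
proof
  assume "polinf E k ({x, y} \<union> H)"
  from polinf_UnD[OF assms(3) this] assms(5)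
  consider "pol1 E k ({x, y} \<union> H)" | A where "A \<subseteq> H" "comult E A" "clus E k ({x, y} \<union> (H - A))"
    by blast
  then show "polinf E (k - 1) H"
  proof cases
    case 1
    then obtain i j where ij: "i + j = k" "pol1 E i {x, y}" "pol1 E j H"
      using pol1_UnD[OF _ assms(2,3)] by blast
    then have "j \<le> k - 1" using pol1_edge_ge[OF ij(2) _ _ assms(1)] by auto
    then show ?thesis using pol1_mono[OF ij(3) subset_refl] pol1_imp_polinf by blast
  next
    case 2
    have "nonadj E {x, y} (H - A)" using assms(3) unfolding nonadj_def by blast
    then obtain i j where ij: "i + j = k" "clus E i {x, y}" "clus E j (H - A)"
      using clus_UnD[of "{x, y}" "H - A" k] 2 assms(2) by auto
    then have "j \<le> k - 1" using clus_ne[OF ij(2), of x] by auto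
    then show ?thesis using clus_mono[OF ij(3) subset_refl] 2 unfolding polinf_def by blast
  qed
next
  assume "polinf E (k - 1) H"
  then obtain A where A: "A \<subseteq> H" "comult E A" "clus E (k - 1) (H - A)" unfolding polinf_def by blast
  have "clus E (1 + (k - 1)) ({x, y} \<union> (H - A))"
    using A assms clus_edge by (intro clus_Un) (auto simp: nonadj_def)
  moreover have "{x, y} \<union> (H - A) = {x, y} \<union> H - A" using A(1) assms(3) unfolding nonadj_def by blast
  ultimately show "polinf E k ({x, y} \<union> H)" using A assms(4) unfolding polinf_def by (intro exI[of _ A]) auto
qed

text \<open>Deleting the middle of \<open>P\<^sub>3\<close> leaves two isolated vertices. They are
  free for an independent multipartite part, but cost two cliques when that part has an edge in
  \<open>H\<close>; hence the two terms on the right.\<close>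

lemma polinf_nonedge_Un:
  assumes "\<not> E x y" "x \<noteq> y" "finite H" "nonadj E {x, y} H" "k \<ge> 2"
  shows "polinf E k ({x, y} \<union> H) \<longleftrightarrow> pol1 E k H \<or> polinf E (k - 2) H"
proof
  assume "polinf E k ({x, y} \<union> H)"
  from polinf_UnD[OF assms(4) this]
  consider "pol1 E k ({x, y} \<union> H)" | "clus E k H" 
    | A where "A \<subseteq> H" "comult E A" "clus E k ({x, y} \<union> (H - A))"
    by blast
  then show "pol1 E k H \<or> polinf E (k - 2) H"
  proof cases
    case 1
    then show ?thesis using pol1_mono[of E k "{x, y} \<union> H" H k] by auto
  next
    case 2
    then show ?thesis using clus_imp_pol1 by blast
  next
    case 3
    have "nonadj E {x, y} (H - A)" using assms(4) unfolding nonadj_def by blast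
    then obtain i j where ij: "i + j = k" "clus E i {x, y}" "clus E j (H - A)"
      using clus_UnD[of "{x, y}" "H - A" k] 3 assms(3) by auto
    then have "j \<le> k - 2" using clus_ne2[OF ij(2), of x y] assms by auto
    then show ?thesis using clus_mono[OF ij(3) subset_refl] 3 unfolding polinf_def by blast
  qed
next
  have ind: "indep E {x, y}" unfolding indep_def using assms(1) sym irr by blast
  assume "pol1 E k H \<or> polinf E (k - 2) H"
  then show "polinf E k ({x, y} \<union> H)"
  proof
    assume "pol1 E k H"
    then have "pol1 E (0 + k) ({x, y} \<union> H)" using ind pol1_0 assms by (intro pol1_Un) auto
    then show ?thesis using pol1_imp_polinf by simp
  next
    assume "polinf E (k - 2) H"
    then obtain A where A: "A \<subseteq> H" "comult E A" "clus E (k - 2) (H - A)" unfolding polinf_def by blast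
    have "clus E 2 {x, y}" using clus_card[OF _ ind] assms(2) by (simp add: numeral_2_eq_2)
    then have "clus E (2 + (k - 2)) ({x, y} \<union> (H - A))"
      using A assms by (intro clus_Un) (auto simp: nonadj_def)
    moreover have "{x, y} \<union> (H - A) = {x, y} \<union> H - A" using A(1) assms(4) unfolding nonadj_def by blast
    moreover have "2 + (k - 2) = k" using assms(5) by simp
    ultimately have "clus E k ({x, y} \<union> H - A)" by metis
    then show ?thesis using A unfolding polinf_def by blast
  qed
qed

theorem min_obs_P3_Un:
  assumes k: "k \<ge> 2" and P: "P = {a, b, c}" and e: "E a b" "E b c" "\<not> E a c" "a \<noteq> c"
    and fin: "finite H" and na: "nonadj E P H"
  shows "min_obs (polinf E k) (P \<union> H) \<longleftrightarrow> good E k H"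
proof -
  have ne: "a \<noteq> b" "b \<noteq> c" using e irr by blast+
  have disj: "a \<notin> H" "b \<notin> H" "c \<notin> H" using na P unfolding nonadj_def by blast+
  have eqs: "P \<union> H - {a} = {b, c} \<union> H" "P \<union> H - {c} = {a, b} \<union> H" "P \<union> H - {b} = {a, c} \<union> H"
    using P e(4) ne disj by auto
  have nas: "nonadj E {b, c} H" "nonadj E {a, b} H" "nonadj E {a, c} H"
    using na P unfolding nonadj_def by auto
  have top: "polinf E k (P \<union> H) \<longleftrightarrow> pol1 E (k - 1) H \<or> clus E k H"
    using polinf_P3_Un[OF P e fin na _ subset_refl] k by simp
  have "polinf E k (P \<union> H - {v}) \<longleftrightarrow> pol1 E (k - 1) (H - {v}) \<or> clus E k (H - {v})" if "v \<in> H" for v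
  proof -
    have "P \<union> H - {v} = P \<union> (H - {v})" using na that unfolding nonadj_def by blast
    then show ?thesis using polinf_P3_Un[OF P e fin na, of k "H - {v}"] k by auto
  qed
  moreover have "(\<forall>v\<in>P \<union> H. polinf E k (P \<union> H - {v})) \<longleftrightarrow> (\<forall>v\<in>H. polinf E k (P \<union> H - {v}))
     \<and> polinf E k ({b, c} \<union> H) \<and> polinf E k ({a, b} \<union> H) \<and> polinf E k ({a, c} \<union> H)"
    using eqs P by (metis (no_types, lifting) Un_iff insertCI insertE singletonD)
  moreover have "polinf E k ({b, c} \<union> H) \<longleftrightarrow> polinf E (k - 1) H" "polinf E k ({a, b} \<union> H) \<longleftrightarrow> polinf E (k - 1) H"
    if "\<not> clus E k H"
    using polinf_edge_Un[OF e(2) fin nas(1)] polinf_edge_Un[OF e(1) fin nas(2)] that k by auto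
  moreover have "polinf E k ({a, c} \<union> H) \<longleftrightarrow> pol1 E k H \<or> polinf E (k - 2) H"
    using polinf_nonedge_Un[OF e(3,4) fin nas(3) k] .
  moreover have "min_obs (polinf E k) (P \<union> H) \<longleftrightarrow> \<not> polinf E k (P \<union> H) \<and> (\<forall>v\<in>P \<union> H. polinf E k (P \<union> H - {v}))"
    by (rule min_obs_iff) (rule polinf_mono, auto)
  ultimately show ?thesis unfolding good_def using top by auto
qed

end

section \<open>Necessity of the four alternatives\<close>

definition shape1 :: "('a \<Rightarrow> 'a \<Rightarrow> bool) \<Rightarrow> nat \<Rightarrow> 'a set \<Rightarrow> bool" where
  "shape1 E k H \<longleftrightarrow> (\<exists>a b c W. E a b \<and> E b c \<and> \<not> E a c \<and> a \<noteq> c \<and> nonadj E {a, b, c} W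
     \<and> matching E (k - 1) W \<and> H = {a, b, c} \<union> W)"

text \<open>The hub with its four neighbours is the butterfly, two triangles sharing the vertex
  \<open>v\<close>.\<close>

definition shape2 :: "('a \<Rightarrow> 'a \<Rightarrow> bool) \<Rightarrow> nat \<Rightarrow> 'a set \<Rightarrow> bool" where
  "shape2 E k H \<longleftrightarrow> (\<exists>v M W. alladj E {v} M \<and> matching E 2 M \<and> nonadj E (insert v M) W
     \<and> matching E (k - 2) W \<and> H = insert v M \<union> W)"

context sgraph begin

text \<open>Both alternatives pass to subsets, so a set violating both cannot omit a vertex of
  \<open>H\<close>. In this way a configuration found inside \<open>H\<close> is recognised as all
  of \<open>H\<close>.\<close>

lemma good_minimal:
  assumes "good E k H" "S \<subseteq> H" "\<not> pol1 E (k - 1) S" "\<not> clus E k S"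
  shows "S = H"
proof (rule ccontr)
  assume "S \<noteq> H"
  then obtain v where v: "v \<in> H" "S \<subseteq> H - {v}" using assms(2) by blast
  then consider "pol1 E (k - 1) (H - {v})" | "clus E k (H - {v})" using assms(1) unfolding good_def by blast
  then show False
  proof cases
    case 1
    then show ?thesis using pol1_mono[OF 1 v(2) order_refl] assms by blast
  next
    case 2
    then show ?thesis using clus_mono[OF 2 v(2) order_refl] assms by blast
  qed
qed

lemma not_clus_P3: "a \<in> V \<Longrightarrow> b \<in> V \<Longrightarrow> c \<in> V \<Longrightarrow> E a b \<Longrightarrow> E b c \<Longrightarrow> \<not> E a c \<Longrightarrow> a \<noteq> c \<Longrightarrow> \<not> clus E k V"
  unfolding clus_def p3free_def by blast

lemma P3_Un_matching:
  assumes "E a b" "E b c" "\<not> E a c" "a \<noteq> c" "nonadj E {a, b, c} W" "matching E n W"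
  shows "pol1 E i ({a, b, c} \<union> W) \<longleftrightarrow> Suc n \<le> i"
proof
  assume "pol1 E i ({a, b, c} \<union> W)"
  then obtain p q where "p + q = i" "pol1 E p {a, b, c}" "pol1 E q W"
    using pol1_UnD[OF _ matching_finite[OF assms(6)] assms(5)] by blast
  then show "Suc n \<le> i" using matching_pol1[OF assms(6)] pol1_edge_ge[of p "{a, b, c}" a b] assms(1) by auto
next
  assume "Suc n \<le> i"
  have "pol1 E 1 {a, b, c}" using pol1_P3[OF refl assms(1-4) finite.emptyI, of 1] by (simp add: nonadj_def)
  then have "pol1 E (1 + n) ({a, b, c} \<union> W)"
    using assms matching_pol1[OF assms(6), of n] matching_finite by (intro pol1_Un) auto
  then show "pol1 E i ({a, b, c} \<union> W)" using pol1_mono[OF _ subset_refl] \<open>Suc n \<le> i\<close> by auto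
qed

text \<open>Each of the two edges keeps an end outside \<open>A\<close>; if \<open>v\<close> were
  outside as well, these two ends and \<open>v\<close> would form an induced
  \<open>P\<^sub>3\<close> in the cluster part.\<close>

lemma hub_in_indep:
  assumes "indep E A" "p3free E (V - A)" "{v, a, b, c, d} \<subseteq> V" "E a b" "E c d"
    "nonadj E {a, b} {c, d}" "E v a" "E v b" "E v c" "E v d"
  shows "v \<in> A"
proof (rule ccontr)
  assume "v \<notin> A"
  obtain x where x: "x \<in> {a, b}" "x \<notin> A" using assms(1,4) unfolding indep_def by blast
  obtain y where y: "y \<in> {c, d}" "y \<notin> A" using assms(1,5) unfolding indep_def by blast
  have "E x v" "E v y" using x y assms(7-10) sym by blast+
  moreover have "\<not> E x y" "x \<noteq> y" using x y assms(6) unfolding nonadj_def by blast+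
  moreover have "x \<in> V - A" "y \<in> V - A" "v \<in> V - A" using x y assms(3) \<open>v \<notin> A\<close> by blast+
  ultimately show False using assms(2) unfolding p3free_def by blast
qed

lemma matching_2D:
  assumes "matching E 2 M"
  shows "\<exists>a b c d. M = {a, b, c, d} \<and> E a b \<and> E c d \<and> nonadj E {a, b} {c, d}"
proof -
  have "M \<noteq> {}" using assms unfolding matching_def by auto
  then obtain a b where ab: "a \<in> M" "b \<in> M" "E a b" using assms unfolding matching_def by blast
  note m = matching_edge[OF assms ab]
  then have "M - {a, b} \<noteq> {}" unfolding matching_def by fastforce
  then obtain c d where cd: "c \<in> M - {a, b}" "d \<in> M - {a, b}" "E c d" using m(1) unfolding matching_def by blast
  have "M - {a, b} - {c, d} = {}" using matching_edge(1)[OF m(1) cd] matching_0 by simp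
  then have eq: "M - {a, b} = {c, d}" using cd by blast
  then have "M = {a, b, c, d}" using ab by blast
  moreover have "nonadj E {a, b} {c, d}" using m(2) eq by simp
  ultimately show ?thesis using ab cd by blast
qed

text \<open>The hub is forced into the independent part, which leaves both edges to the cluster;
  conversely that choice works.\<close>

lemma pol1_butterfly:
  assumes "alladj E {v} M" "matching E 2 M"
  shows "pol1 E i (insert v M) \<longleftrightarrow> 2 \<le> i"
proof
  obtain a b c d where M: "M = {a, b, c, d}" "E a b" "E c d" "nonadj E {a, b} {c, d}"
    using matching_2D[OF assms(2)] by blast
  assume "pol1 E i (insert v M)"
  then obtain A where A: "indep E A" "clus E i (insert v M - A)" unfolding pol1_def by blast
  have v: "v \<in> A"
    using A M assms(1) by (intro hub_in_indep[of A "insert v M" v a b c d]) (auto simp: clus_def alladj_def)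
  have "a \<notin> A" "c \<notin> A" using A(1) v M(1) assms(1) unfolding indep_def alladj_def by blast+
  then show "2 \<le> i" using M assms(1) by (intro clus_ne2[OF A(2), of a c]) (auto simp: nonadj_def)
next
  assume i: "2 \<le> i"
  have "insert v M - {v} = M" using assms(1) unfolding alladj_def by blast
  then have "clus E i (insert v M - {v})" using clus_mono[OF matching_clus[OF assms(2)] subset_refl i] by simp
  then show "pol1 E i (insert v M)" unfolding pol1_def using irr by (intro exI[of _ "{v}"]) (auto simp: indep_def)
qed

lemma butterfly_Un_matching:
  assumes "alladj E {v} M" "matching E 2 M" "nonadj E (insert v M) W" "matching E n W"
  shows "pol1 E i (insert v M \<union> W) \<longleftrightarrow> n + 2 \<le> i"
proof
  have fin: "finite (insert v M)" "finite W" using matching_finite assms by auto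
  {
    assume "pol1 E i (insert v M \<union> W)"
    then obtain p q where "p + q = i" "pol1 E p (insert v M)" "pol1 E q W"
      using pol1_UnD[OF fin assms(3)] by blast
    then show "n + 2 \<le> i" using matching_pol1[OF assms(4)] pol1_butterfly[OF assms(1,2)] by auto
  }
  assume "n + 2 \<le> i"
  have "pol1 E (2 + n) (insert v M \<union> W)"
    using assms matching_pol1[OF assms(4), of n] fin pol1_butterfly by (intro pol1_Un) auto
  then show "pol1 E i (insert v M \<union> W)" using pol1_mono[OF _ subset_refl] \<open>n + 2 \<le> i\<close> by auto
qed

lemma not_clus_butterfly:
  assumes "alladj E {v} M" "matching E 2 M" "insert v M \<subseteq> V"
  shows "\<not> clus E k V"
proof -
  obtain a b c d where M: "M = {a, b, c, d}" "E a b" "E c d" "nonadj E {a, b} {c, d}"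
    using matching_2D[OF assms(2)] by blast
  have "E a v" "E v c" using M(1) assms(1) sym unfolding alladj_def by blast+
  then show ?thesis using M assms(3) by (intro not_clus_P3[of a V v c]) (auto simp: nonadj_def)
qed

text \<open>\<open>W\<close> supplies \<open>k\<close> independent vertices; a vertex of
  \<open>Q\<close> without a neighbour in \<open>W\<close> would be one more.\<close>

lemma matching_clus_adjacent:
  assumes "clus E k Q" "matching E k W" "W \<subseteq> Q" "q \<in> Q"
  shows "\<exists>w\<in>W. E q w"
proof (rule ccontr)
  assume no: "\<not> (\<exists>w\<in>W. E q w)"
  have qW: "q \<notin> W" using no assms(2) unfolding matching_def by blast
  obtain S where S: "S \<subseteq> W" "indep E S" "card S = k" using matching_indep[OF assms(2)] by blast
  have "indep E ({q} \<union> S)"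
    using no qW S irr by (intro indep_Un[of "{q}" W]) (auto simp: nonadj_def indep_def)
  then have "card ({q} \<union> S) \<le> k" using S assms(3,4) by (intro clus_indep_card[OF assms(1)]) auto
  moreover have "card ({q} \<union> S) = Suc k"
    using S qW matching_finite[OF assms(2)] finite_subset[OF S(1)] by (auto simp: card_insert_if)
  ultimately show False by simp
qed

text \<open>\<open>H - {v}\<close> is a cluster of \<open>k\<close> cliques, each containing an
  edge. If \<open>v\<close> is adjacent to only part of some clique, (1) appears. Otherwise
  \<open>v\<close> sees each clique entirely or not at all, and the number of cliques seen decides:
  none or one contradicts \<open>good\<close>, two give (2), three or more contradict
  minimality.\<close>

lemma shape_of_cluster_plus_vertex:
  assumes k: "k \<ge> 2" and fin: "finite H" and p4: "p4free E H" and g: "good E k H"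
    and v: "v \<in> H" and cl: "clus E k (H - {v})" and npol: "\<not> pol1 E (k - 1) (H - {v})"
  shows "shape1 E k H \<or> shape2 E k H"
proof -
  define Q where "Q = H - {v}"
  have p3: "E a c" if "a \<in> Q" "b \<in> Q" "c \<in> Q" "E a b" "E b c" "a \<noteq> c" for a b c
    using cl that unfolding clus_def p3free_def Q_def by blast
  obtain W where "W \<subseteq> Q" "matching E (Suc (k - 1)) W"
    using p3free_matching[of Q "k - 1"] fin cl npol unfolding Q_def clus_def by blast
  then have W: "W \<subseteq> Q" "matching E k W" using k by auto
  have finW: "finite W" using matching_finite W by blast
  have vW: "v \<notin> W" using W(1) unfolding Q_def by blast
  have adjW: "\<exists>w\<in>W. E q w" if "q \<in> Q" for q
    using matching_clus_adjacent[OF _ W(2,1) that] cl unfolding Q_def by blast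
  have H: "H = insert v Q" using v unfolding Q_def by blast
  show ?thesis
  proof (cases "\<exists>q\<in>Q. \<exists>q'\<in>Q. E q q' \<and> E v q \<and> \<not> E v q'")
    case True
    then obtain q q' where q: "q \<in> Q" "q' \<in> Q" "E q q'" "E v q" "\<not> E v q'" by blast
    obtain w where w: "w \<in> W" "E q w" using adjW q by blast
    obtain w' where w': "w' \<in> W" "E w w'" using w W(2) unfolding matching_def by blast
    \<comment> \<open>The edge from \<open>w\<close> to \<open>w'\<close> lies in the clique of
      \<open>q\<close>, so \<open>R\<close> keeps one edge from each of the other
      \<open>k - 1\<close> cliques.\<close>
    define R where "R = W - {w, w'}"
    note m = matching_edge[OF W(2) w(1) w']
    have clq: "\<not> E q z" "\<not> E q' z" "z \<noteq> q" "z \<noteq> q'" if "z \<in> R" for z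
    proof -
      have z: "z \<in> Q" "z \<noteq> w" "\<not> E w z" "z \<in> W" using that W(1) m(2) unfolding R_def nonadj_def by blast+
      have wQ: "w \<in> Q" using w W by blast
      show 1: "\<not> E q z" using p3[of w q z] z wQ q w sym[of q w] by blast
      show "z \<noteq> q" using z(3) w(2) sym by blast
      show "z \<noteq> q'" using 1 q(3) by blast
      show "\<not> E q' z" using p3[of q q' z] 1 z q \<open>z \<noteq> q\<close> by blast
    qed
    \<comment> \<open>An edge from \<open>v\<close> to \<open>z\<close> would make
      \<open>q' q v z\<close> an induced \<open>P\<^sub>4\<close>.\<close>
    have vR: "\<not> E v z" if "z \<in> R" for z
    proof
      assume "E v z"
      have "{q', q, v, z} \<subseteq> H" using that q v W unfolding R_def Q_def by blast
      moreover have "E q' q" "E q v" "\<not> E q' v" using q sym by blast+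
      ultimately show False using p4 \<open>E v z\<close> clq[OF that] unfolding p4free_def by blast
    qed
    have na: "nonadj E {v, q, q'} R" using clq vR vW unfolding nonadj_def R_def by blast
    have vq: "v \<noteq> q'" using q(2) unfolding Q_def by blast
    have mR: "matching E (k - 1) R" using m unfolding R_def by simp
    have "{v, q, q'} \<union> R = H"
    proof (rule good_minimal[OF g])
      show "{v, q, q'} \<union> R \<subseteq> H" using v q W unfolding Q_def R_def by blast
      show "\<not> pol1 E (k - 1) ({v, q, q'} \<union> R)"
        using P3_Un_matching[OF q(4,3,5) vq na mR] k by simp
      show "\<not> clus E k ({v, q, q'} \<union> R)" using q vq by (intro not_clus_P3[of v _ q q']) auto
    qed
    then show ?thesis unfolding shape1_def using q vq na mR by blast
  next
    case False
    then have closed: "E v q \<longleftrightarrow> E v q'" if "q \<in> Q" "q' \<in> Q" "E q q'" for q q'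
      using that sym[of q q'] by blast
    show ?thesis
    proof (cases "\<exists>w\<in>W. E v w")
      \<comment> \<open>\<open>H\<close> is an isolated vertex together with
        \<open>kK\<^sub>2\<close>. A multipartite part with an edge is confined to a single edge, so
        \<open>k\<close> components remain for a cluster that may only have
        \<open>k - 1\<close>.\<close>
      case noW: False
      have "{v} \<union> W = H"
      proof (rule good_minimal[OF g])
        show "{v} \<union> W \<subseteq> H" using v W unfolding Q_def by blast
        show "\<not> pol1 E (k - 1) ({v} \<union> W)"
          using pol1_mono[of E "k - 1" "{v} \<union> W" W "k - 1"] matching_pol1[OF W(2), of "k - 1"] k by auto
        show "\<not> clus E k ({v} \<union> W)"
          using matching_clus_adjacent[of k "{v} \<union> W" W v] W(2) noW by blast
      qed
      moreover have "nonadj E {v} W" using noW vW unfolding nonadj_def by blast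
      ultimately have H': "H = {v} \<union> W" "nonadj E {v} W" by simp_all
      obtain A where A: "A \<subseteq> H" "comult E A" "clus E (k - 1) (H - A)"
        using g unfolding good_def polinf_def by blast
      have "\<not> indep E A" using A g unfolding good_def pol1_def by blast
      then obtain a b where ab: "a \<in> A" "b \<in> A" "E a b" unfolding indep_def by blast
      have nv: "\<not> E v x" if "x \<in> H" for x using noW irr that H'(1) by blast
      have abW: "a \<in> W" "b \<in> W"
        using ab A(1) H'(1) nv[of b] sym[of a b] nv[of a] by blast+
      note m = matching_edge[OF W(2) abW ab(3)]
      have "A \<subseteq> {a, b}"
      proof
        fix z assume "z \<in> A"
        then have "E a z \<or> E b z" using comult_edge[OF A(2) ab] by blast
        then show "z \<in> {a, b}"
          using \<open>z \<in> A\<close> A(1) H'(1) m(2) nv[of a] nv[of b] sym[of a z] sym[of b z] abW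
          unfolding nonadj_def by blast
      qed
      then have sub: "{v} \<union> (W - {a, b}) \<subseteq> H - A" using H' abW unfolding nonadj_def by blast
      have "\<not> clus E (k - 1) ({v} \<union> (W - {a, b}))"
        using matching_clus_adjacent[of "k - 1" "{v} \<union> (W - {a, b})" "W - {a, b}" v] m(1) noW by blast
      then show ?thesis using clus_mono[OF A(3) sub order_refl] by blast
    next
      case True
      then obtain a where a: "a \<in> W" "E v a" by blast
      obtain b where b: "b \<in> W" "E a b" using a W(2) unfolding matching_def by blast
      have vb: "E v b" using closed[of a b] a b W(1) by blast
      note m = matching_edge[OF W(2) a(1) b]
      define R where "R = W - {a, b}"
      have ab_Q: "a \<in> Q" "b \<in> Q" using a b W by auto
      show ?thesis
      proof (cases "\<exists>w\<in>R. E v w")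
        \<comment> \<open>\<open>v\<close> sees only the clique of \<open>a\<close>; adding
          \<open>v\<close> enlarges this clique, so \<open>H\<close> itself would be a cluster with
          at most \<open>k\<close> components.\<close>
        case noR: False
        have nb: "E q a \<or> q = a" if q: "q \<in> Q" "E v q" for q
        proof -
          obtain w where w: "w \<in> W" "E q w" using adjW[OF q(1)] by blast
          then have "E v w" using closed[of q w] q W(1) by blast
          then have "w = a \<or> w = b" using noR w unfolding R_def by blast
          then show ?thesis using w p3[of q b a] q ab_Q sym[of a b] b by blast
        qed
        have nb2: "E x y" if "x \<in> Q" "E v x" "y \<in> Q" "E v y" "x \<noteq> y" for x y
          using nb[OF that(1,2)] nb[OF that(3,4)] p3[of x a y] that ab_Q sym[of y a] by blast
        have "p3free E H" unfolding p3free_def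
        proof (intro ballI impI)
          fix x y z assume *: "x \<in> H" "y \<in> H" "z \<in> H" "E x y" "E y z" "x \<noteq> z"
          consider "x = v" | "y = v" | "z = v" | "x \<in> Q" "y \<in> Q" "z \<in> Q" using * H by blast
          then show "E x z"
          proof cases
            case 1
            then have "y \<in> Q" "z \<in> Q" using * H irr by blast+
            then show ?thesis using closed[of y z] * 1 by blast
          next
            case 2
            then have "x \<in> Q" "z \<in> Q" using * H irr by blast+
            then show ?thesis using nb2[of x z] * 2 sym[of x v] by blast
          next
            case 3
            then have "x \<in> Q" "y \<in> Q" using * H irr by blast+
            then show ?thesis using closed[of x y] * 3 sym[of y v] sym[of v x] by blast
          qed (use p3 * in blast)
        qed
        moreover have "card S \<le> k" if S: "S \<subseteq> H" "indep E S" for S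
        proof (cases "v \<in> S")
          case False
          then have "S \<subseteq> H - {v}" using S by blast
          then show ?thesis using clus_indep_card[OF cl] S by blast
        next
          case True
          have nv: "\<not> E x v" "\<not> E v x" if "x \<in> S" for x using S(2) that True unfolding indep_def by blast+
          have na: "\<not> E x a" "\<not> E a x" "x \<noteq> a" if "x \<in> S - {v}" for x
          proof -
            have xQ: "x \<in> Q" using that S(1) H by blast
            show "\<not> E x a" using closed[of x a] xQ ab_Q a(2) nv that by blast
            then show "\<not> E a x" using sym by blast
            show "x \<noteq> a" using a(2) nv that by blast
          qed
          \<comment> \<open>Exchanging \<open>v\<close> for its neighbour \<open>a\<close> gives an
            independent set of the same size that avoids \<open>v\<close>.\<close>
          have "indep E (insert a (S - {v}))" using S(2) na irr unfolding indep_def by blast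
          moreover have "insert a (S - {v}) \<subseteq> H - {v}" using S(1) ab_Q unfolding Q_def by blast
          ultimately have "card (insert a (S - {v})) \<le> k" using clus_indep_card[OF cl] by blast
          moreover have "card (insert a (S - {v})) = card S"
            using na True finite_subset[OF S(1) fin]
            by (metis card.insert card_Suc_Diff1 finite_Diff)
          ultimately show ?thesis by simp
        qed
        ultimately have "clus E k H" unfolding clus_def by blast
        then show ?thesis using g unfolding good_def by blast
      next
        case True
        then obtain c where c: "c \<in> R" "E v c" by blast
        obtain d where d: "d \<in> R" "E c d" using c(1) m(1) unfolding matching_def R_def by blast
        have cd_Q: "c \<in> Q" "d \<in> Q" using c d W unfolding R_def by auto
        have vd: "E v d" using closed[of c d] c d cd_Q by blast
        define T where "T = R - {c, d}"
        have mR: "matching E (k - 1) R" using m unfolding R_def by blast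
        note m' = matching_edge[OF mR c(1) d]
        have mT: "matching E (k - 2) T" using m' unfolding T_def by (simp add: numeral_2_eq_2)
        have naR: "nonadj E {a, b} R" using m unfolding R_def by blast
        have naT: "nonadj E {c, d} T" using m' unfolding T_def by blast
        have nacd: "nonadj E {a, b} {c, d}" using naR c d unfolding nonadj_def by blast
        have "matching E (Suc (Suc 0)) ({a, b} \<union> ({c, d} \<union> {}))"
          using b d nacd by (intro matching_insert) (auto simp: matching_0 nonadj_def)
        moreover have "{a, b} \<union> ({c, d} \<union> {}) = {a, b, c, d}" by blast
        ultimately have m2: "matching E 2 {a, b, c, d}" by (simp only: numeral_2_eq_2)
        have hub: "alladj E {v} {a, b, c, d}"
          using a vb c vd vW W ab_Q cd_Q unfolding alladj_def Q_def by blast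
        show ?thesis
        proof (cases "\<exists>w\<in>T. E v w")
          case False
          have na: "nonadj E (insert v {a, b, c, d}) T"
            using False naR naT vW unfolding nonadj_def T_def R_def by blast
          have "insert v {a, b, c, d} \<union> T = H"
          proof (rule good_minimal[OF g])
            show "insert v {a, b, c, d} \<union> T \<subseteq> H" using v ab_Q cd_Q W unfolding T_def R_def Q_def by blast
            show "\<not> pol1 E (k - 1) (insert v {a, b, c, d} \<union> T)"
              using butterfly_Un_matching[OF hub m2 na mT] k by simp
            show "\<not> clus E k (insert v {a, b, c, d} \<union> T)" using not_clus_butterfly[OF hub m2] by blast
          qed
          then show ?thesis unfolding shape2_def using hub m2 na mT by blast
        next
          case True
          then obtain e where e: "e \<in> T" "E v e" by blast
          obtain f where f: "f \<in> T" "E e f" using e(1) mT unfolding matching_def by blast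
          define U where "U = T - {e, f}"
          note m'' = matching_edge[OF mT e(1) f]
          have mU: "matching E (k - 3) U" using m'' unfolding U_def by (simp add: numeral_3_eq_3 numeral_2_eq_2)
          have naU: "nonadj E {e, f} U" using m'' unfolding U_def by blast
          have ef: "e \<noteq> f" using f irr by blast
          \<comment> \<open>Of the third edge only \<open>e\<close> is kept. The hub is forced into
            the independent part, so the cluster contains \<open>a\<close>, \<open>c\<close>,
            \<open>e\<close> and an end of each of the \<open>k - 3\<close> edges of
            \<open>U\<close>, which are \<open>k\<close> independent vertices. Hence
            \<open>S\<close> already violates both properties, although it misses
            \<open>f\<close>.\<close>
          define S where "S = {v, a, b, c, d, e} \<union> U"
          have SH: "S \<subseteq> H" using v ab_Q cd_Q e W unfolding S_def U_def T_def R_def Q_def by blast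
          have "S = H"
          proof (rule good_minimal[OF g SH])
            show "\<not> clus E k S" by (rule not_clus_butterfly[OF hub m2]) (auto simp: S_def)
            show "\<not> pol1 E (k - 1) S"
            proof
              assume "pol1 E (k - 1) S"
              then obtain A where A: "A \<subseteq> S" "indep E A" "clus E (k - 1) (S - A)" unfolding pol1_def by blast
              have vA: "v \<in> A"
                using A hub nacd b d
                by (intro hub_in_indep[of A S v a b c d]) (auto simp: clus_def alladj_def S_def)
              have nA: "a \<notin> A" "c \<notin> A" "e \<notin> A" using vA A(2) a c e unfolding indep_def by blast+
              obtain Z where Z: "Z \<subseteq> U - A" "indep E Z" "card Z = k - 3"
                using matching_indep_avoiding[OF mU A(2)] by blast
              have "nonadj E {a, c, e} U"
                using naU naR naT unfolding nonadj_def U_def T_def R_def by auto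
              moreover have "indep E {a, c, e}"
              proof -
                have "\<not> E a c" "\<not> E a e" "\<not> E c e"
                  using nacd naR naT e unfolding nonadj_def T_def by auto
                then show ?thesis using irr sym unfolding indep_def by blast
              qed
              ultimately have "indep E ({a, c, e} \<union> Z)" using Z by (intro indep_Un[of "{a, c, e}" U]) auto
              then have "card ({a, c, e} \<union> Z) \<le> k - 1"
                using nA Z by (intro clus_indep_card[OF A(3)]) (auto simp: S_def)
              moreover have "card ({a, c, e} \<union> Z) = card {a, c, e} + card Z"
                using Z \<open>nonadj E {a, c, e} U\<close> finite_subset[OF Z(1)] matching_finite[OF mU]
                by (intro card_Un_disjoint) (auto simp: nonadj_def)
              moreover have "a \<noteq> c" "a \<noteq> e" "c \<noteq> e"
                using nacd naR naT e unfolding nonadj_def T_def by auto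
              then have "card {a, c, e} = 3" by simp
              \<comment> \<open>\<open>m''(3)\<close> gives \<open>k - 2 \<ge> 1\<close>, so
                truncated subtraction is harmless and the two sizes add up to
                \<open>k\<close>.\<close>
              ultimately show False using Z m''(3) by linarith
            qed
          qed
          moreover have "f \<notin> S" using f ef vW naR naT unfolding S_def U_def T_def R_def nonadj_def by auto
          moreover have "f \<in> H" using f W unfolding T_def R_def Q_def by blast
          ultimately show ?thesis by blast
        qed
      qed
    qed
  qed
qed

end

text \<open>Proper subsets of a minimal (1, j)-polar obstruction are monopolar, so the clause on
  \<open>monopolar\<close> amounts to \<open>D\<close> itself being monopolar.\<close>

definition shape3 :: "('a \<Rightarrow> 'a \<Rightarrow> bool) \<Rightarrow> nat \<Rightarrow> 'a set \<Rightarrow> bool" where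
  "shape3 E k H \<longleftrightarrow> (\<exists>j\<in>{1..k - 1}. \<exists>W D. nonadj E W D \<and> matching E (k - j - 1) W \<and> conn E D
     \<and> min_obs (pol1 E j) D \<and> \<not> min_obs (monopolar E) D \<and> H = W \<union> D)"

definition shape4 :: "('a \<Rightarrow> 'a \<Rightarrow> bool) \<Rightarrow> nat \<Rightarrow> 'a set \<Rightarrow> bool" where
  "shape4 E k H \<longleftrightarrow> k \<ge> 3 \<and> min_obs (monopolar E) H"

lemma min_obs_pol1_iff: "min_obs (pol1 E j) V \<longleftrightarrow> \<not> pol1 E j V \<and> (\<forall>v\<in>V. pol1 E j (V - {v}))"
  by (rule min_obs_iff) (rule pol1_mono, auto)

lemma min_obs_monopolar_iff: "min_obs (monopolar E) V \<longleftrightarrow> \<not> monopolar E V \<and> (\<forall>v\<in>V. monopolar E (V - {v}))"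
  by (rule min_obs_iff) (rule monopolar_mono)

context sgraph begin

text \<open>A complete multipartite graph with at most one part of two or more vertices splits into
  this part and a clique. So two parts have at least two vertices each, and these span a
  four-cycle.\<close>

lemma pol1_1_comult_C4:
  assumes "finite H" "comult E H" "\<not> pol1 E 1 H"
  shows "\<exists>a b c d. {a, b, c, d} \<subseteq> H \<and> a \<noteq> c \<and> b \<noteq> d \<and> \<not> E a c \<and> \<not> E b d \<and> E a b \<and> E a d \<and> E c b \<and> E c d"
proof -
  have cm: "\<not> E x z" if "x \<in> H" "y \<in> H" "z \<in> H" "\<not> E x y" "\<not> E y z" for x y z
    using assms(2) that unfolding comult_def by blast
  have "\<not> clus E 1 H" using assms(3) clus_imp_pol1 by blast
  then obtain a c where ac: "a \<in> H" "c \<in> H" "a \<noteq> c" "\<not> E a c" using clus_clique[of H] by blast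
  define A where "A = {x \<in> H. \<not> E a x}"
  have "indep E A"
    unfolding indep_def
  proof (intro ballI)
    fix x y assume "x \<in> A" "y \<in> A"
    then show "\<not> E x y" using cm[of x a y] sym[of x a] ac(1) unfolding A_def by blast
  qed
  moreover have "A \<subseteq> H" unfolding A_def by blast
  ultimately have "\<not> clus E 1 (H - A)" using assms(3) unfolding pol1_def by blast
  then obtain b d where bd: "b \<in> H - A" "d \<in> H - A" "b \<noteq> d" "\<not> E b d" using clus_clique[of "H - A"] by blast
  then have "E a b" "E a d" unfolding A_def by blast+
  moreover then have "E c b" "E c d" using cm[of a c b] cm[of a c d] ac bd by blast+
  ultimately show ?thesis using ac bd by blast
qed

lemma C4_polarity:
  assumes "a \<noteq> c" "b \<noteq> d" "\<not> E a c" "\<not> E b d" "E a b" "E a d" "E c b" "E c d"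
  shows "\<not> pol1 E 1 {a, b, c, d}" "monopolar E {a, b, c, d}"
proof
  assume "pol1 E 1 {a, b, c, d}"
  then obtain A where A: "indep E A" "clus E 1 ({a, b, c, d} - A)" unfolding pol1_def by blast
  have cl: "E x y" if "x \<in> {a, b, c, d} - A" "y \<in> {a, b, c, d} - A" "x \<noteq> y" for x y
    using clus_1D[OF A(2) that] .
  have "a \<in> A \<or> c \<in> A" "b \<in> A \<or> d \<in> A" using cl[of a c] cl[of b d] assms(1-4) by blast+
  moreover have "\<not> E x y" if "x \<in> A" "y \<in> A" for x y using A(1) that unfolding indep_def by blast
  ultimately show False using assms(5-8) by blast
next
  have "\<not> E c a" "\<not> E d b" using assms(3,4) sym by blast+
  then have "indep E {a, c}" "p3free E {b, d}" using assms(3,4) irr unfolding indep_def p3free_def by auto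
  moreover have "{a, b, c, d} - {a, c} = {b, d}" using assms irr by blast
  ultimately show "monopolar E {a, b, c, d}" unfolding monopolar_def by (intro exI[of _ "{a, c}"]) auto
qed

text \<open>The complement of the component is a maximal vertex set that misses \<open>a\<close> and
  sends no edge to the rest; a cut of what remains would enlarge it.\<close>

lemma component_of:
  assumes "finite V" "a \<in> V"
  shows "\<exists>D W. D \<union> W = V \<and> nonadj E W D \<and> a \<in> D \<and> conn E D"
proof -
  define F where "F = {W. W \<subseteq> V \<and> a \<notin> W \<and> nonadj E W (V - W)}"
  have "finite F" "{} \<in> F" unfolding F_def nonadj_def using assms by auto
  then obtain W where W: "W \<in> F" "\<And>U. U \<in> F \<Longrightarrow> W \<subseteq> U \<Longrightarrow> U = W"
    using finite_has_maximal2[of F "{}"] by metis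
  have *: "Y = {}" if XY: "X \<union> Y = V - W" "nonadj E X Y" "a \<in> X" for X Y
  proof -
    have "nonadj E (W \<union> Y) (V - (W \<union> Y))"
      using W(1) XY nonadj_sym[OF XY(2)] unfolding nonadj_def F_def by blast
    moreover have "a \<notin> W \<union> Y" using W(1) XY(2,3) unfolding nonadj_def F_def by blast
    ultimately have "W \<union> Y \<in> F" using W(1) XY(1) unfolding F_def by blast
    then have "W \<union> Y = W" using W(2) by blast
    then show "Y = {}" using XY(1) by blast
  qed
  have "conn E (V - W)"
    unfolding conn_def
  proof (intro conjI allI impI)
    show "V - W \<noteq> {}" using W(1) assms(2) unfolding F_def by blast
    fix X Y assume XY: "X \<union> Y = V - W" "nonadj E X Y"
    have "a \<in> V - W" using W(1) assms(2) unfolding F_def by blast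
    then consider "a \<in> X" | "a \<in> Y" using XY(1) by blast
    then show "X = {} \<or> Y = {}"
    proof cases
      case 1
      then show ?thesis using *[OF XY] by blast
    next
      case 2
      then show ?thesis using *[of Y X] XY nonadj_sym[OF XY(2)] by blast
    qed
  qed
  moreover have "(V - W) \<union> W = V" "nonadj E W (V - W)" "a \<in> V - W" using W(1) assms(2) unfolding F_def by auto
  ultimately show ?thesis by blast
qed

text \<open>A non-monopolar \<open>H\<close> is (4). Otherwise the multipartite part has an edge and
  lies in one component \<open>D\<close>, the rest \<open>W\<close> belongs to the cluster, and
  minimality turns every clique of \<open>W\<close> into an edge. These \<open>t\<close> edges cost
  \<open>t\<close>, which leaves \<open>j = k - 1 - t\<close> for \<open>D\<close>.\<close>

lemma shape_of_pol1_minimal: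
  assumes k: "k \<ge> 2" and fin: "finite H" and g: "good E k H"
    and sub: "\<And>v. v \<in> H \<Longrightarrow> pol1 E (k - 1) (H - {v})"
  shows "shape3 E k H \<or> shape4 E k H"
proof -
  have npol: "\<not> pol1 E (k - 1) H" using g unfolding good_def by blast
  have mini: "S = H" if S: "S \<subseteq> H" "\<not> pol1 E (k - 1) S" for S
  proof (rule ccontr)
    assume "S \<noteq> H"
    then obtain v where "v \<in> H" "S \<subseteq> H - {v}" using S(1) by blast
    then show False using pol1_mono[OF sub[of v] _ order_refl] S(2) by blast
  qed
  show ?thesis
  proof (cases "monopolar E H")
    case False
    have mo: "min_obs (monopolar E) H"
      unfolding min_obs_monopolar_iff using False sub pol1_imp_monopolar by blast
    \<comment> \<open>For \<open>k = 2\<close> the condition from the middle of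
      \<open>P\<^sub>3\<close> would make \<open>H\<close> complete multipartite. It would then
      contain a four-cycle, which is not (1, 1)-polar, so \<open>H\<close> would be that four-cycle;
      but this is monopolar.\<close>
    have "k \<noteq> 2"
    proof
      assume "k = 2"
      have "\<not> pol1 E k H" using False pol1_imp_monopolar by blast
      then have "polinf E 0 H" using g \<open>k = 2\<close> unfolding good_def by simp
      then obtain A where A: "A \<subseteq> H" "comult E A" "clus E 0 (H - A)" unfolding polinf_def by blast
      have "x \<notin> H - A" for x using clus_ne[OF A(3), of x] by auto
      then have "A = H" using A(1) by blast
      then obtain a b c d where abcd: "{a, b, c, d} \<subseteq> H" "a \<noteq> c" "b \<noteq> d" "\<not> E a c" "\<not> E b d"
        "E a b" "E a d" "E c b" "E c d"
        using pol1_1_comult_C4[of H] fin A npol \<open>k = 2\<close> by auto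
      note C = C4_polarity[OF abcd(2-9)]
      have "{a, b, c, d} = H" using C(1) \<open>k = 2\<close> by (intro mini abcd(1)) simp
      then show False using C(2) False by simp
    qed
    then show ?thesis using mo k unfolding shape4_def by simp
  next
    case mono: True
    obtain A where A: "A \<subseteq> H" "comult E A" "clus E (k - 1) (H - A)"
      using g unfolding good_def polinf_def by blast
    have "\<not> indep E A" using A npol unfolding pol1_def by blast
    then obtain a b where ab: "a \<in> A" "b \<in> A" "E a b" unfolding indep_def by blast
    obtain D W where D: "D \<union> W = H" "nonadj E W D" "a \<in> D" "conn E D"
      using component_of[OF fin, of a] ab A by blast
    have na: "\<not> E x y" "\<not> E y x" "x \<noteq> y" if "x \<in> W" "y \<in> D" for x y
      using D(2) nonadj_sym[OF D(2)] that unfolding nonadj_def by blast+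
    have bD: "b \<in> D" using na(2)[of b a] ab D A(1) by blast
    have AD: "A \<subseteq> D"
    proof
      fix z assume z: "z \<in> A"
      then have "E a z \<or> E b z" using comult_edge[OF A(2) ab] by blast
      then show "z \<in> D" using z A(1) D(1,3) bD na(2)[of z a] na(2)[of z b] by blast
    qed
    have finD: "finite D" "finite W" using fin D(1) by auto
    have WB: "W \<subseteq> H - A" using AD D(1,2) unfolding nonadj_def by blast
    have p3: "E x z" if "x \<in> W" "y \<in> W" "z \<in> W" "E x y" "E y z" "x \<noteq> z" for x y z
      using A(3) that WB unfolding clus_def p3free_def by blast
    \<comment> \<open>An isolated vertex can be added to the independent part, so its deletion
      cannot restore polarity.\<close>
    have ex: "\<exists>y\<in>W. E x y" if x: "x \<in> W" for x
    proof (rule ccontr)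
      assume no: "\<not> (\<exists>y\<in>W. E x y)"
      have "nonadj E {x} (H - {x})" using no na(1)[OF x] D(1) unfolding nonadj_def by blast
      moreover have "pol1 E 0 {x}" using irr by (simp add: pol1_0 indep_def)
      moreover have "pol1 E (k - 1) (H - {x})" using sub x D(1) by blast
      ultimately have "pol1 E (0 + (k - 1)) ({x} \<union> (H - {x}))" using fin by (intro pol1_Un) auto
      moreover have "{x} \<union> (H - {x}) = H" using x D(1) by blast
      ultimately show False using npol by simp
    qed
    \<comment> \<open>A clique with three vertices still contains an edge after deletion of
      \<open>z\<close> and costs one before and after, so deleting \<open>z\<close> cannot restore
      polarity.\<close>
    have un: "y = z" if xyz: "x \<in> W" "y \<in> W" "z \<in> W" "E x y" "E x z" for x y z
    proof (rule ccontr)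
      assume "y \<noteq> z"
      define N where "N = {u \<in> W. u = x \<or> E x u}"
      have NH: "N \<subseteq> H" "N \<subseteq> W" using D(1) unfolding N_def by blast+
      have clN: "E u w" if "u \<in> N" "w \<in> N" "u \<noteq> w" for u w
        using p3[of u x w] that sym[of x u] xyz(1) unfolding N_def by blast
      have naN: "nonadj E N (H - N)" unfolding nonadj_def
      proof (intro conjI ballI notI)
        fix u w assume "u \<in> N" "w \<in> H - N" "E u w"
        then have "w \<in> W" using na(1)[of u w] NH D(1) by blast
        then show False
          using p3[of x u w] \<open>u \<in> N\<close> \<open>w \<in> H - N\<close> \<open>E u w\<close> xyz(1) unfolding N_def by blast
      qed blast
      have zN: "z \<in> N" "y \<in> N" "x \<in> N" using xyz unfolding N_def by blast+
      have "z \<noteq> x" using xyz irr by blast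
      have finN: "finite N" "finite (H - N)" using fin NH finite_subset by blast+
      have "nonadj E (N - {z}) (H - N)" using naN unfolding nonadj_def by blast
      moreover have "(N - {z}) \<union> (H - N) = H - {z}" using NH zN by blast
      moreover have "z \<in> H" using zN NH by blast
      ultimately obtain i j where ij: "i + j = k - 1" "pol1 E i (N - {z})" "pol1 E j (H - N)"
        using pol1_UnD[of "N - {z}" "H - N" "k - 1"] finN sub[of z] by auto
      have "1 \<le> i" using pol1_edge_ge[OF ij(2), of x y] zN \<open>z \<noteq> x\<close> \<open>y \<noteq> z\<close> xyz by blast
      have "pol1 E 1 N" using clN by (intro clus_imp_pol1 clus_clique)
      then have "pol1 E (1 + j) (N \<union> (H - N))" using pol1_Un[OF finN naN] ij by blast
      moreover have "N \<union> (H - N) = H" using NH by blast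
      ultimately show False using npol pol1_mono[of E "1 + j" H H "k - 1"] ij(1) \<open>1 \<le> i\<close> by simp
    qed
    have "matching E (card W div 2) W"
    proof -
      have "\<exists>n. matching E n W"
      proof -
        have sc: "\<exists>n. matching E n U" if "U \<subseteq> W" "\<And>x. x \<in> U \<Longrightarrow> \<exists>y\<in>U. E x y" for U
          using finite_subset[OF that(1) finD(2)] that
        proof (induction U rule: finite_psubset_induct)
          case (psubset U)
          show ?case
          proof (cases "U = {}")
            case True
            then show ?thesis using matching_0 by blast
          next
            case False
            then obtain x y where xy: "x \<in> U" "y \<in> U" "E x y" using psubset.prems by blast
            have xyW: "x \<in> W" "y \<in> W" "E y x" using xy psubset.prems(1) sym by blast+
            have nb: "\<not> E x u" "\<not> E y u" if "u \<in> U - {x, y}" for u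
            proof -
              have "u \<in> W" using that psubset.prems(1) by blast
              then show "\<not> E x u" "\<not> E y u"
                using un[of x y u] un[of y x u] xyW xy(3) that by blast+
            qed
            have "\<exists>v\<in>U - {x, y}. E u v" if "u \<in> U - {x, y}" for u
              using psubset.prems(2)[of u] nb[OF that] sym[of u x] sym[of u y] that by blast
            then obtain n where n: "matching E n (U - {x, y})"
              using psubset.IH[of "U - {x, y}"] xy psubset.prems(1) by blast
            have "nonadj E {x, y} (U - {x, y})" using nb unfolding nonadj_def by blast
            from matching_insert[OF n this xy(3)]
            have "matching E (Suc n) ({x, y} \<union> (U - {x, y}))" .
            moreover have "{x, y} \<union> (U - {x, y}) = U" using xy by blast
            ultimately show ?thesis by auto
          qed
        qed
        show ?thesis using sc[of W] ex by blast
      qed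
      then show ?thesis unfolding matching_def by auto
    qed
    then obtain t where t: "matching E t W" by blast
    have naD: "nonadj E D W" using D nonadj_sym by blast
    \<comment> \<open>With \<open>k - 1\<close> edges in \<open>W\<close>, the edge from
      \<open>a\<close> to \<open>b\<close> in \<open>D\<close> would complete a set that is not (1,
      k - 1)-polar, hence all of \<open>H\<close>; then \<open>H\<close> would be a cluster with
      \<open>k\<close> components. So something is left for \<open>D\<close>, that is
      \<open>1 \<le> j\<close>.\<close>
    have tk: "t \<le> k - 2"
    proof (rule ccontr)
      assume "\<not> t \<le> k - 2"
      then have tge: "t \<ge> k - 1" by simp
      have nab: "nonadj E {a, b} W" using naD D bD unfolding nonadj_def by blast
      note m = matching_insert[OF t nab ab(3)]
      have "{a, b} \<union> W = H"
        using matching_pol1[OF m, of "k - 1"] tge k D bD by (intro mini) auto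
      moreover have "\<not> t \<ge> k"
      proof
        assume "t \<ge> k"
        then have "\<not> pol1 E (k - 1) W" using matching_pol1[OF t] k by simp
        then have "W = H" using D(1) by (intro mini) auto
        then show False using D(1,2,3) unfolding nonadj_def by blast
      qed
      moreover have "Suc t = k" using calculation(2) tge k by simp
      ultimately have "clus E k H" using matching_clus[OF m] by simp
      then show False using g unfolding good_def by blast
    qed
    define j where "j = k - 1 - t"
    have jt: "j + t = k - 1" "1 \<le> j" "j \<le> k - 1" "k - j - 1 = t" using tk k unfolding j_def by auto
    have "\<not> pol1 E j D"
    proof
      assume "pol1 E j D"
      then have "pol1 E (j + t) (D \<union> W)" using matching_pol1[OF t, of t] by (intro pol1_Un finD naD) auto
      then show False using npol jt D(1) by simp
    qed
    moreover have "pol1 E j (D - {v})" if "v \<in> D" for v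
    proof -
      have "(D - {v}) \<union> W = H - {v}" using D that unfolding nonadj_def by blast
      moreover have "nonadj E (D - {v}) W" using naD unfolding nonadj_def by blast
      moreover have "v \<in> H" using D that by blast
      ultimately obtain p q where pq: "p + q = k - 1" "pol1 E p (D - {v})" "pol1 E q W"
        using pol1_UnD[of "D - {v}" W "k - 1"] finD sub[of v] by auto
      then have "p \<le> j" using matching_pol1[OF t] jt by auto
      then show ?thesis using pol1_mono[OF pq(2) subset_refl] by blast
    qed
    ultimately have "min_obs (pol1 E j) D" unfolding min_obs_pol1_iff by blast
    moreover have "\<not> min_obs (monopolar E) D"
      using monopolar_mono[OF mono, of D] D(1) unfolding min_obs_def by blast
    ultimately have "shape3 E k H"
      unfolding shape3_def using jt t D by (intro bexI[of _ j] exI[of _ W] exI[of _ D]) auto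
    then show ?thesis by blast
  qed
qed

theorem good_shape:
  assumes "k \<ge> 2" "finite H" "p4free E H" "good E k H"
  shows "shape1 E k H \<or> shape2 E k H \<or> shape3 E k H \<or> shape4 E k H"
proof (cases "\<forall>v\<in>H. pol1 E (k - 1) (H - {v})")
  case True
  then show ?thesis using shape_of_pol1_minimal[OF assms(1,2,4)] by blast
next
  case False
  then obtain v where v: "v \<in> H" "\<not> pol1 E (k - 1) (H - {v})" by blast
  then have "clus E k (H - {v})" using assms(4) unfolding good_def by blast
  then show ?thesis using shape_of_cluster_plus_vertex[OF assms v(1) _ v(2)] by blast
qed

end

section \<open>Sufficiency of the first three alternatives\<close>

context sgraph begin

section \<open>Alternatives (1) and (2) are good\<close>

lemma matching_remove:
  assumes "matching E n W" "v \<in> W"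
  shows "pol1 E (n - 1) (W - {v})" "n \<ge> 1"
proof -
  obtain w where w: "w \<in> W" "E v w" using assms unfolding matching_def by blast
  note m = matching_edge[OF assms w]
  \<comment> \<open>The partner of \<open>v\<close> becomes isolated and costs nothing.\<close>
  have "pol1 E 0 {w}" using irr by (simp add: pol1_0 indep_def)
  moreover have "nonadj E {w} (W - {v, w})" using m(2) unfolding nonadj_def by blast
  ultimately have "pol1 E (0 + (n - 1)) ({w} \<union> (W - {v, w}))"
    using matching_pol1[OF m(1)] matching_finite[OF m(1)] by (intro pol1_Un) auto
  moreover have "{w} \<union> (W - {v, w}) = W - {v}" using w irr by blast
  ultimately show "pol1 E (n - 1) (W - {v})" by simp
  show "n \<ge> 1" using m(3) .
qed

lemma p3free_imp_p4free: "p3free E V \<Longrightarrow> p4free E V"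
  unfolding p3free_def p4free_def using sym by metis

lemma p4free_Un:
  assumes "nonadj E X Y" "p4free E X" "p4free E Y"
  shows "p4free E (X \<union> Y)"
  unfolding p4free_def
proof (intro ballI notI)
  fix a b c d assume V: "a \<in> X \<union> Y" "b \<in> X \<union> Y" "c \<in> X \<union> Y" "d \<in> X \<union> Y"
    and P: "E a b \<and> E b c \<and> E c d \<and> \<not> E a c \<and> \<not> E a d \<and> \<not> E b d"
  have "x \<in> X \<longleftrightarrow> y \<in> X" if "E x y" "x \<in> X \<union> Y" "y \<in> X \<union> Y" for x y
    using assms(1) nonadj_sym[OF assms(1)] that unfolding nonadj_def by blast
  from this[of a b] this[of b c] this[of c d] V P
  have "{a, b, c, d} \<subseteq> X \<or> {a, b, c, d} \<subseteq> Y" by blast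
  then have "p4free E {a, b, c, d}" using p4free_mono[OF assms(2)] p4free_mono[OF assms(3)] by blast
  then show False using P unfolding p4free_def by simp
qed

text \<open>Dual to \<open>p4free_Un\<close> through complementation, which is an involution on
  loop-free relations.\<close>

lemma p4free_join:
  assumes "alladj E X Y" "p4free E X" "p4free E Y"
  shows "p4free E (X \<union> Y)"
proof -
  have "p4free (compl (compl E)) (X \<union> Y)"
    using assms p4free_compl nonadj_compl
    by (intro sgraph.p4free_compl[OF sgraph_compl] sgraph.p4free_Un[OF sgraph_compl]) auto
  moreover have "compl (compl E) = E" using irr unfolding compl_def by fastforce
  ultimately show ?thesis by simp
qed

lemma matching_p4free: "matching E n W \<Longrightarrow> p4free E W"
  using matching_clus p3free_imp_p4free unfolding clus_def by blast

lemma p4free_P3: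
  assumes "E a b" "E b c" "\<not> E a c" "a \<noteq> c"
  shows "p4free E {a, b, c}"
proof -
  have "p4free E ({b} \<union> {a, c})"
    using assms irr sym by (intro p4free_join) (auto simp: alladj_def p4free_def)
  then show ?thesis by (simp add: insert_commute)
qed

lemma shape1_p4free: "shape1 E k H \<Longrightarrow> p4free E H"
  unfolding shape1_def by (elim exE conjE) (hypsubst, rule p4free_Un[OF _ p4free_P3 matching_p4free])

lemma shape2_p4free:
  assumes "shape2 E k H" shows "p4free E H"
proof -
  obtain v M W where *: "alladj E {v} M" "matching E 2 M" "nonadj E (insert v M) W"
    "matching E (k - 2) W" "H = insert v M \<union> W" using assms unfolding shape2_def by blast
  have "p4free E {v}" using irr by (auto simp: p4free_def)
  then have "p4free E ({v} \<union> M)" using * matching_p4free by (intro p4free_join) auto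
  then show ?thesis unfolding *(5) using * matching_p4free by (intro p4free_Un) auto
qed

lemma shape1_good:
  assumes k: "k \<ge> 2" and "shape1 E k H" shows "good E k H"
proof -
  obtain a b c W where e: "E a b" "E b c" "\<not> E a c" "a \<noteq> c" and na: "nonadj E {a, b, c} W"
    and m: "matching E (k - 1) W" and H: "H = {a, b, c} \<union> W"
    using assms(2) unfolding shape1_def by blast
  have ne: "a \<noteq> b" "b \<noteq> c" using e irr by blast+
  have notW: "a \<notin> W" "b \<notin> W" "c \<notin> W" using na unfolding nonadj_def by blast+
  have finW: "finite W" using m matching_finite by blast
  note pol = P3_Un_matching[OF e na m]
  have s: "Suc (k - 1) = k" using k by simp
  have ends: "clus E k ({x, y} \<union> W)" if "E x y" "{x, y} \<subseteq> {a, b, c}" for x y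
  proof -
    have "nonadj E {x, y} W" using na that unfolding nonadj_def by blast
    then show ?thesis using matching_clus[OF matching_insert[OF m _ that(1)]] s by simp
  qed
  have del: "pol1 E (k - 1) (H - {v}) \<or> clus E k (H - {v})" if v: "v \<in> H" for v
  proof -
    consider "v = a" | "v = b" | "v = c" | "v \<in> W" using v H by blast
    then show ?thesis
    proof cases
      case 1
      then have "H - {v} = {b, c} \<union> W" using H ne e(4) notW by blast
      then show ?thesis using ends[OF e(2)] by simp
    next
      \<comment> \<open>Without the middle vertex the ends are isolated and cost nothing.\<close>
      case 2
      then have "H - {v} = {a, c} \<union> W" using H ne e(4) notW by blast
      moreover have "pol1 E 0 {a, c}" using e irr sym by (auto simp: pol1_0 indep_def)
      moreover have "nonadj E {a, c} W" using na unfolding nonadj_def by blast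
      ultimately show ?thesis
        using pol1_Un[of "{a, c}" W 0 "k - 1"] finW matching_pol1[OF m] by simp
    next
      case 3
      then have "H - {v} = {a, b} \<union> W" using H ne e(4) notW by blast
      then show ?thesis using ends[OF e(1)] by simp
    next
      case 4
      then have "H - {v} = {a, b, c} \<union> (W - {v})" using H notW by blast
      moreover have "pol1 E 1 {a, b, c}" using pol1_P3[OF refl e finite.emptyI, of 1] by (simp add: nonadj_def)
      moreover have "nonadj E {a, b, c} (W - {v})" using na unfolding nonadj_def by blast
      moreover note matching_remove[OF m 4]
      ultimately have "pol1 E (1 + (k - 1 - 1)) (H - {v})"
        using pol1_Un[of "{a, b, c}" "W - {v}" 1 "k - 1 - 1"] finW by simp
      moreover have "1 + (k - 1 - 1) = k - 1" using k by simp
      ultimately show ?thesis by simp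
    qed
  qed
  \<comment> \<open>With the whole \<open>P\<^sub>3\<close> as multipartite part, the cluster is
    \<open>W\<close> with its \<open>k - 1\<close> edges.\<close>
  have "{a, b, c} \<union> W - {a, b, c} = W" using notW by blast
  then have "polinf E (k - 1) H"
    unfolding polinf_def H using comult_P3[OF refl e finW na] matching_clus[OF m]
    by (intro exI[of _ "{a, b, c}"]) auto
  moreover have "\<not> clus E k H" using e H by (intro not_clus_P3[of a H b c]) auto
  ultimately show ?thesis unfolding good_def using del pol H s by auto
qed

lemma shape2_good:
  assumes k: "k \<ge> 2" and "shape2 E k H" shows "good E k H"
proof -
  obtain v M W where v: "alladj E {v} M" and M: "matching E 2 M" and na: "nonadj E (insert v M) W"
    and m: "matching E (k - 2) W" and H: "H = insert v M \<union> W" using assms(2) unfolding shape2_def by blast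
  have vM: "v \<notin> M" and Ev: "\<And>x. x \<in> M \<Longrightarrow> E v x" using v unfolding alladj_def by auto
  have disj: "v \<notin> W" "M \<inter> W = {}" using na unfolding nonadj_def by blast+
  have fin: "finite W" "finite M" using m M matching_finite by blast+
  have s: "2 + (k - 2) = k" using k by simp
  note pol = butterfly_Un_matching[OF v M na m]
  have naM: "nonadj E M W" using na unfolding nonadj_def by blast
  have half: "\<exists>y\<in>M. E x y \<and> matching E 1 (M - {x, y})" if x: "x \<in> M" for x
  proof -
    obtain y where y: "y \<in> M" "E x y" using M x unfolding matching_def by blast
    then show ?thesis using matching_edge(1)[OF M x y] by auto
  qed
  have del: "pol1 E (k - 1) (H - {x}) \<or> clus E k (H - {x})" if x: "x \<in> H" for x
  proof -
    consider "x = v" | "x \<in> M" | "x \<in> W" using x H by blast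
    then show ?thesis
    proof cases
      case 1
      then have "H - {x} = M \<union> W" using H vM disj by blast
      moreover have "clus E (2 + (k - 2)) (M \<union> W)"
        using naM fin matching_clus[OF M] matching_clus[OF m] by (intro clus_Un)
      ultimately show ?thesis using s by simp
    next
      case 2
      then obtain y where y: "y \<in> M" "E x y" "matching E 1 (M - {x, y})" using half by blast
      \<comment> \<open>After deletion of \<open>x\<close> its partner \<open>y\<close> goes to the
        independent part; the hub and the other edge form a triangle, so the damaged butterfly costs
        only one.\<close>
      define B where "B = insert v M - {x}"
      have "E p q" if "p \<in> B - {y}" "q \<in> B - {y}" "p \<noteq> q" for p q
        using clus_1D[OF matching_clus[OF y(3)], of p q] Ev[of p] Ev[of q] sym[of v p] that
        unfolding B_def by blast
      then have "clus E 1 (B - {y})" by (rule clus_clique)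
      moreover have "y \<in> B" using y irr unfolding B_def by blast
      ultimately have "pol1 E 1 B" unfolding pol1_def using irr by (intro exI[of _ "{y}"]) (auto simp: indep_def)
      moreover have "nonadj E B W" using na unfolding nonadj_def B_def by blast
      ultimately have "pol1 E (1 + (k - 2)) (B \<union> W)"
        using fin matching_pol1[OF m] by (intro pol1_Un) (auto simp: B_def)
      moreover have "B \<union> W = H - {x}" using H 2 disj unfolding B_def by blast
      moreover have "1 + (k - 2) = k - 1" using k by simp
      ultimately show ?thesis by simp
    next
      case 3
      have "pol1 E (2 + (k - 2 - 1)) (insert v M \<union> (W - {x}))"
        using fin matching_remove(1)[OF m 3] pol1_butterfly[OF v M] na
        by (intro pol1_Un) (auto simp: nonadj_def)
      moreover have "insert v M \<union> (W - {x}) = H - {x}" using H 3 disj by blast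
      moreover have "2 + (k - 2 - 1) = k - 1" using matching_remove(2)[OF m 3] by simp
      ultimately show ?thesis by simp
    qed
  qed
  have "M \<noteq> {}" using M unfolding matching_def by auto
  then obtain x where x: "x \<in> M" by blast
  then obtain y where y: "y \<in> M" "E x y" "matching E 1 (M - {x, y})" using half by blast
  \<comment> \<open>A triangle of the butterfly as multipartite part leaves the other edge and
    \<open>W\<close>, that is \<open>k - 1\<close> components.\<close>
  have "comult E {v, x, y}"
    using Ev[OF x] Ev[OF y(1)] y(2) sym[of v x] sym[of v y] sym[of x y] irr unfolding comult_def by auto
  moreover have "clus E (1 + (k - 2)) ((M - {x, y}) \<union> W)"
    using fin matching_clus[OF y(3)] matching_clus[OF m] naM by (intro clus_Un) (auto simp: nonadj_def)
  moreover have "H - {v, x, y} = (M - {x, y}) \<union> W" using H x y vM disj by blast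
  moreover have "1 + (k - 2) = k - 1" using k by simp
  moreover have "{v, x, y} \<subseteq> H" using H x y by blast
  ultimately have "polinf E (k - 1) H" unfolding polinf_def by metis
  moreover have "\<not> clus E k H" using H by (intro not_clus_butterfly[OF v M]) auto
  ultimately show ?thesis unfolding good_def using del pol H s k by auto
qed

section \<open>Joins and connected minimal obstructions\<close>

lemma conn_p3free_clique:
  assumes "conn E D" "p3free E D" "x \<in> D" "y \<in> D" "x \<noteq> y"
  shows "E x y"
proof (rule ccontr)
  assume no: "\<not> E x y"
  define N where "N = {z \<in> D. z = x \<or> E x z}"
  have "nonadj E N (D - N)" unfolding nonadj_def
  proof (intro conjI ballI notI)
    fix u w assume "u \<in> N" "w \<in> D - N" "E u w"
    then show False using assms(2,3) unfolding p3free_def N_def by blast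
  qed blast
  moreover have "N \<union> (D - N) = D" unfolding N_def by blast
  ultimately have "N = {} \<or> D - N = {}" using assms(1) unfolding conn_def by blast
  then show False using assms no unfolding N_def by blast
qed

lemma indep_alladj_side:
  assumes "alladj E X Y" "indep E A" "A \<subseteq> X \<union> Y"
  shows "A \<subseteq> X \<or> A \<subseteq> Y"
  using assms unfolding alladj_def indep_def by blast

text \<open>Two non-adjacent vertices lie in the same factor and have every vertex of the other
  factor as a common neighbour, which would be an induced \<open>P\<^sub>3\<close>.\<close>

lemma join_p3free_clique:
  assumes "alladj E X Y" "X \<noteq> {}" "Y \<noteq> {}" "p3free E (X \<union> Y)"
  shows "clus E 1 (X \<union> Y)"
proof (rule clus_clique)
  fix u w assume uw: "u \<in> X \<union> Y" "w \<in> X \<union> Y" "u \<noteq> w"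
  obtain x y where xy: "x \<in> X" "y \<in> Y" using assms by blast
  have XY: "E p q" "E q p" if "p \<in> X" "q \<in> Y" for p q
    using assms(1) alladj_sym[OF assms(1)] that unfolding alladj_def by blast+
  consider "u \<in> X" "w \<in> X" | "u \<in> Y" "w \<in> Y" | "u \<in> X" "w \<in> Y" | "u \<in> Y" "w \<in> X" using uw by blast
  then show "E u w"
  proof cases
    case 1
    then show ?thesis using assms(4) XY[of u y] XY[of w y] xy uw unfolding p3free_def by blast
  next
    case 2
    then show ?thesis using assms(4) XY[of x u] XY[of x w] xy uw unfolding p3free_def by blast
  qed (use XY in auto)
qed

text \<open>In a join with a monopolar partition \<open>(A, B)\<close>, the independent part lies in one factor \<open>X\<close>,
  and unless \<open>B\<close> is a clique it is all of \<open>X\<close>.\<close>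
lemma join_min_obs_aux:
  assumes D: "D = X \<union> Y" "alladj E X Y" "X \<noteq> {}" "Y \<noteq> {}" "finite D" and j: "j \<ge> 1"
    and npol: "\<not> pol1 E j D" and sub: "\<And>w. w \<in> D \<Longrightarrow> pol1 E j (D - {w})"
    and A: "A \<subseteq> X" "indep E A" "p3free E (D - A)"
  shows "pol1 E (Suc j) D \<and> polinf E j D"
proof -
  have np1: "\<not> pol1 E 1 D" using npol pol1_mono[of E 1 D D j] j by blast
  have disj: "X \<inter> Y = {}" and XY: "\<And>x y. x \<in> X \<Longrightarrow> y \<in> Y \<Longrightarrow> E x y \<and> E y x"
    using D(2) alladj_sym[OF D(2)] unfolding alladj_def by blast+
  have finXY: "finite X" "finite Y" using D by auto
  have AX: "A = X"
  proof (rule ccontr)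
    assume "A \<noteq> X"
    have eq: "D - A = (X - A) \<union> Y" using D(1) A(1) disj by blast
    have "clus E 1 ((X - A) \<union> Y)"
    proof (rule join_p3free_clique)
      show "alladj E (X - A) Y" using D(2) unfolding alladj_def by blast
      show "X - A \<noteq> {}" using A(1) \<open>A \<noteq> X\<close> by blast
      show "Y \<noteq> {}" using D(4) .
      show "p3free E ((X - A) \<union> Y)" using A(3) eq by simp
    qed
    then show False using np1 A D(1) eq unfolding pol1_def by auto
  qed
  have DX: "D - X = Y" "D - Y = X" using D(1) disj by blast+
  have indX: "indep E X" and p3Y: "p3free E Y" using A AX DX by simp_all
  \<comment> \<open>A larger independent set \<open>S\<close> of \<open>Y\<close> keeps more than
    \<open>j\<close> vertices when any one of them is deleted. This forces the independent part of
    the reduced graph into \<open>Y\<close> and leaves \<open>X\<close> to the cluster.\<close>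
  have "clus E (Suc j) Y"
  proof (rule ccontr)
    assume "\<not> clus E (Suc j) Y"
    then obtain S where S: "S \<subseteq> Y" "indep E S" "card S > Suc j" using p3Y unfolding clus_def by force
    have finS: "finite S" using S(1) finXY finite_subset by blast
    have step: "\<exists>A'. A' \<subseteq> Y - {w} \<and> indep E A' \<and> clus E j (X \<union> (Y - {w} - A'))" if w: "w \<in> S" for w
    proof -
      have wD: "w \<in> D" "w \<in> Y" "w \<notin> X" using w S(1) D(1) disj by blast+
      obtain A' where A': "A' \<subseteq> D - {w}" "indep E A'" "clus E j (D - {w} - A')"
        using sub[OF wD(1)] unfolding pol1_def by blast
      have "A' \<subseteq> X \<or> A' \<subseteq> Y" using indep_alladj_side[OF D(2) A'(2)] A'(1) D(1) by blast
      then show ?thesis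
      proof
        assume A'Y: "A' \<subseteq> Y"
        then have "D - {w} - A' = X \<union> (Y - {w} - A')" using D(1) disj wD by blast
        then show ?thesis using A' A'Y by (intro exI[of _ A']) auto
      next
        assume A'X: "A' \<subseteq> X"
        have card: "card (S - {w}) > j" using S(3) w finS by simp
        have Sw: "S - {w} \<subseteq> D - {w} - A'" using S(1) A'X D(1) disj by blast
        have "card (S - {w}) \<le> j"
          using clus_indep_card[OF A'(3) Sw] indep_mono[OF S(2)] by blast
        then show ?thesis using card by simp
      qed
    qed
    \<comment> \<open>\<open>S\<close> has at least three vertices because \<open>j \<ge> 1\<close>,
      and an independent set inside at most two disjoint edges has at most two. So some
      \<open>w\<close> can be deleted while such edges stay intact.\<close>
    have avoid: "\<exists>w\<in>S. w \<notin> W" if "matching E n W" "n \<le> 2" for W n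
    proof (rule ccontr)
      assume "\<not> ?thesis"
      then have "S \<subseteq> W" by blast
      then have "card S \<le> n" using clus_indep_card[OF matching_clus[OF that(1)]] S(2) by blast
      then show False using S(3) that(2) j by simp
    qed
    show False
    proof (cases "\<exists>x. X = {x}")
      \<comment> \<open>The cluster part contains \<open>x\<close>, which is adjacent to all of
        \<open>Y\<close>, so what it contains of \<open>Y\<close> is a clique and
        \<open>Y - {w}\<close> would be (1, 1)-polar. But \<open>Y\<close> contains
        \<open>2K\<^sub>2\<close>, and \<open>w\<close> is chosen outside it.\<close>
      case True
      then obtain x where x: "X = {x}" by blast
      have split: "pol1 E j' D" if "A' \<subseteq> Y" "indep E A'" "clus E j' (X \<union> (Y - A'))" for A' j'
      proof -
        have "D - A' = X \<union> (Y - A')" using that(1) D(1) disj by blast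
        then show ?thesis using that D(1) unfolding pol1_def by (intro exI[of _ A']) auto
      qed
      have cone: "clus E 1 (X \<union> K)" if "clus E 1 K" "K \<subseteq> Y" for K
      proof (rule clus_clique)
        fix p q assume "p \<in> X \<union> K" "q \<in> X \<union> K" "p \<noteq> q"
        then show "E p q"
          using x clus_1D[OF that(1), of p q] XY[of x p] XY[of x q] that(2) by blast
      qed
      have "\<not> pol1 E 1 Y"
      proof
        assume "pol1 E 1 Y"
        then obtain A' where "A' \<subseteq> Y" "indep E A'" "clus E 1 (Y - A')" unfolding pol1_def by blast
        then show False using split[of A' 1] cone[of "Y - A'"] np1 by blast
      qed
      then obtain W where "W \<subseteq> Y" "matching E (Suc 1) W" using p3free_matching[OF finXY(2) p3Y] by blast
      then have W: "W \<subseteq> Y" "matching E 2 W" by (simp_all add: numeral_2_eq_2)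
      obtain w where w: "w \<in> S" "w \<notin> W" using avoid[OF W(2)] by blast
      obtain A' where A': "A' \<subseteq> Y - {w}" "indep E A'" "clus E j (X \<union> (Y - {w} - A'))"
        using step[OF w(1)] by blast
      have "clus E 1 (Y - {w} - A')"
      proof (rule clus_clique)
        fix p q assume pq: "p \<in> Y - {w} - A'" "q \<in> Y - {w} - A'" "p \<noteq> q"
        then have "E p x" "E x q" using XY[of x p] XY[of x q] x by blast+
        then show "E p q" using A'(3) pq x unfolding clus_def p3free_def by blast
      qed
      then have "pol1 E 1 (Y - {w})" using A' unfolding pol1_def by blast
      then have "pol1 E 1 W" using pol1_mono[of E 1 "Y - {w}" W 1] W(1) w(2) by blast
      then show False using matching_pol1[OF W(2)] by simp
    next
      \<comment> \<open>Two non-adjacent vertices of \<open>X\<close> in the cluster part leave no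
        room for a vertex of \<open>Y\<close>, so \<open>Y - {w}\<close> would be independent. But
        \<open>Y\<close> has an edge, since otherwise \<open>Y\<close> could be the independent
        part, and \<open>w\<close> is chosen off this edge.\<close>
      case False
      obtain x where "x \<in> X" using D(3) by blast
      then obtain x' where x: "x \<in> X" "x' \<in> X" "x \<noteq> x'" using False by blast
      have stepX: "indep E (Y - {w}) \<and> clus E j X" if w: "w \<in> S" for w
      proof -
        obtain A' where A': "A' \<subseteq> Y - {w}" "indep E A'" "clus E j (X \<union> (Y - {w} - A'))"
          using step[OF w] by blast
        have "Y - {w} - A' = {}"
        proof (rule ccontr)
          assume "Y - {w} - A' \<noteq> {}"
          then obtain p where p: "p \<in> Y - {w} - A'" by blast
          then have "E x p" "E p x'" using XY[of x p] XY[of x' p] x by blast+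
          then have "E x x'" using A'(3) p x unfolding clus_def p3free_def by blast
          then show False using indX x unfolding indep_def by blast
        qed
        then have "A' = Y - {w}" using A'(1) by blast
        then show ?thesis using A' clus_mono[OF A'(3), of X j] by simp
      qed
      have "S \<noteq> {}" using S(3) by auto
      then have "clus E j X" using stepX by blast
      then have "\<not> indep E Y" using npol DX D(1) unfolding pol1_def by auto
      then obtain a b where ab: "a \<in> Y" "b \<in> Y" "E a b" unfolding indep_def by blast
      have "matching E (Suc 0) ({a, b} \<union> {})" using ab by (intro matching_insert) (auto simp: matching_0 nonadj_def)
      then obtain w where w: "w \<in> S" "w \<notin> {a, b}" using avoid[of "Suc 0" "{a, b}"] by auto
      then show False using stepX[OF w(1)] ab unfolding indep_def by blast
    qed
  qed
  note cY = this
  have "pol1 E (Suc j) D" unfolding pol1_def using cY indX DX D(1) by (intro exI[of _ X]) auto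
  moreover have "polinf E j D"
  proof -
    obtain y where y: "y \<in> Y" using D(4) by blast
    \<comment> \<open>A clique of the cluster \<open>Y\<close>. With \<open>X\<close> as one part
      and the vertices of \<open>Q\<close> as singleton parts, \<open>X \<union> Q\<close> is
      complete multipartite, and removing \<open>Q\<close> lowers the bound on the components of
      \<open>Y\<close> from \<open>j + 1\<close> to \<open>j\<close>.\<close>
    define Q where "Q = {z \<in> Y. z = y \<or> E y z}"
    have clQ: "E p q" if "p \<in> Q" "q \<in> Q" "p \<noteq> q" for p q
      using p3Y that y sym[of y p] unfolding p3free_def Q_def by blast
    have QY: "Q \<subseteq> Y" unfolding Q_def by blast
    have "comult E (X \<union> Q)" unfolding comult_def
    proof (intro ballI impI)
      fix p q r assume *: "p \<in> X \<union> Q" "q \<in> X \<union> Q" "r \<in> X \<union> Q" "\<not> E p q" "\<not> E q r"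
      show "\<not> E p r"
      proof (cases "q \<in> X")
        case True
        then have "p \<in> X" "r \<in> X" using * XY[of q p] XY[of q r] QY by blast+
        then show ?thesis using indX unfolding indep_def by blast
      next
        case False
        then have "q \<in> Q" using * by blast
        then have "p = q" "r = q" using * XY[of p q] XY[of r q] clQ[of p q] clQ[of q r] QY by blast+
        then show ?thesis using irr by simp
      qed
    qed
    moreover have "D - (X \<union> Q) = Y - Q" using D(1) disj by blast
    moreover have "clus E j (Y - Q)" unfolding clus_def
    proof (intro conjI allI impI)
      show "p3free E (Y - Q)" using p3free_mono[OF p3Y] by blast
      fix S assume S: "S \<subseteq> Y - Q" "indep E S"
      have "y \<notin> S" using S(1) y unfolding Q_def by blast
      moreover have "\<not> E y s" "\<not> E s y" if "s \<in> S" for s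
        using S(1) that sym[of s y] unfolding Q_def by blast+
      then have "indep E (insert y S)" using S(2) irr unfolding indep_def by blast
      then have "card (insert y S) \<le> Suc j" using S(1) y by (intro clus_indep_card[OF cY]) auto
      moreover have "finite S" using S(1) finXY(2) finite_subset by blast
      ultimately show "card S \<le> j" by simp
    qed
    moreover have "X \<union> Q \<subseteq> D" using D(1) QY by blast
    ultimately show ?thesis unfolding polinf_def by metis
  qed
  ultimately show ?thesis by blast
qed

text \<open>The independent part of a monopolar partition lies in one factor of the join, and either
  factor can play the role of \<open>X\<close>. The two conclusions serve the deletion of the middle
  and of an end of \<open>P\<^sub>3\<close>.\<close>

lemma conn_min_obs_pol1:
  assumes "finite D" "p4free E D" "conn E D" "j \<ge> 1" "min_obs (pol1 E j) D" "\<not> min_obs (monopolar E) D"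
  shows "pol1 E (Suc j) D" "polinf E j D"
proof -
  have npol: "\<not> pol1 E j D" and sub: "\<And>w. w \<in> D \<Longrightarrow> pol1 E j (D - {w})"
    using assms(5) unfolding min_obs_pol1_iff by blast+
  have "monopolar E D" using assms(6) sub pol1_imp_monopolar unfolding min_obs_monopolar_iff by blast
  then obtain A where A: "A \<subseteq> D" "indep E A" "p3free E (D - A)" unfolding monopolar_def by blast
  have "\<not> clus E 1 D" using npol pol1_mono[OF clus_imp_pol1[of E 1 D] subset_refl assms(4)] by blast
  then obtain x y where xy: "x \<in> D" "y \<in> D" "x \<noteq> y" using clus_clique[of D] by blast
  obtain X Y where D: "X \<union> Y = D" "X \<noteq> {}" "Y \<noteq> {}" "alladj E X Y"
    using conn_p4free_join[OF assms(1-3) xy] by auto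
  have "A \<subseteq> X \<or> A \<subseteq> Y" using indep_alladj_side[OF D(4) A(2)] A(1) D(1) by blast
  then have "pol1 E (Suc j) D \<and> polinf E j D"
  proof
    assume "A \<subseteq> X"
    then show ?thesis using join_min_obs_aux[OF D(1)[symmetric] D(4,2,3) assms(1,4) npol sub _ A(2,3)] by blast
  next
    assume "A \<subseteq> Y"
    moreover have "D = Y \<union> X" using D(1) by blast
    ultimately show ?thesis
      using join_min_obs_aux[OF _ alladj_sym[OF D(4)] D(3,2) assms(1,4) npol sub _ A(2,3)] by blast
  qed
  then show "pol1 E (Suc j) D" "polinf E j D" by blast+
qed

lemma polinf_Un_clus:
  assumes "finite X" "finite Y" "nonadj E X Y" "clus E i X" "polinf E j Y"
  shows "polinf E (i + j) (X \<union> Y)"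
proof -
  obtain A where A: "A \<subseteq> Y" "comult E A" "clus E j (Y - A)" using assms(5) unfolding polinf_def by blast
  have "clus E (i + j) (X \<union> (Y - A))" using assms A by (intro clus_Un) (auto simp: nonadj_def)
  moreover have "X \<union> Y - A = X \<union> (Y - A)" using assms(3) A(1) unfolding nonadj_def by blast
  ultimately show ?thesis unfolding polinf_def using A by (intro exI[of _ A]) auto
qed

lemma shape3_good:
  assumes k: "k \<ge> 2" and fin: "finite H" and p4: "p4free E H" and "shape3 E k H"
  shows "good E k H"
proof -
  obtain j W D where j: "1 \<le> j" "j \<le> k - 1" and na: "nonadj E W D" and m: "matching E (k - j - 1) W"
    and D: "conn E D" "min_obs (pol1 E j) D" "\<not> min_obs (monopolar E) D" and H: "H = W \<union> D"
    using assms(4) unfolding shape3_def by auto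
  have fD: "finite D" "finite W" "p4free E D" using fin p4 H p4free_mono by auto
  note up = conn_min_obs_pol1[OF fD(1,3) D(1) j(1) D(2,3)]
  define t where "t = k - j - 1"
  have t: "t + j = k - 1" "t + Suc j = k" using j k unfolding t_def by auto
  have mt: "matching E t W" using m unfolding t_def .
  have npD: "\<not> pol1 E j D" and sub: "\<And>v. v \<in> D \<Longrightarrow> pol1 E j (D - {v})" using D(2) unfolding min_obs_pol1_iff by blast+
  have n1: "\<not> pol1 E (k - 1) H"
  proof
    assume "pol1 E (k - 1) H"
    then obtain p q where pq: "p + q = k - 1" "pol1 E p W" "pol1 E q D"
      using pol1_UnD[OF fD(2,1) na] H by blast
    then have "q \<le> j" using matching_pol1[OF mt] t by auto
    then show False using npD pol1_mono[OF pq(3) subset_refl] by blast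
  qed
  have n2: "\<not> clus E k H"
  proof
    assume "clus E k H"
    then have "p3free E D" using p3free_mono[of E H D] H unfolding clus_def by blast
    then have "clus E 1 D" using conn_p3free_clique[OF D(1)] by (intro clus_clique) blast
    then have "pol1 E 1 D" by (rule clus_imp_pol1)
    then show False using npD pol1_mono[OF _ subset_refl j(1)] by blast
  qed
  have del: "pol1 E (k - 1) (H - {v})" if v: "v \<in> H" for v
  proof (cases "v \<in> W")
    \<comment> \<open>Deleting a vertex of \<open>W\<close> saves one clique, which pays for the
      extra one that \<open>D\<close> needs.\<close>
    case True
    then have "H - {v} = (W - {v}) \<union> D" using H na unfolding nonadj_def by blast
    moreover have "pol1 E ((t - 1) + Suc j) ((W - {v}) \<union> D)"
      using matching_remove(1)[OF mt True] up(1) fD na by (intro pol1_Un) (auto simp: nonadj_def)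
    moreover have "(t - 1) + Suc j = k - 1" using matching_remove(2)[OF mt True] t by simp
    ultimately show ?thesis by simp
  next
    case False
    then have "H - {v} = W \<union> (D - {v})" "v \<in> D" using H v by blast+
    moreover have "pol1 E (t + j) (W \<union> (D - {v}))"
      using matching_pol1[OF mt, of t] sub[OF \<open>v \<in> D\<close>] fD na by (intro pol1_Un) (auto simp: nonadj_def)
    ultimately show ?thesis using t by simp
  qed
  have "polinf E (t + j) H" unfolding H using polinf_Un_clus[OF fD(2,1) na matching_clus[OF mt] up(2)] .
  moreover have "pol1 E (t + Suc j) H"
    unfolding H using matching_pol1[OF mt, of t] up(1) fD na by (intro pol1_Un) auto
  ultimately show ?thesis unfolding good_def using n1 n2 del t by auto
qed

end

section \<open>Minimal non-monopolar cographs\<close>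

context sgraph begin

definition is_C4 :: "'a \<Rightarrow> 'a \<Rightarrow> 'a \<Rightarrow> 'a \<Rightarrow> bool" where
  "is_C4 a b c d \<longleftrightarrow> a \<noteq> c \<and> b \<noteq> d \<and> \<not> E a c \<and> \<not> E b d \<and> E a b \<and> E a d \<and> E c b \<and> E c d"

definition is_2K2 :: "'a \<Rightarrow> 'a \<Rightarrow> 'a \<Rightarrow> 'a \<Rightarrow> bool" where
  "is_2K2 a b c d \<longleftrightarrow> E a b \<and> E c d \<and> nonadj E {a, b} {c, d}"

definition is_P3 :: "'a \<Rightarrow> 'a \<Rightarrow> 'a \<Rightarrow> bool" where
  "is_P3 a b c \<longleftrightarrow> E a b \<and> E b c \<and> \<not> E a c \<and> a \<noteq> c"

text \<open>\<open>A\<close> and \<open>B\<close> may overlap and exceed \<open>V\<close>, so that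
  the same few sets certify several vertex deletions.\<close>

lemma pol1_coverI: "indep E A \<Longrightarrow> clus E k B \<Longrightarrow> V \<subseteq> A \<union> B \<Longrightarrow> pol1 E k V"
  unfolding pol1_def
  by (intro exI[of _ "A \<inter> V"] conjI indep_mono[of E A "A \<inter> V"] clus_mono[of E k B "V - A \<inter> V" k]) auto

lemma polinf_coverI: "comult E A \<Longrightarrow> clus E k B \<Longrightarrow> V \<subseteq> A \<union> B \<Longrightarrow> polinf E k V"
  unfolding polinf_def
  by (intro exI[of _ "A \<inter> V"] conjI comult_mono[of E A "A \<inter> V"] clus_mono[of E k B "V - A \<inter> V" k]) auto

lemma comult_clique: "clus E 1 A \<Longrightarrow> comult E A"
  unfolding comult_def using clus_1D irr by metis

lemma not_p3free: "\<not> p3free E V \<longleftrightarrow> (\<exists>a b c. {a, b, c} \<subseteq> V \<and> is_P3 a b c)"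
  unfolding p3free_def is_P3_def by auto

lemma clus_join:
  assumes "alladj E X Y" "clus E 1 X" "clus E 1 Y"
  shows "clus E 1 (X \<union> Y)"
proof (rule clus_clique)
  fix p q assume "p \<in> X \<union> Y" "q \<in> X \<union> Y" "p \<noteq> q"
  then show "E p q"
    using assms(1) alladj_sym[OF assms(1)] clus_1D[OF assms(2), of p q] clus_1D[OF assms(3), of p q]
    unfolding alladj_def by blast
qed

text \<open>(1, 1)-polar graphs are the split graphs. In a disjoint union one side has no edge, for
  otherwise a \<open>2K\<^sub>2\<close> appears; in a join one side is a clique, for otherwise a
  four-cycle does. A side of this kind is absorbed by the partition of the other.\<close>

lemma p4free_split:
  assumes "finite V" "p4free E V" "\<And>a b c d. {a, b, c, d} \<subseteq> V \<Longrightarrow> \<not> is_C4 a b c d \<and> \<not> is_2K2 a b c d"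
  shows "pol1 E 1 V"
  using assms
proof (induction V rule: finite_psubset_induct)
  case (psubset V)
  show ?case
  proof (cases "\<exists>x\<in>V. \<exists>y\<in>V. x \<noteq> y")
    case False
    then have "clus E 1 V" by (intro clus_clique) blast
    then show ?thesis by (rule clus_imp_pol1)
  next
    case True
    then obtain x y where xy: "x \<in> V" "y \<in> V" "x \<noteq> y" by blast
    obtain X Y where XY: "X \<union> Y = V" "X \<noteq> {}" "Y \<noteq> {}" "nonadj E X Y \<or> alladj E X Y"
      using p4free_decomp[OF psubset.hyps psubset.prems(1) xy] by auto
    have sub: "X \<subset> V" "Y \<subset> V" using XY unfolding nonadj_def alladj_def by blast+
    have IH: "pol1 E 1 U" if U: "U \<subset> V" for U
    proof (rule psubset.IH[OF U])
      show "p4free E U" using p4free_mono[OF psubset.prems(1)] U by blast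
      show "\<not> is_C4 a b c d \<and> \<not> is_2K2 a b c d" if "{a, b, c, d} \<subseteq> U" for a b c d
        using psubset.prems(2)[of a b c d] that U by (meson psubset_imp_subset subset_trans)
    qed
    have fin: "finite X" "finite Y" using XY(1) psubset.hyps by auto
    show ?thesis
    proof (cases "nonadj E X Y")
      case True
      have "indep E X \<or> indep E Y"
      proof (rule ccontr)
        assume "\<not> ?thesis"
        then obtain a b c d where "{a, b} \<subseteq> X" "{c, d} \<subseteq> Y" "E a b" "E c d" unfolding indep_def by auto
        moreover then have "is_2K2 a b c d" using True unfolding is_2K2_def nonadj_def by blast
        ultimately show False using psubset.prems(2)[of a b c d] XY(1) by blast
      qed
      then show ?thesis
      proof
        assume "indep E X"
        then have "pol1 E (0 + 1) (X \<union> Y)" using pol1_0[OF fin(1)] IH[OF sub(2)] by (intro pol1_Un fin True) auto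
        then show ?thesis using XY(1) by simp
      next
        assume "indep E Y"
        then have "pol1 E (1 + 0) (X \<union> Y)" using pol1_0[OF fin(2)] IH[OF sub(1)] by (intro pol1_Un fin True) auto
        then show ?thesis using XY(1) by simp
      qed
    next
      case False
      then have all: "alladj E X Y" using XY(4) by blast
      have cone: "pol1 E 1 V" if VZ: "V = Z \<union> K" "alladj E Z K" "clus E 1 K" "pol1 E 1 Z" for Z K
      proof -
        obtain A where A: "A \<subseteq> Z" "indep E A" "clus E 1 (Z - A)" using VZ(4) unfolding pol1_def by blast
        have "alladj E (Z - A) K" using VZ(2) unfolding alladj_def by blast
        then have "clus E 1 ((Z - A) \<union> K)" using A VZ(3) clus_join by blast
        then show ?thesis using A VZ by (intro pol1_coverI[OF A(2)]) auto
      qed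
      have "clus E 1 X \<or> clus E 1 Y"
      proof (rule ccontr)
        assume no: "\<not> ?thesis"
        obtain a c where ac: "a \<in> X" "c \<in> X" "a \<noteq> c" "\<not> E a c" using no clus_clique[of X] by blast
        obtain b d where bd: "b \<in> Y" "d \<in> Y" "b \<noteq> d" "\<not> E b d" using no clus_clique[of Y] by blast
        have "is_C4 a b c d" using ac bd all unfolding is_C4_def alladj_def by blast
        then show False using psubset.prems(2)[of a b c d] XY(1) ac bd by blast
      qed
      then show ?thesis
        using cone[of X Y] cone[of Y X] IH sub all alladj_sym[OF all] XY(1) by blast
    qed
  qed
qed

text \<open>In a join the \<open>2K\<^sub>2\<close> lies in one factor and any vertex of the other
  is a hub. In a disjoint union some side contains a \<open>P\<^sub>3\<close>; an edge of the
  \<open>2K\<^sub>2\<close> on the other side gives \<open>P\<^sub>3 + K\<^sub>2\<close>, and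
  otherwise both edges are on the same side and the induction continues there.\<close>

lemma p4free_2K2_P3:
  assumes "finite V" "p4free E V" "{a, b, c, d} \<subseteq> V" "is_2K2 a b c d" "\<not> p3free E V"
  shows "(\<exists>a b c d e. {a, b, c, d, e} \<subseteq> V \<and> is_P3 a b c \<and> E d e \<and> nonadj E {a, b, c} {d, e})
    \<or> (\<exists>v a b c d. {v, a, b, c, d} \<subseteq> V \<and> is_2K2 a b c d \<and> alladj E {v} {a, b, c, d})"
  using assms
proof (induction V rule: finite_psubset_induct)
  case (psubset V)
  have ab: "a \<in> V" "b \<in> V" "a \<noteq> b" "c \<in> V" "d \<in> V" using psubset.prems(2,3) irr unfolding is_2K2_def by blast+
  have e: "E a b" "E c d" "\<not> E a c" "\<not> E a d" "\<not> E b c" "\<not> E b d"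
    using psubset.prems(3) unfolding is_2K2_def nonadj_def by blast+
  obtain X Y where XY: "X \<union> Y = V" "X \<noteq> {}" "Y \<noteq> {}" "nonadj E X Y \<or> alladj E X Y"
    using p4free_decomp[OF psubset.hyps psubset.prems(1) ab(1-3)] by auto
  show ?case
  proof (cases "nonadj E X Y")
    case False
    then have all: "alladj E X Y" using XY(4) by blast
    have bf: ?thesis if Z: "{a, b, c, d} \<subseteq> Z" "w \<in> Y'" "alladj E Z Y'" "Z \<union> Y' = V" for Z Y' w
    proof -
      have "alladj E {w} {a, b, c, d}" using alladj_sym[OF Z(3)] Z(1,2) unfolding alladj_def by blast
      moreover have "{w, a, b, c, d} \<subseteq> V" using Z by blast
      ultimately show ?thesis using psubset.prems(3) by blast
    qed
    have nE: "\<not> (p \<in> X \<and> q \<in> Y)" "\<not> (q \<in> X \<and> p \<in> Y)" if "\<not> E p q" for p q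
      using all alladj_sym[OF all] that unfolding alladj_def by blast+
    have "{a, b, c, d} \<subseteq> X \<or> {a, b, c, d} \<subseteq> Y"
      using nE[OF e(3)] nE[OF e(4)] nE[OF e(5)] nE[OF e(6)] ab XY(1) by blast
    then show ?thesis using bf[of X _ Y] bf[of Y _ X] all alladj_sym[OF all] XY by blast
  next
    case True
    have side: ?thesis if Z: "Z \<union> Y' = V" "nonadj E Z Y'" "Y' \<noteq> {}" "is_P3 p q r" "{p, q, r} \<subseteq> Z" for Z Y' p q r
    proof -
      have P3K2: ?thesis if "x \<in> Y'" "y \<in> Y'" "E x y" for x y
      proof -
        have "nonadj E {p, q, r} {x, y}" using Z(2,5) that unfolding nonadj_def by blast
        moreover have "{p, q, r, x, y} \<subseteq> V" using Z that by blast
        ultimately show ?thesis using Z(4) that(3) by blast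
      qed
      have nE: "\<not> (x \<in> Z \<and> y \<in> Y')" "\<not> (y \<in> Z \<and> x \<in> Y')" if "E x y" for x y
        using Z(2) nonadj_sym[OF Z(2)] that unfolding nonadj_def by blast+
      consider "a \<in> Y'" "b \<in> Y'" | "c \<in> Y'" "d \<in> Y'" | "{a, b, c, d} \<subseteq> Z"
        using nE[OF e(1)] nE[OF e(2)] ab Z(1) by blast
      then show ?thesis
      proof cases
        case 1
        then show ?thesis using P3K2 e by blast
      next
        case 2
        then show ?thesis using P3K2 e by blast
      next
        case 3
        have ZV: "Z \<subset> V" using Z(1,2,3) unfolding nonadj_def by blast
        have "\<not> p3free E Z" using Z(4,5) not_p3free by blast
        from psubset.IH[OF ZV p4free_mono[OF psubset.prems(1)] 3 psubset.prems(3) this] ZV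
        show ?thesis by (meson psubset_imp_subset subset_trans)
      qed
    qed
    obtain p q r where pqr: "{p, q, r} \<subseteq> V" "is_P3 p q r" using psubset.prems(4) not_p3free by blast
    have "E p q" "E q r" using pqr(2) unfolding is_P3_def by blast+
    moreover have "\<not> (s \<in> X \<and> t \<in> Y)" "\<not> (t \<in> X \<and> s \<in> Y)" if "E s t" for s t
      using True nonadj_sym[OF True] that unfolding nonadj_def by blast+
    ultimately have "\<not> (p \<in> X \<and> q \<in> Y)" "\<not> (q \<in> X \<and> p \<in> Y)" "\<not> (q \<in> X \<and> r \<in> Y)" "\<not> (r \<in> X \<and> q \<in> Y)"
      by metis+
    then have "{p, q, r} \<subseteq> X \<or> {p, q, r} \<subseteq> Y" using pqr(1) XY(1) by blast
    then show ?thesis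
      using side[of X Y p q r] side[of Y X p q r] XY(1-3) True nonadj_sym[OF True] pqr(2) by blast
  qed
qed

section \<open>The four minimal graphs\<close>

lemma clus_triangle: "E p q \<Longrightarrow> E p r \<Longrightarrow> E q r \<Longrightarrow> clus E 1 {p, q, r}"
  using sym by (intro clus_clique) auto

text \<open>Adjacent and equal vertices are covered as well: two vertices hold neither a
  \<open>P\<^sub>3\<close> nor a larger independent set.\<close>

lemma clus_nonedge: "clus E 2 {p, q}"
proof -
  have "p3free E {p, q}" unfolding p3free_def using irr by auto
  moreover have "card S \<le> 2" if "S \<subseteq> {p, q}" for S
    using card_mono[OF _ that] card_insert_le_m1[of 2 "{q}" p] by simp
  ultimately show ?thesis unfolding clus_def by blast
qed

text \<open>\<open>K\<^sub>1 \<oplus> C\<^sub>4\<close> is complete tripartite, so it is itself a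
  multipartite part. An independent set consists of the hub or lies in a diagonal, and then misses
  an induced path around the cycle or through the hub.\<close>

lemma wheel_polarity:
  assumes "is_C4 a b c d" "alladj E {u} {a, b, c, d}"
  shows "\<not> monopolar E {u, a, b, c, d}"
    and "polinf E 1 {u, a, b, c, d}"
    and "v \<in> {u, a, b, c, d} \<Longrightarrow> pol1 E 2 ({u, a, b, c, d} - {v})"
proof -
  have u: "E u a" "E u b" "E u c" "E u d" and u': "E a u" "E b u" "E c u" "E d u"
    using assms(2) alladj_sym[OF assms(2)] unfolding alladj_def by blast+
  have e: "a \<noteq> c" "b \<noteq> d" "\<not> E a c" "\<not> E b d" "E a b" "E a d" "E c b" "E c d"
    using assms(1) unfolding is_C4_def by blast+
  have e': "E b a" "E d a" "E b c" "E d c" "\<not> E c a" "\<not> E d b" using e sym by blast+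
  show "\<not> monopolar E {u, a, b, c, d}"
  proof
    assume "monopolar E {u, a, b, c, d}"
    then obtain A where A: "indep E A" "p3free E ({u, a, b, c, d} - A)" unfolding monopolar_def by blast
    have i: "\<not> (x \<in> A \<and> y \<in> A)" if "E x y" for x y using A(1) that unfolding indep_def by blast
    have p: "x \<in> A \<or> y \<in> A \<or> z \<in> A" if "E x y" "E y z" "x \<noteq> z" "\<not> E x z" "{x, y, z} \<subseteq> {u, a, b, c, d}" for x y z
      using A(2) that unfolding p3free_def by blast
    show False
      using i[OF u(1)] i[OF u(2)] i[OF u(3)] i[OF e(5)] i[OF e(6)] i[OF e(7)] i[OF e(8)]
        p[of a u c] p[of b u d] p[of a b c] e u u' e' by blast
  qed
  have "comult E {u, a, b, c, d}" unfolding comult_def using e e' u u' irr by auto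
  moreover have "clus E 1 {}" by (rule clus_clique) auto
  ultimately show "polinf E 1 {u, a, b, c, d}" by (rule polinf_coverI) auto
  have ind: "indep E {a, c}" "indep E {b, d}" using e e' irr unfolding indep_def by auto
  have c2: "clus E 2 {x, y}" for x y by (rule clus_nonedge)
  assume "v \<in> {u, a, b, c, d}"
  then consider "v = u" | "v = a" | "v = b" | "v = c" | "v = d" by blast
  then show "pol1 E 2 ({u, a, b, c, d} - {v})"
  proof cases
    case 1 show ?thesis by (rule pol1_coverI[OF ind(1) c2[of b d]]) (use 1 in blast)
  next
    case 2 show ?thesis by (rule pol1_coverI[OF ind(2) c2[of u c]]) (use 2 in blast)
  next
    case 3 show ?thesis by (rule pol1_coverI[OF ind(1) c2[of u d]]) (use 3 in blast)
  next
    case 4 show ?thesis by (rule pol1_coverI[OF ind(2) c2[of u a]]) (use 4 in blast)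
  next
    case 5 show ?thesis by (rule pol1_coverI[OF ind(1) c2[of u b]]) (use 5 in blast)
  qed
qed

lemma clus_1_2: "clus E 1 B \<Longrightarrow> clus E 2 B"
  by (rule clus_mono) auto

text \<open>The hub sees two independent edges and is forced into the independent part, which leaves
  the \<open>P\<^sub>3\<close> to the cluster. The hub together with the \<open>P\<^sub>3\<close> is
  complete multipartite.\<close>

lemma cone_P3_K2_polarity:
  assumes "is_P3 a b c" "E d e" "nonadj E {a, b, c} {d, e}" "alladj E {u} {a, b, c, d, e}"
  shows "\<not> monopolar E {u, a, b, c, d, e}"
    and "polinf E 1 {u, a, b, c, d, e}"
    and "v \<in> {u, a, b, c, d, e} \<Longrightarrow> pol1 E 2 ({u, a, b, c, d, e} - {v})"
proof -
  have u: "E u a" "E u b" "E u c" "E u d" "E u e" and u': "E a u" "E b u" "E c u" "E d u" "E e u"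
    using assms(4) alladj_sym[OF assms(4)] unfolding alladj_def by blast+
  have p: "E a b" "E b c" "\<not> E a c" "a \<noteq> c" using assms(1) unfolding is_P3_def by blast+
  have p': "E b a" "E c b" "\<not> E c a" "E e d" using p assms(2) sym by blast+
  have n: "\<not> E a d" "\<not> E a e" "\<not> E b d" "\<not> E b e" "\<not> E c d" "\<not> E c e" using assms(3) unfolding nonadj_def by blast+
  have n': "\<not> E d a" "\<not> E e a" "\<not> E d b" "\<not> E e b" "\<not> E d c" "\<not> E e c" using n sym by blast+
  have na: "nonadj E {a, b} {d, e}" "nonadj E {b, c} {d, e}" using assms(3) unfolding nonadj_def by blast+
  have m1: "matching E 1 {d, e}"
    using matching_insert[of 0 "{}" d e] assms(2) by (auto simp: matching_0 nonadj_def)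
  show "\<not> monopolar E {u, a, b, c, d, e}"
  proof
    assume "monopolar E {u, a, b, c, d, e}"
    then obtain A where A: "indep E A" "p3free E ({u, a, b, c, d, e} - A)" unfolding monopolar_def by blast
    have "u \<in> A" by (rule hub_in_indep[OF A _ p(1) assms(2) na(1) u(1,2,4,5)]) auto
    then have "a \<notin> A" "b \<notin> A" "c \<notin> A" using A(1) u unfolding indep_def by blast+
    then show False using A(2) p unfolding p3free_def by blast
  qed
  have "comult E {u, a, b, c}" unfolding comult_def using p p' u u' irr by auto
  then show "polinf E 1 {u, a, b, c, d, e}" using clus_edge[OF assms(2)] by (rule polinf_coverI) auto
  have bc: "clus E 2 ({b, c} \<union> {d, e})" "clus E 2 ({a, b} \<union> {d, e})"
    using matching_clus[OF matching_insert[OF m1 na(2) p(2)]] matching_clus[OF matching_insert[OF m1 na(1) p(1)]]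
    by (simp_all add: numeral_2_eq_2)
  have iu: "indep E {u}" and i: "indep E {a, c, d}" "indep E {a, e}" "indep E {a, d}"
    using p p' n n' irr unfolding indep_def by auto
  have t: "clus E 2 {u, b, c}" using clus_1_2[OF clus_triangle[OF u(2,3) p(2)]] .
  assume "v \<in> {u, a, b, c, d, e}"
  then consider "v = u" | "v = a" | "v = b" | "v = c" | "v = d" | "v = e" by blast
  then show "pol1 E 2 ({u, a, b, c, d, e} - {v})"
  proof cases
    case 1
    have "pol1 E 2 ({a, b, c} \<union> {d, e})" using P3_Un_matching[OF p assms(3) m1, of 2] by simp
    then show ?thesis using 1 by (elim pol1_mono) auto
  next
    case 2 show ?thesis by (rule pol1_coverI[OF iu bc(1)]) (use 2 in blast)
  next
    case 3 show ?thesis by (rule pol1_coverI[OF i(1) clus_1_2[OF clus_edge[OF u(5)]]]) (use 3 in blast)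
  next
    case 4 show ?thesis by (rule pol1_coverI[OF iu bc(2)]) (use 4 in blast)
  next
    case 5 show ?thesis by (rule pol1_coverI[OF i(2) t]) (use 5 in blast)
  next
    case 6 show ?thesis by (rule pol1_coverI[OF i(3) t]) (use 6 in blast)
  qed
qed

text \<open>Each hub is forced into the independent part, but the hubs are adjacent. Both hubs and
  one of the edges form a clique, which serves as multipartite part.\<close>

lemma double_cone_2K2_polarity:
  assumes "is_2K2 a b c d" "E u w" "alladj E {u, w} {a, b, c, d}"
  shows "\<not> monopolar E {u, w, a, b, c, d}"
    and "polinf E 1 {u, w, a, b, c, d}"
    and "v \<in> {u, w, a, b, c, d} \<Longrightarrow> pol1 E 2 ({u, w, a, b, c, d} - {v})"
proof -
  have e: "E a b" "E c d" and na: "nonadj E {a, b} {c, d}" using assms(1) unfolding is_2K2_def by blast+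
  have u: "E u a" "E u b" "E u c" "E u d" and w: "E w a" "E w b" "E w c" "E w d"
    using assms(3) unfolding alladj_def by blast+
  have n: "\<not> E a c" "\<not> E a d" "\<not> E b c" "\<not> E b d" using na unfolding nonadj_def by blast+
  then have n': "\<not> E c a" "\<not> E d a" "\<not> E c b" "\<not> E d b" using sym by blast+
  show "\<not> monopolar E {u, w, a, b, c, d}"
  proof
    assume "monopolar E {u, w, a, b, c, d}"
    then obtain A where A: "indep E A" "p3free E ({u, w, a, b, c, d} - A)" unfolding monopolar_def by blast
    have "u \<in> A" by (rule hub_in_indep[OF A _ e na u]) auto
    moreover have "w \<in> A" by (rule hub_in_indep[OF A _ e na w]) auto
    ultimately show False using A(1) assms(2) unfolding indep_def by blast
  qed
  have "alladj E {u, w} {a, b}" using assms(3) unfolding alladj_def by blast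
  then have "clus E 1 ({u, w} \<union> {a, b})" using clus_join clus_edge assms(2) e by blast
  then have "comult E ({u, w} \<union> {a, b})" by (rule comult_clique)
  then show "polinf E 1 {u, w, a, b, c, d}" using clus_edge[OF e(2)] by (rule polinf_coverI) auto
  have m1: "matching E 1 {c, d}"
    using matching_insert[of 0 "{}" c d] e by (auto simp: matching_0 nonadj_def)
  have m: "clus E 2 ({a, b} \<union> {c, d})"
    using matching_clus[OF matching_insert[OF m1 na e(1)]] by (simp add: numeral_2_eq_2)
  have i: "indep E {u}" "indep E {w}" "indep E {a, c}" "indep E {b, c}" "indep E {a, d}"
    using n n' irr unfolding indep_def by auto
  have t: "clus E 2 {u, w, x}" if "x \<in> {a, b, c, d}" for x
    using clus_1_2[OF clus_triangle[OF assms(2), of x]] u w that by blast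
  assume "v \<in> {u, w, a, b, c, d}"
  then consider "v = u" | "v = w" | "v = a" | "v = b" | "v = c" | "v = d" by blast
  then show "pol1 E 2 ({u, w, a, b, c, d} - {v})"
  proof cases
    case 1 show ?thesis by (rule pol1_coverI[OF i(2) m]) (use 1 in blast)
  next
    case 2 show ?thesis by (rule pol1_coverI[OF i(1) m]) (use 2 in blast)
  next
    case 3 show ?thesis by (rule pol1_coverI[OF i(4) t[of d]]) (use 3 in blast)+
  next
    case 4 show ?thesis by (rule pol1_coverI[OF i(3) t[of d]]) (use 4 in blast)+
  next
    case 5 show ?thesis by (rule pol1_coverI[OF i(5) t[of b]]) (use 5 in blast)+
  next
    case 6 show ?thesis by (rule pol1_coverI[OF i(3) t[of b]]) (use 6 in blast)+
  qed
qed

text \<open>The independent part lies in one factor and misses an end of the edge there; this end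
  and a non-adjacent pair of the other factor form an induced \<open>P\<^sub>3\<close>. Two
  triangles cover the vertex set. Deletions are treated in the first factor only, as the factors can
  be exchanged.\<close>

lemma join_K1K2_polarity:
  assumes "E y z" "\<not> E x y" "\<not> E x z" "x \<noteq> y" "x \<noteq> z"
    and "E y' z'" "\<not> E x' y'" "\<not> E x' z'" "x' \<noteq> y'" "x' \<noteq> z'"
    and "alladj E {x, y, z} {x', y', z'}"
  shows "\<not> monopolar E ({x, y, z} \<union> {x', y', z'})"
    and "polinf E 1 ({x, y, z} \<union> {x', y', z'})"
    and "v \<in> {x, y, z} \<Longrightarrow> pol1 E 2 ({x, y, z} \<union> {x', y', z'} - {v})"
proof -
  have adj: "E p q" "E q p" if "p \<in> {x, y, z}" "q \<in> {x', y', z'}" for p q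
    using assms(11) alladj_sym[OF assms(11)] that unfolding alladj_def by blast+
  have s: "E z y" "\<not> E y x" "\<not> E z x" "E z' y'" "\<not> E y' x'" "\<not> E z' x'" using assms sym by blast+
  show "\<not> monopolar E ({x, y, z} \<union> {x', y', z'})"
  proof
    assume "monopolar E ({x, y, z} \<union> {x', y', z'})"
    then obtain A where A: "A \<subseteq> {x, y, z} \<union> {x', y', z'}" "indep E A" "p3free E ({x, y, z} \<union> {x', y', z'} - A)"
      unfolding monopolar_def by blast
    have disj: "{x, y, z} \<inter> {x', y', z'} = {}" using assms(11) unfolding alladj_def by blast
    have "A \<subseteq> {x, y, z} \<or> A \<subseteq> {x', y', z'}" using indep_alladj_side[OF assms(11) A(2,1)] .
    then show False
    proof
      assume AX: "A \<subseteq> {x, y, z}"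
      obtain p where p: "p \<in> {x, y, z}" "p \<notin> A" using A(2) assms(1) unfolding indep_def by blast
      have "E x' p" "E p y'" using adj p by blast+
      moreover have "x' \<notin> A" "y' \<notin> A" using AX disj by blast+
      ultimately show False using A(3) p assms(7,9) unfolding p3free_def by blast
    next
      assume AX: "A \<subseteq> {x', y', z'}"
      obtain p where p: "p \<in> {x', y', z'}" "p \<notin> A" using A(2) assms(6) unfolding indep_def by blast
      have "E x p" "E p y" using adj p by blast+
      moreover have "x \<notin> A" "y \<notin> A" using AX disj by blast+
      ultimately show False using A(3) p assms(2,4) unfolding p3free_def by blast
    qed
  qed
  have 1: "clus E 1 {x', y, z}" by (intro clus_triangle adj(2) assms(1)) auto
  have "clus E 1 {x, y', z'}" by (intro clus_triangle adj(1) assms(6)) auto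
  then show "polinf E 1 ({x, y, z} \<union> {x', y', z'})" by (rule polinf_coverI[OF comult_clique[OF 1]]) auto
  have i: "indep E {x', y'}" "indep E {x, z}" "indep E {x, y}"
    using assms s irr unfolding indep_def by auto
  have t: "clus E 2 {y, z, z'}" by (intro clus_1_2 clus_triangle adj(1) assms(1)) auto
  have c: "clus E (1 + 1) ({x'} \<union> {y', z'})"
    using assms clus_edge[OF assms(6)] clus_clique[of "{x'}"] by (intro clus_Un) (auto simp: nonadj_def)
  then have c: "clus E 2 {x', y', z'}" by (simp add: numeral_2_eq_2 insert_commute)
  assume "v \<in> {x, y, z}"
  then consider "v = x" | "v = y" | "v = z" by blast
  then show "pol1 E 2 ({x, y, z} \<union> {x', y', z'} - {v})"
  proof cases
    case 1 show ?thesis by (rule pol1_coverI[OF i(1) t]) (use 1 in blast)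
  next
    case 2 show ?thesis by (rule pol1_coverI[OF i(2) c]) (use 2 in blast)
  next
    case 3 show ?thesis by (rule pol1_coverI[OF i(3) c]) (use 3 in blast)
  qed
qed

lemma cluster_K1K2:
  assumes "p3free E X" "\<not> clus E 1 X" "\<not> indep E X"
  shows "\<exists>x y z. {x, y, z} \<subseteq> X \<and> E y z \<and> \<not> E x y \<and> \<not> E x z \<and> x \<noteq> y \<and> x \<noteq> z"
proof -
  obtain y z where yz: "y \<in> X" "z \<in> X" "E y z" using assms(3) unfolding indep_def by blast
  obtain p q where pq: "p \<in> X" "q \<in> X" "p \<noteq> q" "\<not> E p q" using assms(2) clus_clique[of X] by blast
  have p3: "E a c" if "a \<in> X" "b \<in> X" "c \<in> X" "E a b" "E b c" "a \<noteq> c" for a b c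
    using assms(1) that unfolding p3free_def by blast
  have "\<not> (p = y \<or> E p y) \<or> \<not> (q = y \<or> E q y)"
    using p3[of p y q] pq yz(1) sym[of q y] sym[of q p] by blast
  then obtain x where x: "x \<in> X" "x \<noteq> y" "\<not> E x y" using pq by blast
  moreover then have "\<not> E x z" using p3[of x z y] yz sym[of y z] by blast
  moreover have "x \<noteq> z" using x(3) yz sym[of y z] by blast
  ultimately show ?thesis using yz by blast
qed

text \<open>By minimality it suffices to find one of the four graphs inside \<open>H\<close>, which
  must be a join because monopolarity is closed under disjoint unions. The cases depend on whether a
  factor is a clique and, if none is, on whether a factor contains a
  \<open>P\<^sub>3\<close>.\<close>

lemma min_nonmonopolar:
  assumes fin: "finite H" and p4: "p4free E H" and mo: "min_obs (monopolar E) H"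
  shows "polinf E 1 H \<and> (\<forall>v\<in>H. pol1 E 2 (H - {v}))"
proof -
  have nm: "\<not> monopolar E H" and mini: "\<And>S. S \<subseteq> H \<Longrightarrow> \<not> monopolar E S \<Longrightarrow> S = H"
    using mo unfolding min_obs_def by blast+
  have np: "\<not> pol1 E i H" for i using nm pol1_imp_monopolar by blast
  have wheel: ?thesis if "is_C4 a b c d" "alladj E {u} {a, b, c, d}" "{u, a, b, c, d} \<subseteq> H" for u a b c d
    using wheel_polarity(2,3)[OF that(1,2)] unfolding mini[OF that(3) wheel_polarity(1)[OF that(1,2)]] by blast
  have cone: ?thesis if "is_P3 a b c" "E d e" "nonadj E {a, b, c} {d, e}" "alladj E {u} {a, b, c, d, e}"
    "{u, a, b, c, d, e} \<subseteq> H" for u a b c d e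
    using cone_P3_K2_polarity(2,3)[OF that(1-4)] unfolding mini[OF that(5) cone_P3_K2_polarity(1)[OF that(1-4)]] by blast
  have dcone: ?thesis if "is_2K2 a b c d" "E u w" "alladj E {u, w} {a, b, c, d}" "{u, w, a, b, c, d} \<subseteq> H"
    for u w a b c d
    using double_cone_2K2_polarity(2,3)[OF that(1-3)] unfolding mini[OF that(4) double_cone_2K2_polarity(1)[OF that(1-3)]] by blast
  have "\<not> clus E 1 H" using np clus_imp_pol1 by blast
  then obtain x y where xy: "x \<in> H" "y \<in> H" "x \<noteq> y" using clus_clique[of H] by blast
  obtain X Y where XY: "X \<union> Y = H" "X \<noteq> {}" "Y \<noteq> {}" "nonadj E X Y \<or> alladj E X Y"
    using p4free_decomp[OF fin p4 xy] by auto
  have finXY: "finite X" "finite Y" using XY(1) fin by auto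
  have "\<not> nonadj E X Y"
  proof
    assume na: "nonadj E X Y"
    then have "X \<subset> H" "Y \<subset> H" using XY unfolding nonadj_def by blast+
    then have "monopolar E X" "monopolar E Y" using mo unfolding min_obs_def by blast+
    then obtain i j where "pol1 E i X" "pol1 E j Y" using monopolar_imp_pol1[OF finXY(1)] monopolar_imp_pol1[OF finXY(2)] by metis
    from pol1_Un[OF finXY na this] show False using np XY(1) by simp
  qed
  then have all: "alladj E X Y" using XY(4) by blast
  have clique_case: ?thesis if Z: "X' \<union> Y' = H" "X' \<noteq> {}" "alladj E X' Y'" "clus E 1 X'" for X' Y'
  proof -
    obtain u where u: "u \<in> X'" using Z(2) by blast
    have fin': "finite Y'" "p4free E Y'" using Z(1) fin p4free_mono[OF p4] by auto
    have adj: "E p q" if "p \<in> X'" "q \<in> Y'" for p q using Z(3) that unfolding alladj_def by blast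
    have disj: "X' \<inter> Y' = {}" using Z(3) unfolding alladj_def by blast
    \<comment> \<open>A clique factor could be added to the clique of a split partition, so the
      other factor is not split and contains \<open>C\<^sub>4\<close> or
      \<open>2K\<^sub>2\<close>.\<close>
    have "\<not> pol1 E 1 Y'"
    proof
      assume "pol1 E 1 Y'"
      then obtain A where A: "A \<subseteq> Y'" "indep E A" "clus E 1 (Y' - A)" unfolding pol1_def by blast
      have "clus E 1 (X' \<union> (Y' - A))"
        using Z(3,4) A by (intro clus_join) (auto simp: alladj_def)
      then have "pol1 E 1 H" using Z(1) by (intro pol1_coverI[OF A(2)]) auto
      then show False using np by blast
    qed
    then obtain a b c d where abcd: "{a, b, c, d} \<subseteq> Y'" "is_C4 a b c d \<or> is_2K2 a b c d"
      using p4free_split[OF fin'] by blast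
    show ?thesis
    proof (cases "is_C4 a b c d")
      case True
      have "alladj E {u} {a, b, c, d}" using Z(3) u abcd(1) unfolding alladj_def by blast
      then show ?thesis using True abcd(1) u Z(1) by (intro wheel[of a b c d u]) auto
    next
      case False
      then have k2: "is_2K2 a b c d" using abcd(2) by blast
      show ?thesis
      proof (cases "\<exists>w\<in>X'. w \<noteq> u")
        case True
        then obtain w where w: "w \<in> X'" "w \<noteq> u" by blast
        have uw: "E u w" using clus_1D[OF Z(4) u w(1)] w(2) by blast
        have "alladj E {u, w} {a, b, c, d}" using Z(3) u w abcd(1) unfolding alladj_def by blast
        then show ?thesis using k2 uw abcd(1) u w Z(1) by (intro dcone[of a b c d u w]) auto
      next
        case one: False
        then have X': "X' = {u}" using u by blast
        \<comment> \<open>The vertex \<open>u\<close> alone would be an independent part if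
          \<open>Y'\<close> were a cluster.\<close>
        have "\<not> p3free E Y'"
        proof
          assume "p3free E Y'"
          moreover have "H - {u} = Y'" using X' Z(1) disj by blast
          ultimately show False using nm irr u Z(1) unfolding monopolar_def
            by (auto simp: indep_def dest!: spec[of _ "{u}"])
        qed
        from p4free_2K2_P3[OF fin' abcd(1) k2 this] show ?thesis
        proof (elim disjE exE conjE)
          fix a b c d e
          assume *: "{a, b, c, d, e} \<subseteq> Y'" "is_P3 a b c" "E d e" "nonadj E {a, b, c} {d, e}"
          have "alladj E {u} {a, b, c, d, e}" using Z(3) u *(1) unfolding alladj_def by blast
          then show ?thesis using * u Z(1) by (intro cone[of a b c d e u]) auto
        next
          fix v a b c d
          assume *: "{v, a, b, c, d} \<subseteq> Y'" "is_2K2 a b c d" "alladj E {v} {a, b, c, d}"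
          have "alladj E {u} {a, b, c, d}" using Z(3) u *(1) unfolding alladj_def by blast
          then have "alladj E {u, v} {a, b, c, d}" using *(3) unfolding alladj_def by simp
          moreover have "E u v" using adj u *(1) by blast
          ultimately show ?thesis using * u Z(1) by (intro dcone[of a b c d u v]) auto
        qed
      qed
    qed
  qed
  show ?thesis
  proof (cases "clus E 1 X \<or> clus E 1 Y")
    case True
    then show ?thesis
      using clique_case[of X Y] clique_case[of Y X] XY(1-3) all alladj_sym[OF all] by blast
  next
    case False
    have adj: "E p q" "E q p" if "p \<in> X" "q \<in> Y" for p q
      using all alladj_sym[OF all] that unfolding alladj_def by blast+
    have P3_case: ?thesis if Z: "X' \<union> Y' = H" "alladj E X' Y'" "\<not> p3free E X'" "\<not> clus E 1 Y'" for X' Y'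
    proof -
      obtain a b c where abc: "{a, b, c} \<subseteq> X'" "is_P3 a b c" using Z(3) not_p3free by blast
      obtain p q where pq: "p \<in> Y'" "q \<in> Y'" "p \<noteq> q" "\<not> E p q" using Z(4) clus_clique[of Y'] by blast
      have a': "E s t" "E t s" "s \<noteq> t" if "s \<in> X'" "t \<in> Y'" for s t
        using Z(2) alladj_sym[OF Z(2)] that unfolding alladj_def by blast+
      \<comment> \<open>The ends of the path and a non-adjacent pair of the other factor form a
        four-cycle, with the middle \<open>b\<close> adjacent to all of it.\<close>
      have "is_C4 a p c q"
        using abc pq a'[of a p] a'[of a q] a'[of c p] a'[of c q] unfolding is_C4_def is_P3_def by blast
      moreover have "alladj E {b} {a, p, c, q}"
        using abc a'[of b p] a'[of b q] pq sym[of a b] irr unfolding alladj_def is_P3_def by blast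
      ultimately show ?thesis using abc(1) pq Z(1) by (intro wheel[of a p c q b]) auto
    qed
    show ?thesis
    proof (cases "p3free E X \<and> p3free E Y")
      case notboth: False
      then show ?thesis
        using P3_case[of X Y] P3_case[of Y X] XY(1) all alladj_sym[OF all] False by blast
    next
      case True
      have HX: "H - X = Y" "H - Y = X" using XY(1) all unfolding alladj_def by blast+
      have "\<not> indep E X" "\<not> indep E Y" using nm HX True XY(1) unfolding monopolar_def by auto
      then obtain x y z x' y' z' where
        1: "{x, y, z} \<subseteq> X" "E y z" "\<not> E x y" "\<not> E x z" "x \<noteq> y" "x \<noteq> z" and
        2: "{x', y', z'} \<subseteq> Y" "E y' z'" "\<not> E x' y'" "\<not> E x' z'" "x' \<noteq> y'" "x' \<noteq> z'"
        using cluster_K1K2[of X] cluster_K1K2[of Y] True False by metis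
      have al: "alladj E {x, y, z} {x', y', z'}" using all 1(1) 2(1) unfolding alladj_def by blast
      note pol = join_K1K2_polarity[OF 1(2-6) 2(2-6) al]
      note pol' = join_K1K2_polarity[OF 2(2-6) 1(2-6) alladj_sym[OF al]]
      have eq: "{x, y, z} \<union> {x', y', z'} = H" using 1(1) 2(1) XY(1) by (intro mini pol(1)) auto
      have eq': "{x', y', z'} \<union> {x, y, z} = H" using eq by blast
      have "pol1 E 2 (H - {v})" if "v \<in> H" for v
        using pol(3)[of v] pol'(3)[of v] that unfolding eq eq' using eq by blast
      then show ?thesis using pol(2) eq by simp
    qed
  qed
qed

text \<open>The bounds 1 and 2 of \<open>min_nonmonopolar\<close> fit under \<open>k - 2\<close> and
  \<open>k - 1\<close> because \<open>k \<ge> 3\<close>.\<close>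

lemma shape4_good:
  assumes fin: "finite H" and p4: "p4free E H" and "shape4 E k H"
  shows "good E k H"
proof -
  have k: "k \<ge> 3" and mo: "min_obs (monopolar E) H" using assms(3) unfolding shape4_def by auto
  have n: "\<not> pol1 E i H" for i using mo pol1_imp_monopolar unfolding min_obs_def by blast
  then have "\<not> clus E k H" using clus_imp_pol1 by blast
  moreover have P: "polinf E 1 H" "\<And>v. v \<in> H \<Longrightarrow> pol1 E 2 (H - {v})"
    using min_nonmonopolar[OF fin p4 mo] by blast+
  moreover have "pol1 E (k - 1) (H - {v})" if "v \<in> H" for v
    using pol1_mono[OF P(2)[OF that] subset_refl] k by simp
  moreover have "polinf E (k - 1) H" "polinf E (k - 2) H"
    using polinf_mono[OF P(1) subset_refl] k by simp_all
  ultimately show ?thesis unfolding good_def using n by blast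
qed

text \<open>Alternatives (1) and (2) describe concrete cographs; (3) and (4) leave room for an
  arbitrary part, so \<open>p4free\<close> accompanies them.\<close>

theorem good_iff_shape:
  assumes "k \<ge> 2" "finite H"
  shows "p4free E H \<and> good E k H \<longleftrightarrow>
    shape1 E k H \<or> shape2 E k H \<or> p4free E H \<and> (shape3 E k H \<or> shape4 E k H)"
  using good_shape[OF assms] shape1_good[OF assms(1)] shape2_good[OF assms(1)] shape3_good[OF assms]
    shape4_good[OF assms(2)] shape1_p4free shape2_p4free by blast

end

section \<open>Isomorphism invariance\<close>

text \<open>Relations are compared on the vertex sets only and are unconstrained elsewhere, so
  vertex subsets need no graph of their own.\<close>

definition giso :: "('a \<Rightarrow> 'a \<Rightarrow> bool) \<Rightarrow> 'a set \<Rightarrow> ('b \<Rightarrow> 'b \<Rightarrow> bool) \<Rightarrow> 'b set \<Rightarrow> bool" where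
  "giso E V E' V' \<longleftrightarrow> (\<exists>f. bij_betw f V V' \<and> (\<forall>x\<in>V. \<forall>y\<in>V. E x y \<longleftrightarrow> E' (f x) (f y)))"

lemma gisoI: "bij_betw f V V' \<Longrightarrow> (\<And>x y. x \<in> V \<Longrightarrow> y \<in> V \<Longrightarrow> E x y \<longleftrightarrow> E' (f x) (f y)) \<Longrightarrow> giso E V E' V'"
  unfolding giso_def by blast

lemma giso_refl: "giso E V E V"
  by (rule gisoI[of id]) auto

lemma giso_sym:
  assumes "giso E V E' V'" shows "giso E' V' E V"
proof -
  obtain f where f: "bij_betw f V V'" "\<And>x y. x \<in> V \<Longrightarrow> y \<in> V \<Longrightarrow> E x y \<longleftrightarrow> E' (f x) (f y)"
    using assms unfolding giso_def by blast
  show ?thesis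
  proof (rule gisoI[OF bij_betw_inv_into[OF f(1)]])
    fix x y assume "x \<in> V'" "y \<in> V'"
    then have "inv_into V f x \<in> V" "inv_into V f y \<in> V" "f (inv_into V f x) = x" "f (inv_into V f y) = y"
      using f(1) by (auto simp: bij_betw_def inv_into_into f_inv_into_f)
    then show "E' x y \<longleftrightarrow> E (inv_into V f x) (inv_into V f y)" using f(2) by metis
  qed
qed

lemma giso_trans:
  assumes "giso E V E' V'" "giso E' V' E'' V''" shows "giso E V E'' V''"
proof -
  obtain f g where f: "bij_betw f V V'" "\<forall>x\<in>V. \<forall>y\<in>V. E x y \<longleftrightarrow> E' (f x) (f y)"
    and g: "bij_betw g V' V''" "\<forall>x\<in>V'. \<forall>y\<in>V'. E' x y \<longleftrightarrow> E'' (g x) (g y)"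
    using assms unfolding giso_def by blast
  have "f x \<in> V'" if "x \<in> V" for x using f(1) that unfolding bij_betw_def by blast
  then show ?thesis using f(2) g(2) by (intro gisoI[OF bij_betw_trans[OF f(1) g(1)]]) auto
qed

section \<open>Transport along an injective map\<close>

context
  fixes f :: "'a \<Rightarrow> 'b" and E E' V
  assumes inj: "inj_on f V" and edge: "\<And>x y. x \<in> V \<Longrightarrow> y \<in> V \<Longrightarrow> E' (f x) (f y) \<longleftrightarrow> E x y"
begin

private lemma eq: "x \<in> V \<Longrightarrow> y \<in> V \<Longrightarrow> f x = f y \<longleftrightarrow> x = y"
  using inj by (auto dest: inj_onD)

private lemma ex_subset_image: "(\<exists>B\<subseteq>f ` A. P B) \<longleftrightarrow> (\<exists>B\<subseteq>A. P (f ` B))"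
  by (metis subset_image_iff)

private lemma all_subset_image: "(\<forall>B\<subseteq>f ` A. P B) \<longleftrightarrow> (\<forall>B\<subseteq>A. P (f ` B))"
  by (metis subset_image_iff)

private lemma diff: "A \<subseteq> V \<Longrightarrow> B \<subseteq> A \<Longrightarrow> f ` A - f ` B = f ` (A - B)"
  using inj by (metis (no_types, lifting) Diff_subset inj_on_image_set_diff subset_trans)

private lemma inj_sub: "A \<subseteq> V \<Longrightarrow> B \<subseteq> V \<Longrightarrow> f ` A = f ` B \<longleftrightarrow> A = B"
  using inj by (rule inj_on_image_eq_iff)

lemma indep_image: "A \<subseteq> V \<Longrightarrow> indep E' (f ` A) \<longleftrightarrow> indep E A"
  unfolding indep_def by (simp add: edge subset_eq)

lemma p3free_image: "A \<subseteq> V \<Longrightarrow> p3free E' (f ` A) \<longleftrightarrow> p3free E A"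
  unfolding p3free_def by (simp add: edge eq subset_eq)

lemma p4free_image: "A \<subseteq> V \<Longrightarrow> p4free E' (f ` A) \<longleftrightarrow> p4free E A"
  unfolding p4free_def by (simp add: edge eq subset_eq)

lemma comult_image: "A \<subseteq> V \<Longrightarrow> comult E' (f ` A) \<longleftrightarrow> comult E A"
  unfolding comult_def by (simp add: edge eq subset_eq)

lemma card_image_sub: "A \<subseteq> V \<Longrightarrow> card (f ` A) = card A"
  using inj by (meson card_image inj_on_subset)

lemma clus_image: "A \<subseteq> V \<Longrightarrow> clus E' k (f ` A) \<longleftrightarrow> clus E k A"
  unfolding clus_def all_subset_image using p3free_image[of A] indep_image card_image_sub
  by (metis subset_trans)

lemma pol1_image: "W \<subseteq> V \<Longrightarrow> pol1 E' k (f ` W) \<longleftrightarrow> pol1 E k W"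
  unfolding pol1_def ex_subset_image
  by (intro ex_cong1 conj_cong refl) (auto simp: diff indep_image clus_image subset_trans[of _ W V] Diff_subset[THEN subset_trans])

lemma monopolar_image: "W \<subseteq> V \<Longrightarrow> monopolar E' (f ` W) \<longleftrightarrow> monopolar E W"
  unfolding monopolar_def ex_subset_image
  by (intro ex_cong1 conj_cong refl) (auto simp: diff indep_image p3free_image subset_trans[of _ W V] Diff_subset[THEN subset_trans])

lemma min_obs_image:
  assumes "\<And>W. W \<subseteq> V \<Longrightarrow> P' (f ` W) \<longleftrightarrow> P W"
  shows "min_obs P' (f ` V) \<longleftrightarrow> min_obs P V"
proof -
  have "(\<forall>W\<subset>f ` V. P' W) \<longleftrightarrow> (\<forall>W\<subseteq>f ` V. W \<noteq> f ` V \<longrightarrow> P' W)" by blast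
  also have "\<dots> \<longleftrightarrow> (\<forall>W\<subseteq>V. f ` W \<noteq> f ` V \<longrightarrow> P' (f ` W))" by (rule all_subset_image)
  also have "\<dots> \<longleftrightarrow> (\<forall>W\<subseteq>V. W \<noteq> V \<longrightarrow> P W)" by (simp add: inj_sub assms cong: imp_cong)
  also have "\<dots> \<longleftrightarrow> (\<forall>W\<subset>V. P W)" by blast
  finally show ?thesis unfolding min_obs_def using assms[of V] by blast
qed

lemma nonadj_image: "A \<subseteq> V \<Longrightarrow> B \<subseteq> V \<Longrightarrow> nonadj E A B \<Longrightarrow> nonadj E' (f ` A) (f ` B)"
  using inj_on_image_Int[OF inj, of A B] unfolding nonadj_def by (auto simp: edge subset_eq)

lemma conn_image_imp:
  assumes "conn E' (f ` V)" shows "conn E V"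
  unfolding conn_def
proof (intro conjI allI impI)
  show "V \<noteq> {}" using assms unfolding conn_def by blast
  fix X Y assume XY: "X \<union> Y = V" "nonadj E X Y"
  then have "nonadj E' (f ` X) (f ` Y)" using nonadj_image[of X Y] by blast
  moreover have "f ` X \<union> f ` Y = f ` V" using XY(1) by blast
  ultimately show "X = {} \<or> Y = {}" using assms unfolding conn_def by blast
qed

end

lemma gisoE:
  assumes "giso E V E' V'"
  obtains f where "V' = f ` V" "inj_on f V" "\<And>x y. x \<in> V \<Longrightarrow> y \<in> V \<Longrightarrow> E' (f x) (f y) \<longleftrightarrow> E x y"
  using assms unfolding giso_def bij_betw_def by metis

lemma giso_p4free: "giso E V E' V' \<Longrightarrow> p4free E' V' \<longleftrightarrow> p4free E V"
  by (erule gisoE) (simp add: p4free_image[of _ V E' E])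

lemma giso_min_obs_pol1: "giso E V E' V' \<Longrightarrow> min_obs (pol1 E' k) V' \<longleftrightarrow> min_obs (pol1 E k) V"
  by (erule gisoE) (simp add: min_obs_image[of _ V E' E] pol1_image[of _ V E' E])

lemma giso_min_obs_monopolar: "giso E V E' V' \<Longrightarrow> min_obs (monopolar E') V' \<longleftrightarrow> min_obs (monopolar E) V"
  by (erule gisoE) (simp add: min_obs_image[of _ V E' E] monopolar_image[of _ V E' E])

lemma giso_conn_imp: "giso E V E' V' \<Longrightarrow> conn E' V' \<Longrightarrow> conn E V"
  by (erule gisoE) (simp add: conn_image_imp[of _ V E' E])

lemma giso_conn: "giso E V E' V' \<Longrightarrow> conn E' V' \<longleftrightarrow> conn E V"
  using giso_conn_imp giso_sym by metis

section \<open>Translation from digraphs\<close>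

definition padj :: "'a pair_pre_digraph \<Rightarrow> 'a \<Rightarrow> 'a \<Rightarrow> bool" where
  "padj G u v \<longleftrightarrow> (u, v) \<in> parcs G"

text \<open>Keeps induced subgraphs within pair digraphs, so that every graph met in the translation
  is an image under \<open>with_proj\<close>.\<close>

definition prestrict :: "'a pair_pre_digraph \<Rightarrow> 'a set \<Rightarrow> 'a pair_pre_digraph" where
  "prestrict G A = \<lparr> pverts = A, parcs = {(u, v) \<in> parcs G. u \<in> A \<and> v \<in> A} \<rparr>"

lemma with_proj_restrict: "with_proj G \<restriction> A = with_proj (prestrict G A)"
  unfolding induce_subgraph_def with_proj_def prestrict_def by auto

lemma pverts_prestrict [simp]: "pverts (prestrict G A) = A"
  by (simp add: prestrict_def)

lemma padj_prestrict: "u \<in> A \<Longrightarrow> v \<in> A \<Longrightarrow> padj (prestrict G A) u v \<longleftrightarrow> padj G u v"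
  by (simp add: prestrict_def padj_def)

lemma pair_graph_iff:
  "pair_graph G \<longleftrightarrow> finite (pverts G) \<and> sgraph (padj G) \<and> parcs G \<subseteq> pverts G \<times> pverts G"
proof
  assume "pair_graph G"
  then interpret pair_graph G .
  have "(v, u) \<in> parcs G" if "(u, v) \<in> parcs G" for u v
    using pair_sym_arcs that by (auto simp: symmetric_def dest: symD)
  then show "finite (pverts G) \<and> sgraph (padj G) \<and> parcs G \<subseteq> pverts G \<times> pverts G"
    using pair_finite_verts pair_no_loops in_arcsD1 in_arcsD2 unfolding sgraph_def padj_def by fastforce
next
  assume *: "finite (pverts G) \<and> sgraph (padj G) \<and> parcs G \<subseteq> pverts G \<times> pverts G"
  then have "finite (parcs G)" by (meson finite_SigmaI finite_subset)
  moreover have "symmetric (with_proj G)" using * unfolding sgraph_def padj_def symmetric_def by (auto intro: symI)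
  ultimately show "pair_graph G" using * unfolding sgraph_def padj_def by unfold_locales auto
qed

lemma pair_graph_prestrict: "pair_graph G \<Longrightarrow> A \<subseteq> pverts G \<Longrightarrow> pair_graph (prestrict G A)"
  unfolding pair_graph_iff sgraph_def padj_def prestrict_def by (auto intro: finite_subset)

lemma graph_with_proj: "pair_graph G \<Longrightarrow> graph (with_proj G)"
proof -
  assume "pair_graph G"
  then interpret pair_graph G .
  show ?thesis by unfold_locales
qed

text \<open>In a \<open>P\<^sub>3\<close>-free graph a walk can be shortcut at every step, so
  reachability collapses to equality or adjacency.\<close>

lemma reach_p3free:
  assumes "pair_graph K" "p3free (padj K) (pverts K)"
  shows "u \<rightarrow>\<^sup>*\<^bsub>with_proj K\<^esub> v \<longleftrightarrow> u \<in> pverts K \<and> v \<in> pverts K \<and> (u = v \<or> padj K u v)"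
proof
  interpret pair_graph K using assms(1) .
  {
    assume "u \<rightarrow>\<^sup>*\<^bsub>with_proj K\<^esub> v"
    then show "u \<in> pverts K \<and> v \<in> pverts K \<and> (u = v \<or> padj K u v)"
    proof (induction rule: reachable_induct)
      case base
      then show ?case by simp
    next
      case (step x y)
      then have xy: "padj K x y" "x \<in> pverts K" "y \<in> pverts K"
        by (auto simp: padj_def intro: in_arcsD1 in_arcsD2)
      then show ?case using step.IH assms(2) unfolding p3free_def by blast
    qed
  }
  assume "u \<in> pverts K \<and> v \<in> pverts K \<and> (u = v \<or> padj K u v)"
  then show "u \<rightarrow>\<^sup>*\<^bsub>with_proj K\<^esub> v" unfolding padj_def by (auto intro: reachable_adjI)
qed

text \<open>In a cluster the ends of a path on three vertices lie in one complete component.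
  Conversely, vertices of one component are mutually reachable, hence equal or adjacent.\<close>

lemma cluster_iff:
  assumes "pair_graph K"
  shows "cluster (with_proj K) \<longleftrightarrow> p3free (padj K) (pverts K)"
proof
  interpret pair_graph K using assms .
  interpret sgraph "padj K" using assms pair_graph_iff by blast
  {
    assume cl: "cluster (with_proj K)"
    show "p3free (padj K) (pverts K)" unfolding p3free_def
    proof (intro ballI impI)
      fix x y z assume *: "x \<in> pverts K" "y \<in> pverts K" "z \<in> pverts K" "padj K x y" "padj K y z" "x \<noteq> z"
      define C where "C = with_proj K \<restriction> {v. x \<rightarrow>\<^sup>*\<^bsub>with_proj K\<^esub> v}"
      have "C \<in> sccs" unfolding C_def using induce_reachable_is_in_sccs[of x] * by simp
      then obtain n where "complete_digraph n C" using cl unfolding cluster_def by blast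
      moreover have r: "x \<rightarrow>\<^sup>*\<^bsub>with_proj K\<^esub> x" "x \<rightarrow>\<^sup>*\<^bsub>with_proj K\<^esub> y" "y \<rightarrow>\<^sup>*\<^bsub>with_proj K\<^esub> z"
        using * unfolding padj_def by (auto intro: reachable_adjI)
      moreover have "x \<rightarrow>\<^sup>*\<^bsub>with_proj K\<^esub> z" using r reachable_trans by blast
      ultimately have "(x, z) \<in> arcs_ends C" using * unfolding complete_digraph_def C_def by simp
      then show "padj K x z" unfolding C_def with_proj_restrict padj_def prestrict_def by simp
    qed
  }
  assume p3: "p3free (padj K) (pverts K)"
  show "cluster (with_proj K)" unfolding cluster_def
  proof (intro conjI ballI)
    show "graph (with_proj K)" using graph_with_proj assms .
    fix C assume C: "C \<in> sccs"
    then have "induced_subgraph C (with_proj K)" "strongly_connected C" unfolding sccs_def by auto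
    then have V: "verts C \<subseteq> pverts K" "C = with_proj K \<restriction> verts C"
      by (auto simp: induced_subgraph_def subgraph_def compatible_def induce_subgraph_def)
    then have eq: "C = with_proj (prestrict K (verts C))" using with_proj_restrict by metis
    have reach: "u \<rightarrow>\<^sup>*\<^bsub>with_proj K\<^esub> v" if "u \<in> verts C" "v \<in> verts C" for u v
    proof -
      have "verts C \<in> sccs_verts" using C sccs_verts_conv by blast
      then show ?thesis using that unfolding in_sccs_verts_conv_reachable by blast
    qed
    have "arcs_ends C = parcs (prestrict K (verts C))" using eq with_proj_simps(3) by metis
    moreover have "(u, v) \<in> parcs (prestrict K (verts C)) \<longleftrightarrow> u \<in> verts C \<and> v \<in> verts C \<and> u \<noteq> v" for u v
      using reach[of u v] reach_p3free[OF assms p3, of u v] irr unfolding prestrict_def padj_def by auto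
    ultimately have "arcs_ends C = {(u, v). (u, v) \<in> verts C \<times> verts C \<and> u \<noteq> v}" by auto
    moreover have "graph C" using eq graph_with_proj[OF pair_graph_prestrict[OF assms V(1)]] by simp
    ultimately show "\<exists>n. complete_digraph n C" unfolding complete_digraph_def by blast
  qed
qed

text \<open>Components are the closed neighbourhoods \<open>N u\<close>. An independent set meets
  each of them at most once, and one representative from each forms an independent set, so the two
  counts bound each other.\<close>

lemma card_sccs_iff:
  assumes "pair_graph K" "p3free (padj K) (pverts K)"
  shows "card (pre_digraph.sccs (with_proj K)) \<le> k \<longleftrightarrow> clus (padj K) k (pverts K)"
proof -
  interpret pair_graph K using assms(1) .
  interpret sgraph "padj K" using assms pair_graph_iff by blast
  define N where "N u = {v \<in> pverts K. v = u \<or> padj K u v}" for u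
  have p3: "padj K a c" if "a \<in> pverts K" "b \<in> pverts K" "c \<in> pverts K" "padj K a b" "padj K b c" "a \<noteq> c" for a b c
    using assms(2) that unfolding p3free_def by blast
  note R = reach_p3free[OF assms]
  have N: "scc_of u = N u" if "u \<in> pverts K" for u
    unfolding scc_of_def N_def R using that sym by blast
  have sv: "sccs_verts = N ` pverts K"
  proof -
    have "sccs_verts = scc_of ` pverts K"
    proof (intro set_eqI iffI)
      fix S assume S: "S \<in> sccs_verts"
      then obtain u where u: "u \<in> S" unfolding sccs_verts_def by blast
      then have "S = scc_of u" using S unfolding in_sccs_verts_conv_reachable scc_of_def by blast
      moreover have "u \<in> pverts K" using S u unfolding in_sccs_verts_conv_reachable R by blast
      ultimately show "S \<in> scc_of ` pverts K" by blast
    next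
      fix S assume "S \<in> scc_of ` pverts K"
      then obtain u where u: "u \<in> pverts K" "S = scc_of u" by blast
      then have "u \<in> S" unfolding scc_of_def R by blast
      then show "S \<in> sccs_verts" unfolding in_sccs_verts_conv_reachable u(2) scc_of_def
        by (auto intro: reachable_trans)
    qed
    then show ?thesis using N by (simp cong: image_cong)
  qed
  have fin: "finite (N ` pverts K)" using pair_finite_verts by simp
  have cs: "card (pre_digraph.sccs (with_proj K)) = card (N ` pverts K)" using card_sccs_verts sv by simp
  have NE: "N u = N v" if "u \<in> pverts K" "v \<in> pverts K" "padj K u v" for u v
  proof -
    have "w \<in> N u \<longleftrightarrow> w \<in> N v" for w
      unfolding N_def using that sym[of u v] p3[of u v w] p3[of v u w] by auto
    then show ?thesis by blast
  qed
  show ?thesis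
  proof
    assume le: "card (pre_digraph.sccs (with_proj K)) \<le> k"
    show "clus (padj K) k (pverts K)" unfolding clus_def
    proof (intro conjI allI impI assms(2))
      fix S assume S: "S \<subseteq> pverts K" "indep (padj K) S"
      have "inj_on N S"
      proof (rule inj_onI)
        fix x y assume xy: "x \<in> S" "y \<in> S" "N x = N y"
        then have "y \<in> N x" using S(1) unfolding N_def by blast
        then show "x = y" using S(2) xy unfolding N_def indep_def by blast
      qed
      then have "card S = card (N ` S)" by (simp add: card_image)
      also have "\<dots> \<le> card (N ` pverts K)" using S fin by (intro card_mono image_mono)
      finally show "card S \<le> k" using le cs by simp
    qed
  next
    assume cl: "clus (padj K) k (pverts K)"
    define r where "r X = (SOME u. u \<in> pverts K \<and> N u = X)" for X
    have r: "r X \<in> pverts K" "N (r X) = X" if "X \<in> N ` pverts K" for X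
    proof -
      have "\<exists>u. u \<in> pverts K \<and> N u = X" using that by blast
      then have "r X \<in> pverts K \<and> N (r X) = X" unfolding r_def by (rule someI_ex)
      then show "r X \<in> pverts K" "N (r X) = X" by auto
    qed
    have "inj_on r (N ` pverts K)" by (rule inj_onI) (metis r(2))
    then have "card (N ` pverts K) = card (r ` N ` pverts K)" by (simp add: card_image)
    also have "\<dots> \<le> k"
    proof (rule clus_indep_card[OF cl])
      show "r ` N ` pverts K \<subseteq> pverts K" using r by blast
      show "indep (padj K) (r ` N ` pverts K)" unfolding indep_def
      proof (intro ballI notI)
        fix x y assume "x \<in> r ` N ` pverts K" "y \<in> r ` N ` pverts K" and xy: "padj K x y"
        then obtain X Y where X: "X \<in> N ` pverts K" "x = r X" and Y: "Y \<in> N ` pverts K" "y = r Y" by blast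
        then have "X = Y" using NE[of x y] r(1,2)[OF X(1)] r(1,2)[OF Y(1)] xy by metis
        then show False using xy X Y irr by simp
      qed
    qed
    finally show "card (pre_digraph.sccs (with_proj K)) \<le> k" using cs by simp
  qed
qed

lemma cluster_at_most_iff:
  assumes "pair_graph K"
  shows "cluster (with_proj K) \<and> enat (card (pre_digraph.sccs (with_proj K))) \<le> enat k
    \<longleftrightarrow> clus (padj K) k (pverts K)"
  using cluster_iff[OF assms] card_sccs_iff[OF assms, of k] clus_def[of "padj K" k "pverts K"] by auto

text \<open>The parts are the classes \<open>N u\<close> of non-adjacency, and the bound \<infinity>
  admits any number of them.\<close>

lemma complete_multipartite_infty_iff:
  assumes "pair_graph K"
  shows "complete_multipartite_at_most \<infinity> (with_proj K) \<longleftrightarrow> comult (padj K) (pverts K)"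
proof
  interpret sgraph "padj K" using assms pair_graph_iff by blast
  {
    assume "complete_multipartite_at_most \<infinity> (with_proj K)"
    then obtain P where P: "partition_on (pverts K) P"
      "\<And>u v. u \<in> pverts K \<Longrightarrow> v \<in> pverts K \<Longrightarrow> padj K u v \<longleftrightarrow> \<not> (\<exists>X\<in>P. u \<in> X \<and> v \<in> X)"
      unfolding complete_multipartite_at_most_def padj_def by auto
    show "comult (padj K) (pverts K)" unfolding comult_def
    proof (intro ballI impI)
      fix x y z assume *: "x \<in> pverts K" "y \<in> pverts K" "z \<in> pverts K" "\<not> padj K x y" "\<not> padj K y z"
      then obtain X Y where XY: "X \<in> P" "Y \<in> P" "x \<in> X" "y \<in> X" "y \<in> Y" "z \<in> Y" using P(2) by metis
      then have "X = Y" using P(1) unfolding partition_on_def disjoint_def by blast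
      then show "\<not> padj K x z" using P(2) * XY by blast
    qed
  }
  assume cm: "comult (padj K) (pverts K)"
  define N where "N u = {v \<in> pverts K. \<not> padj K u v}" for u
  have NE: "N u = N v" if "u \<in> pverts K" "v \<in> pverts K" "\<not> padj K u v" for u v
  proof -
    have c: "\<not> padj K x z" if "x \<in> pverts K" "y \<in> pverts K" "z \<in> pverts K" "\<not> padj K x y" "\<not> padj K y z" for x y z
      using cm that unfolding comult_def by blast
    have "w \<in> N u \<longleftrightarrow> w \<in> N v" for w
      unfolding N_def using c[of v u w] c[of u v w] that sym[of v u] by auto
    then show ?thesis by blast
  qed
  have self: "u \<in> N u" if "u \<in> pverts K" for u unfolding N_def using that irr by blast
  have "partition_on (pverts K) (N ` pverts K)"
  proof (rule partition_onI)
    show "\<Union> (N ` pverts K) = pverts K" using self unfolding N_def by blast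
    show "disjnt X Y" if XY: "X \<in> N ` pverts K" "Y \<in> N ` pverts K" "X \<noteq> Y" for X Y
    proof (rule ccontr)
      assume "\<not> disjnt X Y"
      obtain u v where uv: "u \<in> pverts K" "v \<in> pverts K" "X = N u" "Y = N v" using XY by blast
      obtain w where "w \<in> N u" "w \<in> N v" using \<open>\<not> disjnt X Y\<close> uv unfolding disjnt_def by blast
      then have "N u = N w" "N v = N w" using uv NE[of u w] NE[of v w] unfolding N_def by blast+
      then show False using XY(3) uv by simp
    qed
    show "{} \<notin> N ` pverts K" using self by blast
  qed
  moreover have "padj K u v \<longleftrightarrow> \<not> (\<exists>X\<in>N ` pverts K. u \<in> X \<and> v \<in> X)" if V: "u \<in> pverts K" "v \<in> pverts K" for u v
  proof
    assume uv: "padj K u v"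
    show "\<not> (\<exists>X\<in>N ` pverts K. u \<in> X \<and> v \<in> X)"
    proof
      assume "\<exists>X\<in>N ` pverts K. u \<in> X \<and> v \<in> X"
      then obtain w where w: "w \<in> pverts K" "u \<in> N w" "v \<in> N w" by blast
      then have "\<not> padj K u w" "\<not> padj K w v" using sym[of u w] unfolding N_def by blast+
      then show False using cm uv V w(1) unfolding comult_def by blast
    qed
  next
    assume no: "\<not> (\<exists>X\<in>N ` pverts K. u \<in> X \<and> v \<in> X)"
    show "padj K u v"
    proof (rule ccontr)
      assume "\<not> padj K u v"
      then have "v \<in> N u" using V unfolding N_def by blast
      then show False using no self V by blast
    qed
  qed
  ultimately show "complete_multipartite_at_most \<infinity> (with_proj K)"
    unfolding complete_multipartite_at_most_def using graph_with_proj[OF assms]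
    by (intro conjI exI[of _ "N ` pverts K"]) (auto simp: padj_def)
qed

lemma complete_multipartite_1_iff:
  assumes "pair_graph K"
  shows "complete_multipartite_at_most 1 (with_proj K) \<longleftrightarrow> indep (padj K) (pverts K)"
proof
  assume "complete_multipartite_at_most 1 (with_proj K)"
  then obtain P where P: "partition_on (pverts K) P" "enat (card P) \<le> 1"
    "\<And>u v. u \<in> pverts K \<Longrightarrow> v \<in> pverts K \<Longrightarrow> padj K u v \<longleftrightarrow> \<not> (\<exists>X\<in>P. u \<in> X \<and> v \<in> X)"
    unfolding complete_multipartite_at_most_def padj_def by auto
  \<comment> \<open>An infinite set has cardinality 0 and would pass the bound.\<close>
  have "finite P" using finite_elements[OF _ P(1)] assms pair_graph_iff by blast
  then have "card P \<le> 1 \<Longrightarrow> X = Y" if "X \<in> P" "Y \<in> P" for X Y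
    using that by (metis One_nat_def card_le_Suc0_iff_eq)
  then have one: "X = Y" if "X \<in> P" "Y \<in> P" for X Y using that P(2) by (simp add: one_enat_def)
  show "indep (padj K) (pverts K)" unfolding indep_def
  proof (intro ballI)
    fix u v assume uv: "u \<in> pverts K" "v \<in> pverts K"
    then obtain X Y where "X \<in> P" "u \<in> X" "Y \<in> P" "v \<in> Y" using P(1) unfolding partition_on_def by blast
    then show "\<not> padj K u v" using P(3)[OF uv] one[of X Y] by blast
  qed
next
  assume ind: "indep (padj K) (pverts K)"
  \<comment> \<open>Blocks of a partition are non-empty, so the empty graph takes the partition
    without blocks.\<close>
  define P where "P = (if pverts K = {} then {} else {pverts K})"
  have "partition_on (pverts K) P" unfolding P_def partition_on_def disjoint_def by auto
  moreover have "enat (card P) \<le> 1" unfolding P_def by (auto simp: one_enat_def)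
  moreover have "padj K u v \<longleftrightarrow> \<not> (\<exists>X\<in>P. u \<in> X \<and> v \<in> X)" if "u \<in> pverts K" "v \<in> pverts K" for u v
    using ind that unfolding P_def indep_def by auto
  ultimately show "complete_multipartite_at_most 1 (with_proj K)"
    unfolding complete_multipartite_at_most_def using graph_with_proj[OF assms]
    by (intro conjI exI[of _ P]) (auto simp: padj_def)
qed

lemma indep_prestrict: "indep (padj (prestrict G A)) A \<longleftrightarrow> indep (padj G) A"
  using indep_image[of id A "padj (prestrict G A)" "padj G" A] by (simp add: padj_prestrict)

lemma comult_prestrict: "comult (padj (prestrict G A)) A \<longleftrightarrow> comult (padj G) A"
  using comult_image[of id A "padj (prestrict G A)" "padj G" A] by (simp add: padj_prestrict)

lemma p3free_prestrict: "p3free (padj (prestrict G A)) A \<longleftrightarrow> p3free (padj G) A"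
  using p3free_image[of id A "padj (prestrict G A)" "padj G" A] by (simp add: padj_prestrict)

lemma clus_prestrict: "clus (padj (prestrict G A)) k A \<longleftrightarrow> clus (padj G) k A"
  using clus_image[of id A "padj (prestrict G A)" "padj G" A] by (simp add: padj_prestrict)

lemma prestrict_prestrict: "A \<subseteq> W \<Longrightarrow> prestrict (prestrict G W) A = prestrict G A"
  unfolding prestrict_def by auto

lemma prestrict_pverts: "pair_graph G \<Longrightarrow> prestrict G (pverts G) = G"
  unfolding pair_graph_iff prestrict_def by (intro pair_pre_digraph.equality) auto

lemma polar_prestrict_iff:
  "polar s k (with_proj (prestrict G W)) \<longleftrightarrow>
    (\<exists>A\<subseteq>W. complete_multipartite_at_most s (with_proj (prestrict G A)) \<and>
      cluster (with_proj (prestrict G (W - A))) \<and>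
      enat (card (pre_digraph.sccs (with_proj (prestrict G (W - A))))) \<le> k)"
proof -
  have "polar_partition s k (with_proj (prestrict G W)) A B \<longleftrightarrow> A \<subseteq> W \<and> B = W - A \<and>
     complete_multipartite_at_most s (with_proj (prestrict G A)) \<and>
      cluster (with_proj (prestrict G (W - A))) \<and>
      enat (card (pre_digraph.sccs (with_proj (prestrict G (W - A))))) \<le> k" for A B
  proof (cases "A \<subseteq> W \<and> B = W - A")
    case True
    then show ?thesis unfolding polar_partition_def with_proj_restrict by (auto simp: prestrict_prestrict)
  next
    case False
    then have "\<not> (A \<union> B = W \<and> A \<inter> B = {})" by blast
    then show ?thesis using False unfolding polar_partition_def by auto
  qed
  then show ?thesis unfolding polar_def by blast
qed

context
  fixes G :: "'a pair_pre_digraph" and W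
  assumes G: "pair_graph G" and W: "W \<subseteq> pverts G"
begin

private lemma sub: "A \<subseteq> W \<Longrightarrow> pair_graph (prestrict G A)" "A \<subseteq> W \<Longrightarrow> pair_graph (prestrict G (W - A))"
  using pair_graph_prestrict[OF G] W by blast+

lemma polar_infty_iff: "polar \<infinity> (enat k) (with_proj (prestrict G W)) \<longleftrightarrow> polinf (padj G) k W"
  unfolding polar_prestrict_iff polinf_def
  using complete_multipartite_infty_iff[OF sub(1)] cluster_at_most_iff[OF sub(2), of _ k]
  by (auto simp: comult_prestrict clus_prestrict)

lemma polar_1_iff: "polar 1 (enat k) (with_proj (prestrict G W)) \<longleftrightarrow> pol1 (padj G) k W"
  unfolding polar_prestrict_iff pol1_def
  using complete_multipartite_1_iff[OF sub(1)] cluster_at_most_iff[OF sub(2), of _ k]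
  by (auto simp: indep_prestrict clus_prestrict)

lemma polar_1_infty_iff: "polar 1 \<infinity> (with_proj (prestrict G W)) \<longleftrightarrow> monopolar (padj G) W"
  unfolding polar_prestrict_iff monopolar_def
  using complete_multipartite_1_iff[OF sub(1)] cluster_iff[OF sub(2)]
  by (auto simp: indep_prestrict p3free_prestrict)

end

section \<open>Induced subgraphs, isomorphism and connectivity\<close>

abbreviation piso :: "'a pair_pre_digraph \<Rightarrow> ('b \<Rightarrow> 'b \<Rightarrow> bool) \<Rightarrow> 'b set \<Rightarrow> bool" where
  "piso G \<equiv> giso (padj G) (pverts G)"

abbreviation pwf :: "'a pair_pre_digraph \<Rightarrow> bool" where
  "pwf G \<equiv> parcs G \<subseteq> pverts G \<times> pverts G"

lemma induced_subgraph_iff: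
  assumes "pair_graph G"
  shows "induced_subgraph H (with_proj G) \<longleftrightarrow> (\<exists>W\<subseteq>pverts G. H = with_proj (prestrict G W))"
proof
  interpret pair_graph G using assms .
  {
    assume "induced_subgraph H (with_proj G)"
    then have "verts H \<subseteq> pverts G" "H = with_proj G \<restriction> verts H"
      by (auto simp: induced_subgraph_def subgraph_def compatible_def induce_subgraph_def)
    then show "\<exists>W\<subseteq>pverts G. H = with_proj (prestrict G W)" using with_proj_restrict by metis
  }
  assume "\<exists>W\<subseteq>pverts G. H = with_proj (prestrict G W)"
  then show "induced_subgraph H (with_proj G)" using induced_induce with_proj_restrict by metis
qed

text \<open>A digraph isomorphism also carries an arc map and new end functions. Equality with a
  pair digraph makes the end functions the projections, so the arc map is determined by the vertex
  map and only the latter remains.\<close>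

lemma digraph_iso_iff:
  assumes "pwf G" "pwf H"
  shows "digraph_iso (with_proj G) (with_proj H) \<longleftrightarrow> piso G (padj H) (pverts H)"
proof
  assume "digraph_iso (with_proj G) (with_proj H)"
  then obtain f where f: "pre_digraph.digraph_isomorphism (with_proj G) f" "with_proj H = app_iso f (with_proj G)"
    unfolding digraph_iso_def by blast
  have "verts (with_proj H) = iso_verts f ` pverts G" "arcs (with_proj H) = iso_arcs f ` parcs G"
    "tail (with_proj H) = iso_tail f" "head (with_proj H) = iso_head f" unfolding f(2) by simp_all
  then have eq: "pverts H = iso_verts f ` pverts G" "parcs H = iso_arcs f ` parcs G"
    "iso_tail f = fst" "iso_head f = snd" by simp_all
  have inj: "inj_on (iso_verts f) (pverts G)"
    and ends: "\<And>u v. (u, v) \<in> parcs G \<Longrightarrow> iso_arcs f (u, v) = (iso_verts f u, iso_verts f v)"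
    using f(1) eq unfolding pre_digraph.digraph_isomorphism_def by (auto simp: prod_eq_iff)
  show "piso G (padj H) (pverts H)"
  proof (rule gisoI)
    show "bij_betw (iso_verts f) (pverts G) (pverts H)" using inj eq unfolding bij_betw_def by blast
    fix x y assume xy: "x \<in> pverts G" "y \<in> pverts G"
    show "padj G x y \<longleftrightarrow> padj H (iso_verts f x) (iso_verts f y)"
    proof
      assume "padj G x y"
      then show "padj H (iso_verts f x) (iso_verts f y)" unfolding padj_def eq using ends by force
    next
      assume "padj H (iso_verts f x) (iso_verts f y)"
      then obtain u v where uv: "(u, v) \<in> parcs G" "iso_verts f u = iso_verts f x" "iso_verts f v = iso_verts f y"
        unfolding padj_def eq using ends by fastforce
      moreover have "u \<in> pverts G" "v \<in> pverts G" using uv(1) assms(1) by blast+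
      ultimately show "padj G x y" unfolding padj_def using inj xy by (metis inj_onD)
    qed
  qed
next
  assume "piso G (padj H) (pverts H)"
  then obtain f where f: "pverts H = f ` pverts G" "inj_on f (pverts G)"
    "\<And>x y. x \<in> pverts G \<Longrightarrow> y \<in> pverts G \<Longrightarrow> padj H (f x) (f y) \<longleftrightarrow> padj G x y"
    by (rule gisoE) blast
  define h where "h = \<lparr> iso_verts = f, iso_arcs = map_prod f f, iso_head = snd, iso_tail = fst \<rparr>"
  have "inj_on (map_prod f f) (parcs G)"
    using map_prod_inj_on[OF f(2) f(2)] assms(1) by (rule inj_on_subset)
  moreover have "wf_digraph (with_proj G)" using assms(1) by unfold_locales auto
  ultimately have "pre_digraph.digraph_isomorphism (with_proj G) h"
    unfolding pre_digraph.digraph_isomorphism_def h_def using f(2) by auto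
  moreover have "parcs H = map_prod f f ` parcs G"
  proof (intro set_eqI iffI)
    fix e assume e: "e \<in> parcs H"
    then obtain x y where xy: "e = (f x, f y)" "x \<in> pverts G" "y \<in> pverts G" using assms(2) f(1) by auto
    then have "(x, y) \<in> parcs G" using f(3)[OF xy(2,3)] e unfolding padj_def by simp
    then show "e \<in> map_prod f f ` parcs G" using xy(1) by force
  next
    fix e assume "e \<in> map_prod f f ` parcs G"
    then obtain x y where xy: "e = (f x, f y)" "(x, y) \<in> parcs G" by auto
    then have "x \<in> pverts G" "y \<in> pverts G" using assms(1) by auto
    then show "e \<in> parcs H" using f(3) xy unfolding padj_def by simp
  qed
  then have "with_proj H = app_iso h (with_proj G)"
    unfolding app_iso_def h_def with_proj_def using f(1) by simp
  ultimately show "digraph_iso (with_proj G) (with_proj H)" unfolding digraph_iso_def by blast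
qed

text \<open>Connectivity of a digraph is strong connectivity of its symmetric closure, here
  \<open>G\<close> itself. A cut blocks reachability, and the set reachable from a vertex is one
  side of a cut.\<close>

lemma connected_iff:
  assumes "pair_graph G"
  shows "Digraph_Component.connected (with_proj G) \<longleftrightarrow> conn (padj G) (pverts G)"
proof -
  interpret pair_graph G using assms .
  interpret sgraph "padj G" using assms pair_graph_iff by blast
  have "mk_symmetric (with_proj G) = G"
    unfolding mk_symmetric_def using sym unfolding padj_def
    by (intro pair_pre_digraph.equality) auto
  then have "Digraph_Component.connected (with_proj G) \<longleftrightarrow> strongly_connected (with_proj G)"
    unfolding Digraph_Component.connected_def by simp
  also have "\<dots> \<longleftrightarrow> conn (padj G) (pverts G)"
  proof
    assume sc: "strongly_connected (with_proj G)"
    show "conn (padj G) (pverts G)" unfolding conn_def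
    proof (intro conjI allI impI)
      show "pverts G \<noteq> {}" using sc unfolding strongly_connected_def by simp
      fix X Y assume XY: "X \<union> Y = pverts G" "nonadj (padj G) X Y"
      have closed: "v \<in> X" if "u \<rightarrow>\<^sup>*\<^bsub>with_proj G\<^esub> v" "u \<in> X" for u v
        using that
      proof (induction rule: reachable_induct)
        case (step x y)
        then have "padj G x y" "y \<in> pverts G" unfolding padj_def by (auto intro: in_arcsD2)
        then show ?case using step XY unfolding nonadj_def by blast
      qed
      show "X = {} \<or> Y = {}"
      proof (rule ccontr)
        assume "\<not> ?thesis"
        then obtain x y where xy: "x \<in> X" "y \<in> Y" by blast
        then have "x \<in> pverts G" "y \<in> pverts G" using XY(1) by blast+
        then have "x \<rightarrow>\<^sup>*\<^bsub>with_proj G\<^esub> y" using sc unfolding strongly_connected_def by simp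
        then show False using closed xy XY(2) unfolding nonadj_def by blast
      qed
    qed
  next
    assume c: "conn (padj G) (pverts G)"
    show "strongly_connected (with_proj G)" unfolding strongly_connected_def
    proof (intro conjI ballI)
      show "verts (with_proj G) \<noteq> {}" using c unfolding conn_def by simp
      fix u v assume uv: "u \<in> verts (with_proj G)" "v \<in> verts (with_proj G)"
      define X where "X = {w \<in> pverts G. u \<rightarrow>\<^sup>*\<^bsub>with_proj G\<^esub> w}"
      have "nonadj (padj G) X (pverts G - X)" unfolding nonadj_def
      proof (intro conjI ballI notI)
        fix x y assume *: "x \<in> X" "y \<in> pverts G - X" "padj G x y"
        then have "u \<rightarrow>\<^sup>*\<^bsub>with_proj G\<^esub> y" using reachable_adj_trans[of u x y] unfolding X_def padj_def by simp
        then show False using * unfolding X_def by blast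
      qed blast
      moreover have "X \<union> (pverts G - X) = pverts G" unfolding X_def by blast
      moreover have "u \<in> X" using uv unfolding X_def by auto
      ultimately have "pverts G - X = {}" using c unfolding conn_def by blast
      then show "u \<rightarrow>\<^sup>*\<^bsub>with_proj G\<^esub> v" using uv unfolding X_def by auto
    qed
  qed
  finally show ?thesis .
qed

section \<open>The graphs occurring in the alternatives\<close>

lemma path_graph_simps [simp]:
  "pverts (path_graph n) = {..<n}"
  "padj (path_graph n) i j \<longleftrightarrow> i < n \<and> j < n \<and> (j = Suc i \<or> i = Suc j)"
  by (auto simp: path_graph_def padj_def)

lemma complete_graph_simps [simp]:
  "pverts (complete_graph n) = {..<n}"
  "padj (complete_graph n) i j \<longleftrightarrow> i < n \<and> j < n \<and> i \<noteq> j"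
  by (auto simp: complete_graph_def padj_def)

lemma disjoint_union_simps [simp]:
  "pverts (disjoint_union G H) = pverts G <+> pverts H"
  "padj (disjoint_union G H) (Inl u) (Inl u') \<longleftrightarrow> padj G u u'"
  "padj (disjoint_union G H) (Inr v) (Inr v') \<longleftrightarrow> padj H v v'"
  "\<not> padj (disjoint_union G H) (Inl u) (Inr v)"
  "\<not> padj (disjoint_union G H) (Inr v) (Inl u)"
  by (auto simp: disjoint_union_def padj_def)

lemma graph_join_simps [simp]:
  "pverts (graph_join G H) = pverts G <+> pverts H"
  "padj (graph_join G H) (Inl u) (Inl u') \<longleftrightarrow> padj G u u'"
  "padj (graph_join G H) (Inr v) (Inr v') \<longleftrightarrow> padj H v v'"
  "padj (graph_join G H) (Inl u) (Inr v) \<longleftrightarrow> u \<in> pverts G \<and> v \<in> pverts H"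
  "padj (graph_join G H) (Inr v) (Inl u) \<longleftrightarrow> u \<in> pverts G \<and> v \<in> pverts H"
  by (auto simp: graph_join_def disjoint_union_def padj_def)

lemma copies_simps [simp]:
  "pverts (copies n G) = {..<n} \<times> pverts G"
  "padj (copies n G) (i, u) (j, v) \<longleftrightarrow> i = j \<and> i < n \<and> padj G u v"
  by (auto simp: copies_def padj_def)

lemma wf_path_graph: "pwf (path_graph n)"
  by (auto simp: path_graph_def)

lemma wf_complete_graph: "pwf (complete_graph n)"
  by (auto simp: complete_graph_def)

lemma wf_copies: "pwf G \<Longrightarrow> pwf (copies n G)"
  by (auto simp: copies_def)

lemma wf_disjoint_union:
  "pwf G \<Longrightarrow> pwf H \<Longrightarrow>
    pwf (disjoint_union G H)"
  by (auto simp: disjoint_union_def)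

lemma wf_graph_join:
  "pwf G \<Longrightarrow> pwf H \<Longrightarrow>
    pwf (graph_join G H)"
  by (auto simp: graph_join_def disjoint_union_def)

lemma giso_sumD:
  assumes "giso F (A <+> B) E V"
  shows "\<exists>f. V = f ` Inl ` A \<union> f ` Inr ` B \<and> f ` Inl ` A \<inter> f ` Inr ` B = {} \<and>
    (\<forall>x\<in>A <+> B. \<forall>y\<in>A <+> B. E (f x) (f y) \<longleftrightarrow> F x y) \<and>
    giso (\<lambda>x y. F (Inl x) (Inl y)) A E (f ` Inl ` A) \<and> giso (\<lambda>x y. F (Inr x) (Inr y)) B E (f ` Inr ` B)"
proof -
  obtain f where f: "V = f ` (A <+> B)" "inj_on f (A <+> B)"
    "\<And>x y. x \<in> A <+> B \<Longrightarrow> y \<in> A <+> B \<Longrightarrow> E (f x) (f y) \<longleftrightarrow> F x y"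
    using assms by (rule gisoE) blast
  have "inj_on f (Inl ` A)" "inj_on f (Inr ` B)" using f(2) by (auto intro: inj_on_subset simp: Plus_def)
  then have "bij_betw (f \<circ> Inl) A (f ` Inl ` A)" "bij_betw (f \<circ> Inr) B (f ` Inr ` B)"
    unfolding bij_betw_def by (auto intro!: comp_inj_on simp: image_comp)
  then have "giso (\<lambda>x y. F (Inl x) (Inl y)) A E (f ` Inl ` A)" "giso (\<lambda>x y. F (Inr x) (Inr y)) B E (f ` Inr ` B)"
    by (auto intro!: gisoI simp: f(3) InlI InrI)
  moreover have "f ` Inl ` A \<inter> f ` Inr ` B = {}"
    using inj_on_image_Int[OF f(2), of "Inl ` A" "Inr ` B"] by (auto simp: Plus_def)
  moreover have "V = f ` Inl ` A \<union> f ` Inr ` B" using f(1) by (auto simp: Plus_def)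
  ultimately show ?thesis using f(3) by blast
qed

text \<open>The relation on the sum is a parameter whose values across the two sides are only
  required to agree with \<open>E\<close>, so unions and joins are both instances.\<close>

lemma giso_sumI:
  assumes "giso F A E X" "giso F' B E Y" "X \<inter> Y = {}"
    "\<And>x y. x \<in> A \<Longrightarrow> y \<in> A \<Longrightarrow> S (Inl x) (Inl y) \<longleftrightarrow> F x y"
    "\<And>x y. x \<in> B \<Longrightarrow> y \<in> B \<Longrightarrow> S (Inr x) (Inr y) \<longleftrightarrow> F' x y"
    "\<And>x y u v. x \<in> A \<Longrightarrow> y \<in> B \<Longrightarrow> u \<in> X \<Longrightarrow> v \<in> Y \<Longrightarrow> S (Inl x) (Inr y) \<longleftrightarrow> E u v"
    "\<And>x y u v. x \<in> A \<Longrightarrow> y \<in> B \<Longrightarrow> u \<in> X \<Longrightarrow> v \<in> Y \<Longrightarrow> S (Inr y) (Inl x) \<longleftrightarrow> E v u"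
  shows "giso S (A <+> B) E (X \<union> Y)"
proof -
  obtain f where f: "X = f ` A" "inj_on f A" "\<And>x y. x \<in> A \<Longrightarrow> y \<in> A \<Longrightarrow> E (f x) (f y) \<longleftrightarrow> F x y"
    using assms(1) by (rule gisoE) blast
  obtain g where g: "Y = g ` B" "inj_on g B" "\<And>x y. x \<in> B \<Longrightarrow> y \<in> B \<Longrightarrow> E (g x) (g y) \<longleftrightarrow> F' x y"
    using assms(2) by (rule gisoE) blast
  have disj: "f x \<noteq> g y" if "x \<in> A" "y \<in> B" for x y using assms(3) f(1) g(1) that by blast
  have "inj_on (case_sum f g) (A <+> B)"
  proof (rule inj_onI)
    fix p q assume "p \<in> A <+> B" "q \<in> A <+> B" "case_sum f g p = case_sum f g q"
    then show "p = q"
      using inj_onD[OF f(2)] inj_onD[OF g(2)] disj disj[symmetric] by (elim PlusE) simp_all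
  qed
  moreover have "case_sum f g ` (A <+> B) = X \<union> Y" unfolding Plus_def f(1) g(1) by (simp add: image_Un image_comp comp_def)
  ultimately have bij: "bij_betw (case_sum f g) (A <+> B) (X \<union> Y)" unfolding bij_betw_def by blast
  show ?thesis
  proof (rule gisoI[OF bij])
    have fX: "f x \<in> X" if "x \<in> A" for x using f(1) that by blast
    have gY: "g y \<in> Y" if "y \<in> B" for y using g(1) that by blast
    fix x y assume "x \<in> A <+> B" "y \<in> A <+> B"
    then show "S x y \<longleftrightarrow> E (case_sum f g x) (case_sum f g y)"
      using assms(6)[OF _ _ fX gY] assms(7)[OF _ _ fX gY] by (elim PlusE) (simp_all add: f(3) g(3) assms(4,5))
  qed
qed

context sgraph begin

lemma giso_disjoint_union_iff:
  "piso (disjoint_union G H) E V \<longleftrightarrow>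
    (\<exists>X Y. X \<union> Y = V \<and> nonadj E X Y \<and> piso G E X \<and> piso H E Y)"
proof
  assume "piso (disjoint_union G H) E V"
  from giso_sumD[OF this[unfolded disjoint_union_simps(1)]]
  obtain f where f: "V = f ` Inl ` pverts G \<union> f ` Inr ` pverts H" "f ` Inl ` pverts G \<inter> f ` Inr ` pverts H = {}"
    "\<forall>x\<in>pverts G <+> pverts H. \<forall>y\<in>pverts G <+> pverts H. E (f x) (f y) \<longleftrightarrow> padj (disjoint_union G H) x y"
    and g: "piso G E (f ` Inl ` pverts G)" "piso H E (f ` Inr ` pverts H)"
    by auto
  have "nonadj E (f ` Inl ` pverts G) (f ` Inr ` pverts H)" unfolding nonadj_def using f(2,3) by (auto simp: Plus_def)
  then show "\<exists>X Y. X \<union> Y = V \<and> nonadj E X Y \<and> piso G E X \<and> piso H E Y"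
    using f(1) g by blast
next
  assume "\<exists>X Y. X \<union> Y = V \<and> nonadj E X Y \<and> piso G E X \<and> piso H E Y"
  then obtain X Y where XY: "X \<union> Y = V" "nonadj E X Y" "piso G E X" "piso H E Y"
    by blast
  have na: "\<not> E u v" "\<not> E v u" if "u \<in> X" "v \<in> Y" for u v
    using XY(2) nonadj_sym[OF XY(2)] that unfolding nonadj_def by blast+
  have "giso (padj (disjoint_union G H)) (pverts G <+> pverts H) E (X \<union> Y)"
    using XY(2) na by (intro giso_sumI[OF XY(3,4)]) (auto simp: nonadj_def)
  then show "piso (disjoint_union G H) E V" using XY(1) by simp
qed

lemma giso_graph_join_iff:
  "piso (graph_join G H) E V \<longleftrightarrow>
    (\<exists>X Y. X \<union> Y = V \<and> alladj E X Y \<and> piso G E X \<and> piso H E Y)"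
proof
  assume "piso (graph_join G H) E V"
  from giso_sumD[OF this[unfolded graph_join_simps(1)]]
  obtain f where f: "V = f ` Inl ` pverts G \<union> f ` Inr ` pverts H" "f ` Inl ` pverts G \<inter> f ` Inr ` pverts H = {}"
    "\<forall>x\<in>pverts G <+> pverts H. \<forall>y\<in>pverts G <+> pverts H. E (f x) (f y) \<longleftrightarrow> padj (graph_join G H) x y"
    and g: "piso G E (f ` Inl ` pverts G)" "piso H E (f ` Inr ` pverts H)"
    by auto
  have "alladj E (f ` Inl ` pverts G) (f ` Inr ` pverts H)" unfolding alladj_def using f(2,3) by (auto simp: Plus_def)
  then show "\<exists>X Y. X \<union> Y = V \<and> alladj E X Y \<and> piso G E X \<and> piso H E Y"
    using f(1) g by blast
next
  assume "\<exists>X Y. X \<union> Y = V \<and> alladj E X Y \<and> piso G E X \<and> piso H E Y"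
  then obtain X Y where XY: "X \<union> Y = V" "alladj E X Y" "piso G E X" "piso H E Y"
    by blast
  have na: "E u v" "E v u" if "u \<in> X" "v \<in> Y" for u v
    using XY(2) alladj_sym[OF XY(2)] that unfolding alladj_def by blast+
  have "giso (padj (graph_join G H)) (pverts G <+> pverts H) E (X \<union> Y)"
    using XY(2) na by (intro giso_sumI[OF XY(3,4)]) (auto simp: alladj_def)
  then show "piso (graph_join G H) E V" using XY(1) by simp
qed

lemma giso_P3_iff:
  "piso (path_graph 3) E X \<longleftrightarrow>
    (\<exists>a b c. X = {a, b, c} \<and> E a b \<and> E b c \<and> \<not> E a c \<and> a \<noteq> c)"
proof
  assume "piso (path_graph 3) E X"
  then obtain f where f: "X = f ` {..<3::nat}" "inj_on f {..<3::nat}"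
    "\<And>i j. i \<in> {..<3} \<Longrightarrow> j \<in> {..<3} \<Longrightarrow> E (f i) (f j) \<longleftrightarrow> padj (path_graph 3) i j"
    unfolding path_graph_simps(1) by (rule gisoE) blast
  have "{..<3::nat} = {0, 1, 2}" by auto
  then have "X = {f 0, f 1, f 2}" using f(1) by auto
  moreover have "E (f 0) (f 1)" "E (f 1) (f 2)" "\<not> E (f 0) (f 2)" using f(3) by auto
  moreover have "f 0 \<noteq> f 2" using inj_onD[OF f(2), of 0 2] by auto
  ultimately show "\<exists>a b c. X = {a, b, c} \<and> E a b \<and> E b c \<and> \<not> E a c \<and> a \<noteq> c" by blast
next
  assume "\<exists>a b c. X = {a, b, c} \<and> E a b \<and> E b c \<and> \<not> E a c \<and> a \<noteq> c"
  then obtain a b c where abc: "X = {a, b, c}" "E a b" "E b c" "\<not> E a c" "a \<noteq> c" by blast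
  have ne: "a \<noteq> b" "b \<noteq> c" and s: "E b a" "E c b" "\<not> E c a" using abc irr sym by blast+
  define f where "f i = (if i = 0 then a else if i = 1 then b else c)" for i :: nat
  have 3: "{..<3::nat} = {0, 1, 2}" by auto
  have "bij_betw f {..<3} X"
    unfolding bij_betw_def 3 using ne abc by (auto simp: inj_on_def f_def)
  then show "piso (path_graph 3) E X"
    unfolding path_graph_simps(1)
  proof (rule gisoI)
    fix i j :: nat assume "i \<in> {..<3}" "j \<in> {..<3}"
    then have "i = 0 \<or> i = 1 \<or> i = 2" "j = 0 \<or> j = 1 \<or> j = 2" by auto
    then show "padj (path_graph 3) i j \<longleftrightarrow> E (f i) (f j)"
      using abc s irr by (auto simp: f_def)
  qed
qed

lemma p4free_iff_giso:
  "p4free E V \<longleftrightarrow> \<not> (\<exists>W\<subseteq>V. giso E W (padj (path_graph 4)) (pverts (path_graph 4)))"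
proof
  have 4: "{..<4::nat} = {0, 1, 2, 3}" by auto
  {
    assume p4: "p4free E V"
    show "\<not> (\<exists>W\<subseteq>V. giso E W (padj (path_graph 4)) (pverts (path_graph 4)))"
    proof
      assume "\<exists>W\<subseteq>V. giso E W (padj (path_graph 4)) (pverts (path_graph 4))"
      then obtain W where W: "W \<subseteq> V" "giso E W (padj (path_graph 4)) (pverts (path_graph 4))" by blast
      from giso_sym[OF W(2)] obtain f where f: "W = f ` {..<4::nat}" "inj_on f {..<4::nat}"
        "\<And>i j. i \<in> {..<4} \<Longrightarrow> j \<in> {..<4} \<Longrightarrow> E (f i) (f j) \<longleftrightarrow> padj (path_graph 4) i j"
        unfolding path_graph_simps(1) by (rule gisoE) blast
      have "E (f 0) (f 1)" "E (f 1) (f 2)" "E (f 2) (f 3)" "\<not> E (f 0) (f 2)" "\<not> E (f 0) (f 3)" "\<not> E (f 1) (f 3)"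
        using f(3) by auto
      moreover have "f 0 \<in> V" "f 1 \<in> V" "f 2 \<in> V" "f 3 \<in> V" using f(1) W(1) 4 by auto
      ultimately show False using p4 unfolding p4free_def by blast
    qed
  }
  assume no: "\<not> (\<exists>W\<subseteq>V. giso E W (padj (path_graph 4)) (pverts (path_graph 4)))"
  show "p4free E V" unfolding p4free_def
  proof (intro ballI notI)
    fix a b c d assume V: "a \<in> V" "b \<in> V" "c \<in> V" "d \<in> V"
      and e: "E a b \<and> E b c \<and> E c d \<and> \<not> E a c \<and> \<not> E a d \<and> \<not> E b d"
    have s: "E b a" "E c b" "E d c" "\<not> E c a" "\<not> E d a" "\<not> E d b" using e sym by blast+
    have ne: "a \<noteq> b" "a \<noteq> c" "a \<noteq> d" "b \<noteq> c" "b \<noteq> d" "c \<noteq> d" using e s irr by blast+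
    define f where "f i = (if i = 0 then a else if i = 1 then b else if i = 2 then c else d)" for i :: nat
    have "bij_betw f {..<4} {a, b, c, d}"
      unfolding bij_betw_def 4 using ne by (auto simp: inj_on_def f_def)
    then have "giso (padj (path_graph 4)) {..<4} E {a, b, c, d}"
    proof (rule gisoI)
      fix i j :: nat assume "i \<in> {..<4}" "j \<in> {..<4}"
      then have "i = 0 \<or> i = 1 \<or> i = 2 \<or> i = 3" "j = 0 \<or> j = 1 \<or> j = 2 \<or> j = 3" by auto
      then show "padj (path_graph 4) i j \<longleftrightarrow> E (f i) (f j)"
        by (elim disjE) (simp_all add: f_def e s irr)
    qed
    from giso_sym[OF this] have "giso E {a, b, c, d} (padj (path_graph 4)) (pverts (path_graph 4))" by simp
    moreover have "{a, b, c, d} \<subseteq> V" using V by simp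
    ultimately show False using no by metis
  qed
qed

end

lemma matching_giso:
  assumes "giso E V E' V'" "matching E n V" shows "matching E' n V'"
proof -
  obtain f where f: "V' = f ` V" "inj_on f V" "\<And>x y. x \<in> V \<Longrightarrow> y \<in> V \<Longrightarrow> E' (f x) (f y) \<longleftrightarrow> E x y"
    using assms(1) by (rule gisoE) blast
  have "\<exists>y\<in>V'. E' x y \<and> (\<forall>z\<in>V'. E' x z \<longrightarrow> z = y)" if x: "x \<in> V'" for x
  proof -
    obtain u where u: "u \<in> V" "x = f u" using x f(1) by blast
    obtain v where v: "v \<in> V" "E u v" "\<forall>w\<in>V. E u w \<longrightarrow> w = v" using assms(2) u unfolding matching_def by blast
    show ?thesis
    proof (intro bexI conjI ballI impI)
      show "f v \<in> V'" unfolding f(1) using v(1) by (rule imageI)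
      show "E' x (f v)" using f(3)[OF u(1) v(1)] u(2) v(2) by simp
      fix z assume z: "z \<in> V'" "E' x z"
      then obtain w where w: "w \<in> V" "z = f w" using f(1) by blast
      then have "E u w" using f(3)[OF u(1) w(1)] u(2) z(2) by simp
      then show "z = f v" using v(3) w by simp
    qed
  qed
  moreover have "card V' = card V" using f(1,2) card_image by blast
  ultimately show ?thesis using assms(2) f(1) unfolding matching_def by simp
qed

lemma matching_copies_K2: "matching (padj (copies n (complete_graph 2))) n (pverts (copies n (complete_graph 2)))"
  unfolding matching_def
proof (intro conjI ballI)
  fix x assume "x \<in> pverts (copies n (complete_graph 2))"
  then obtain i u where x: "x = (i, u)" "i < n" "u < 2" by auto
  have u: "u \<noteq> 1 - u" using x(3) by presburger
  have "padj (copies n (complete_graph 2)) x (i, 1 - u)" using x u by simp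
  moreover have "(i, 1 - u) \<in> pverts (copies n (complete_graph 2))" using x by simp
  moreover have "z = (i, 1 - u)" if "padj (copies n (complete_graph 2)) x z" for z
    using that x by (cases z) auto
  ultimately show "\<exists>y\<in>pverts (copies n (complete_graph 2)). padj (copies n (complete_graph 2)) x y \<and>
      (\<forall>z\<in>pverts (copies n (complete_graph 2)). padj (copies n (complete_graph 2)) x z \<longrightarrow> z = y)" by blast
qed (auto simp: card_cartesian_product)

lemma (in sgraph) matching_imp_giso:
  "matching E n W \<Longrightarrow> piso (copies n (complete_graph 2)) E W"
proof (induction rule: matching_induct)
  case empty
  then show ?case by (auto simp: giso_def bij_betw_def)
next
  case (edge n x y W)
  obtain f where f: "W = f ` ({..<n} \<times> {..<2})" "inj_on f ({..<n} \<times> {..<2})"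
    "\<And>p q. p \<in> {..<n} \<times> {..<2} \<Longrightarrow> q \<in> {..<n} \<times> {..<2} \<Longrightarrow> E (f p) (f q) \<longleftrightarrow> padj (copies n (complete_graph 2)) p q"
    using edge.IH unfolding copies_simps complete_graph_simps by (rule gisoE) blast
  \<comment> \<open>The edge just added becomes the copy with index \<open>n\<close>.\<close>
  define g where "g p = (if fst p < n then f p else if snd p = 0 then x else y)" for p
  have D: "{..<Suc n} \<times> {..<2::nat} = {..<n} \<times> {..<2} \<union> {(n, 0), (n, 1)}" by auto
  have xy: "x \<noteq> y" "E y x" using edge.hyps irr sym by blast+
  have na: "x \<notin> W" "y \<notin> W" "\<And>w. w \<in> W \<Longrightarrow> \<not> E x w \<and> \<not> E y w \<and> \<not> E w x \<and> \<not> E w y"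
    using edge.hyps(2) nonadj_sym[OF edge.hyps(2)] unfolding nonadj_def by auto
  have gf: "g p = f p" "g p \<in> W" if "p \<in> {..<n} \<times> {..<2}" for p using that f(1) unfolding g_def by auto
  have gn: "g (n, 0) = x" "g (n, 1) = y" unfolding g_def by auto
  have "inj_on g ({..<n} \<times> {..<2})" using f(2) gf(1) by (simp cong: inj_on_cong)
  moreover have "g ` ({..<n} \<times> {..<2}) = W" using f(1) gf(1) by (simp cong: image_cong)
  ultimately have bij: "bij_betw g ({..<Suc n} \<times> {..<2}) ({x, y} \<union> W)"
    unfolding D bij_betw_def using gn na(1,2) xy by (auto simp: inj_on_Un image_Un)
  have "giso (padj (copies (Suc n) (complete_graph 2))) ({..<Suc n} \<times> {..<2}) E ({x, y} \<union> W)"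
  proof (rule gisoI[OF bij])
    fix p q :: "nat \<times> nat" assume p: "p \<in> {..<Suc n} \<times> {..<2}" and q: "q \<in> {..<Suc n} \<times> {..<2}"
    have cp: "p \<in> {..<n} \<times> {..<2} \<or> p = (n, 0) \<or> p = (n, 1)" and cq: "q \<in> {..<n} \<times> {..<2} \<or> q = (n, 0) \<or> q = (n, 1)"
      using p q D by blast+
    show "padj (copies (Suc n) (complete_graph 2)) p q \<longleftrightarrow> E (g p) (g q)"
    proof (cases "p \<in> {..<n} \<times> {..<2} \<and> q \<in> {..<n} \<times> {..<2}")
      case True
      then show ?thesis using f(3)[of p q] gf(1) by (cases p, cases q) auto
    next
      case False
      then show ?thesis using cp cq gf(2)[of p] gf(2)[of q] na(3) gn xy edge.hyps(3) irr
        by (cases p, cases q) auto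
    qed
  qed
  then show ?case by simp
qed

lemma (in sgraph) giso_copies_K2_iff:
  "piso (copies n (complete_graph 2)) E W \<longleftrightarrow> matching E n W"
  using matching_imp_giso matching_giso[OF _ matching_copies_K2] by blast

lemma (in sgraph) giso_K1_iff: "piso (complete_graph 1) E X \<longleftrightarrow> (\<exists>v. X = {v})"
proof
  assume "piso (complete_graph 1) E X"
  then show "\<exists>v. X = {v}" by (rule gisoE) auto
next
  assume "\<exists>v. X = {v}"
  then obtain v where "X = {v}" by blast
  then show "piso (complete_graph 1) E X"
    using irr by (intro gisoI[of "\<lambda>_. v"]) (auto simp: bij_betw_def inj_on_def)
qed

text \<open>The theorem quantifies over graphs on natural numbers; numbering a finite vertex set
  provides such a copy.\<close>

lemma (in sgraph) ex_nat_graph: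
  assumes "finite X"
  shows "\<exists>H :: nat pair_pre_digraph. pair_graph H \<and> piso H E X"
proof -
  obtain g where g: "bij_betw g {0..<card X} X" using ex_bij_betw_nat_finite[OF assms] by blast
  define H where "H = \<lparr> pverts = {0..<card X}, parcs = {(i, j). i < card X \<and> j < card X \<and> E (g i) (g j)} \<rparr>"
  have "pair_graph H" unfolding pair_graph_iff H_def sgraph_def padj_def using sym irr by auto
  moreover have "piso H E X" using g by (intro gisoI[of g]) (auto simp: H_def padj_def)
  ultimately show ?thesis by blast
qed

section \<open>Obstructions as statements about vertex sets\<close>

lemma cograph_iff:
  assumes "pair_graph G"
  shows "cograph (with_proj G) \<longleftrightarrow> p4free (padj G) (pverts G)"
proof -
  interpret sgraph "padj G" using assms pair_graph_iff by blast
  have wf: "pwf (prestrict G W)" for W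
    unfolding prestrict_def by auto
  have "digraph_iso (with_proj (prestrict G W)) (with_proj (path_graph 4)) \<longleftrightarrow>
      giso (padj G) W (padj (path_graph 4)) (pverts (path_graph 4))" for W
  proof -
    have "giso (padj G) W (padj (prestrict G W)) W"
      by (rule gisoI[of id]) (auto simp: padj_prestrict)
    then show ?thesis
      using digraph_iso_iff[OF wf wf_path_graph, of W 4] giso_trans[of "padj G" W "padj (prestrict G W)" W]
        giso_trans[of "padj (prestrict G W)" W "padj G" W] giso_sym[of "padj G" W "padj (prestrict G W)" W]
      by auto
  qed
  then have "(\<exists>H. induced_subgraph H (with_proj G) \<and> digraph_iso H (with_proj (path_graph 4))) \<longleftrightarrow>
      (\<exists>W\<subseteq>pverts G. giso (padj G) W (padj (path_graph 4)) (pverts (path_graph 4)))"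
    unfolding induced_subgraph_iff[OF assms] by metis
  then show ?thesis unfolding cograph_def p4free_iff_giso using graph_with_proj[OF assms] by simp
qed

text \<open>Shared by the three kinds of polarity: induced subgraphs correspond to vertex subsets,
  and proper ones to proper subsets because a graph determines its vertex set.\<close>

lemma min_polar_obstruction_iff:
  assumes "pair_graph G"
    and P: "\<And>W. W \<subseteq> pverts G \<Longrightarrow> polar s k (with_proj (prestrict G W)) \<longleftrightarrow> P W"
  shows "cograph_min_polar_obstruction s k (with_proj G) \<longleftrightarrow> p4free (padj G) (pverts G) \<and> min_obs P (pverts G)"
proof -
  have top: "polar s k (with_proj G) \<longleftrightarrow> P (pverts G)" using P[of "pverts G"] prestrict_pverts[OF assms(1)] by simp
  have ne: "with_proj (prestrict G W) \<noteq> with_proj G \<longleftrightarrow> W \<noteq> pverts G" if "W \<subseteq> pverts G" for W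
  proof
    show "with_proj (prestrict G W) \<noteq> with_proj G \<Longrightarrow> W \<noteq> pverts G" using prestrict_pverts[OF assms(1)] by auto
    show "W \<noteq> pverts G \<Longrightarrow> with_proj (prestrict G W) \<noteq> with_proj G"
      using with_proj_simps(1) pverts_prestrict by metis
  qed
  have "(\<forall>H. induced_subgraph H (with_proj G) \<and> H \<noteq> with_proj G \<longrightarrow> polar s k H) \<longleftrightarrow>
      (\<forall>W\<subseteq>pverts G. with_proj (prestrict G W) \<noteq> with_proj G \<longrightarrow> polar s k (with_proj (prestrict G W)))"
    unfolding induced_subgraph_iff[OF assms(1)] by blast
  also have "\<dots> \<longleftrightarrow> (\<forall>W\<subset>pverts G. P W)" using ne P by (metis psubsetE psubsetI order_refl)
  finally show ?thesis
    unfolding cograph_min_polar_obstruction_def min_obs_def cograph_iff[OF assms(1)] top by blast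
qed

lemma min_polar_infty_iff:
  "pair_graph G \<Longrightarrow> cograph_min_polar_obstruction \<infinity> (enat k) (with_proj G) \<longleftrightarrow>
    p4free (padj G) (pverts G) \<and> min_obs (polinf (padj G) k) (pverts G)"
  by (rule min_polar_obstruction_iff) (simp_all add: polar_infty_iff)

lemma min_polar_1_iff:
  "pair_graph G \<Longrightarrow> cograph_min_polar_obstruction 1 (enat k) (with_proj G) \<longleftrightarrow>
    p4free (padj G) (pverts G) \<and> min_obs (pol1 (padj G) k) (pverts G)"
  by (rule min_polar_obstruction_iff) (simp_all add: polar_1_iff)

lemma min_polar_1_infty_iff:
  "pair_graph G \<Longrightarrow> cograph_min_polar_obstruction 1 \<infinity> (with_proj G) \<longleftrightarrow>
    p4free (padj G) (pverts G) \<and> min_obs (monopolar (padj G)) (pverts G)"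
  by (rule min_polar_obstruction_iff) (simp_all add: polar_1_infty_iff)

text \<open>Arcs are symmetric, so a neighbour of a vertex of the component is mutually reachable
  with it and belongs to the component; no edge leaves the \<open>P\<^sub>3\<close>.\<close>

lemma P3_component:
  assumes G: "pair_graph G" and C: "C \<in> pre_digraph.sccs (with_proj G)" "digraph_iso C (with_proj (path_graph 3))"
  shows "\<exists>a b c. padj G a b \<and> padj G b c \<and> \<not> padj G a c \<and> a \<noteq> c \<and> {a, b, c} \<subseteq> pverts G
    \<and> nonadj (padj G) {a, b, c} (pverts G - {a, b, c})"
proof -
  interpret pair_graph G using G .
  interpret sgraph "padj G" using G pair_graph_iff by blast
  have "induced_subgraph C (with_proj G)" using C(1) unfolding sccs_def by blast
  then obtain W where W: "W \<subseteq> pverts G" "C = with_proj (prestrict G W)" using induced_subgraph_iff[OF G] by blast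
  have wf: "pwf (prestrict G W)"
    unfolding prestrict_def by auto
  have "giso (padj (prestrict G W)) W (padj (path_graph 3)) (pverts (path_graph 3))"
    using digraph_iso_iff[OF wf wf_path_graph, of 3] C(2) W(2) by simp
  moreover have "giso (padj G) W (padj (prestrict G W)) W"
    by (rule gisoI[of id]) (auto simp: padj_prestrict)
  ultimately have "piso (path_graph 3) (padj G) W"
    using giso_trans giso_sym by blast
  then obtain a b c where abc: "W = {a, b, c}" "padj G a b" "padj G b c" "\<not> padj G a c" "a \<noteq> c"
    unfolding giso_P3_iff by blast
  have "verts C \<in> sccs_verts" using C(1) sccs_verts_conv by blast
  then have sv: "W \<in> sccs_verts" using W(2) by simp
  have "\<not> padj G u v" if uv: "u \<in> W" "v \<in> pverts G - W" for u v
  proof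
    assume "padj G u v"
    then have "u \<rightarrow>\<^sup>*\<^bsub>with_proj G\<^esub> v" "v \<rightarrow>\<^sup>*\<^bsub>with_proj G\<^esub> u"
      using sym[of u v] unfolding padj_def by (auto intro: reachable_adjI)
    then show False using sv uv unfolding in_sccs_verts_conv_reachable by blast
  qed
  then have "nonadj (padj G) W (pverts G - W)" unfolding nonadj_def by blast
  then show ?thesis using abc W(1) by blast
qed

context sgraph begin

lemma digraph_iso_giso:
  assumes "piso H E X" "pair_graph H" "pwf K"
  shows "digraph_iso (with_proj H) (with_proj K) \<longleftrightarrow> piso K E X"
proof -
  have "pwf H" using assms(2) unfolding pair_graph_iff by blast
  from digraph_iso_iff[OF this assms(3)] show ?thesis
    using assms(1) giso_trans giso_sym by metis
qed

lemma shape1_iff: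
  "shape1 E k X \<longleftrightarrow> piso (disjoint_union (path_graph 3) (copies (k - 1) (complete_graph 2))) E X"
  unfolding shape1_def giso_disjoint_union_iff giso_P3_iff giso_copies_K2_iff by blast

lemma shape2_iff:
  "shape2 E k X \<longleftrightarrow> piso (disjoint_union (copies (k - 2) (complete_graph 2))
     (graph_join (complete_graph 1) (copies 2 (complete_graph 2)))) E X"
  (is "_ \<longleftrightarrow> ?R")
proof -
  have "?R \<longleftrightarrow> (\<exists>W Y. W \<union> Y = X \<and> nonadj E W Y \<and> matching E (k - 2) W \<and>
      (\<exists>V M. V \<union> M = Y \<and> alladj E V M \<and> (\<exists>v. V = {v}) \<and> matching E 2 M))"
    unfolding giso_disjoint_union_iff giso_graph_join_iff giso_K1_iff giso_copies_K2_iff ..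
  also have "\<dots> \<longleftrightarrow> shape2 E k X"
  proof
    assume "\<exists>W Y. W \<union> Y = X \<and> nonadj E W Y \<and> matching E (k - 2) W \<and>
      (\<exists>V M. V \<union> M = Y \<and> alladj E V M \<and> (\<exists>v. V = {v}) \<and> matching E 2 M)"
    then obtain W M v where "W \<union> ({v} \<union> M) = X" "nonadj E W ({v} \<union> M)" "matching E (k - 2) W"
      "alladj E {v} M" "matching E 2 M" by blast
    then show "shape2 E k X" unfolding shape2_def using nonadj_sym[of W "insert v M"]
      by (intro exI[of _ v] exI[of _ M] exI[of _ W]) auto
  next
    assume "shape2 E k X"
    then obtain v M W where *: "alladj E {v} M" "matching E 2 M" "nonadj E (insert v M) W"
      "matching E (k - 2) W" "X = insert v M \<union> W" unfolding shape2_def by blast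
    then have "W \<union> insert v M = X" "nonadj E W (insert v M)" "{v} \<union> M = insert v M" using nonadj_sym by auto
    then show "\<exists>W Y. W \<union> Y = X \<and> nonadj E W Y \<and> matching E (k - 2) W \<and>
      (\<exists>V M. V \<union> M = Y \<and> alladj E V M \<and> (\<exists>v. V = {v}) \<and> matching E 2 M)" using *(1,2,4) by metis
  qed
  finally show ?thesis by blast
qed

text \<open>In (3) only \<open>H\<^sub>j\<close> is required to be a cograph. Adding disjoint edges
  creates no \<open>P\<^sub>4\<close>, so \<open>p4free E X\<close> can stand on the left.\<close>

lemma shape3_iff:
  assumes H: "pair_graph H" "piso H E X" and fin: "finite X"
  shows "p4free E X \<and> shape3 E k X \<longleftrightarrow>
    (\<exists>j\<in>{1..k - 1}. \<exists>H\<^sub>j :: nat pair_pre_digraph. pair_graph H\<^sub>j \<and>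
      Digraph_Component.connected (with_proj H\<^sub>j) \<and>
      cograph_min_polar_obstruction 1 (enat j) (with_proj H\<^sub>j) \<and>
      \<not> cograph_min_polar_obstruction 1 \<infinity> (with_proj H\<^sub>j) \<and>
      digraph_iso (with_proj H) (with_proj (disjoint_union (copies (k - j - 1) (complete_graph 2)) H\<^sub>j)))"
  (is "_ \<longleftrightarrow> ?R")
proof -
  have iso: "digraph_iso (with_proj H) (with_proj (disjoint_union (copies n (complete_graph 2)) K)) \<longleftrightarrow>
      (\<exists>W D. W \<union> D = X \<and> nonadj E W D \<and> matching E n W \<and> piso K E D)"
    if "pair_graph K" for n and K :: "nat pair_pre_digraph"
  proof -
    have "pwf K" using that unfolding pair_graph_iff by blast
    from digraph_iso_giso[OF H(2,1) wf_disjoint_union[OF wf_copies[OF wf_complete_graph[of 2], of n] this]]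
    show ?thesis unfolding giso_disjoint_union_iff giso_copies_K2_iff .
  qed
  have tr: "Digraph_Component.connected (with_proj K) \<and>
      cograph_min_polar_obstruction 1 (enat j) (with_proj K) \<and>
      \<not> cograph_min_polar_obstruction 1 \<infinity> (with_proj K) \<longleftrightarrow>
      p4free E D \<and> conn E D \<and> min_obs (pol1 E j) D \<and> \<not> min_obs (monopolar E) D"
    if K: "pair_graph K" "piso K E D" for K :: "nat pair_pre_digraph" and D j
    unfolding connected_iff[OF K(1)] min_polar_1_iff[OF K(1)] min_polar_1_infty_iff[OF K(1)]
    using giso_p4free[OF K(2)] giso_conn[OF K(2)] giso_min_obs_pol1[OF K(2), of j] giso_min_obs_monopolar[OF K(2)]
    by blast
  show ?thesis
  proof
    assume L: "p4free E X \<and> shape3 E k X"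
    then obtain j W D where j: "j \<in> {1..k - 1}" and D: "nonadj E W D" "matching E (k - j - 1) W" "conn E D"
      "min_obs (pol1 E j) D" "\<not> min_obs (monopolar E) D" "X = W \<union> D" unfolding shape3_def by blast
    have "finite D" using fin D(6) by simp
    then obtain K :: "nat pair_pre_digraph" where K: "pair_graph K" "piso K E D"
      using ex_nat_graph by blast
    have "p4free E D" using L D(6) p4free_mono by blast
    then have 1: "Digraph_Component.connected (with_proj K) \<and>
      cograph_min_polar_obstruction 1 (enat j) (with_proj K) \<and>
      \<not> cograph_min_polar_obstruction 1 \<infinity> (with_proj K)" using tr[OF K, of j] D(3,4,5) by blast
    have "digraph_iso (with_proj H) (with_proj (disjoint_union (copies (k - j - 1) (complete_graph 2)) K))"
      unfolding iso[OF K(1)] using D(1,2,6) K(2) by blast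
    then show ?R
      using j K(1) 1 by blast
  next
    assume ?R
    then obtain j and K :: "nat pair_pre_digraph" where j: "j \<in> {1..k - 1}" and K: "pair_graph K"
      "Digraph_Component.connected (with_proj K) \<and> cograph_min_polar_obstruction 1 (enat j) (with_proj K) \<and>
      \<not> cograph_min_polar_obstruction 1 \<infinity> (with_proj K)"
      "digraph_iso (with_proj H) (with_proj (disjoint_union (copies (k - j - 1) (complete_graph 2)) K))" by blast
    obtain W D where D: "W \<union> D = X" "nonadj E W D" "matching E (k - j - 1) W" "piso K E D"
      using K(3) unfolding iso[OF K(1)] by blast
    have D': "p4free E D" "conn E D" "min_obs (pol1 E j) D" "\<not> min_obs (monopolar E) D"
      using tr[OF K(1) D(4), of j] K(2) by blast+
    have "p4free E X" using p4free_Un[OF D(2) matching_p4free[OF D(3)] D'(1)] D(1) by simp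
    moreover have "shape3 E k X" unfolding shape3_def using j D D' by blast
    ultimately show "p4free E X \<and> shape3 E k X" by blast
  qed
qed

lemma min_obs_iff_shape:
  assumes k: "k \<ge> 2" and fin: "finite V" and P: "P = {a, b, c}" "E a b" "E b c" "\<not> E a c" "a \<noteq> c"
    and V: "P \<union> X = V" "nonadj E P X"
  shows "p4free E V \<and> min_obs (polinf E k) V \<longleftrightarrow>
    shape1 E k X \<or> shape2 E k X \<or> p4free E X \<and> shape3 E k X \<or> p4free E X \<and> shape4 E k X"
proof -
  have finX: "finite X" using fin V(1) by auto
  have "p4free E V \<longleftrightarrow> p4free E X"
    using p4free_Un[OF V(2)] p4free_P3[OF P(2-5)] P(1) V(1) p4free_mono[of E V X] by auto
  moreover have "min_obs (polinf E k) V \<longleftrightarrow> good E k X"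
    using min_obs_P3_Un[OF k P finX V(2)] V(1) by simp
  ultimately show ?thesis using good_iff_shape[OF k finX] by blast
qed

end

theorem theorem6:
  fixes G :: "'a pair_pre_digraph" and k :: nat
  assumes "k \<ge> 2"
    and "pair_graph G"
    and "\<exists>C\<in>pre_digraph.sccs (with_proj G). digraph_iso C (with_proj (path_graph 3))"
  shows "cograph_min_polar_obstruction \<infinity> (enat k) (with_proj G) \<longleftrightarrow>
    (\<exists>H :: nat pair_pre_digraph. pair_graph H \<and>
      digraph_iso (with_proj G) (with_proj (disjoint_union (path_graph 3) H)) \<and>
      (digraph_iso (with_proj H)
          (with_proj (disjoint_union (path_graph 3) (copies (k - 1) (complete_graph 2))))
       \<or> digraph_iso (with_proj H)
          (with_proj (disjoint_union (copies (k - 2) (complete_graph 2))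
            (graph_join (complete_graph 1) (copies 2 (complete_graph 2)))))
       \<or> (\<exists>j\<in>{1..k - 1}. \<exists>H\<^sub>j :: nat pair_pre_digraph. pair_graph H\<^sub>j \<and>
            Digraph_Component.connected (with_proj H\<^sub>j) \<and>
            cograph_min_polar_obstruction 1 (enat j) (with_proj H\<^sub>j) \<and>
            \<not> cograph_min_polar_obstruction 1 \<infinity> (with_proj H\<^sub>j) \<and>
            digraph_iso (with_proj H)
              (with_proj (disjoint_union (copies (k - j - 1) (complete_graph 2)) H\<^sub>j)))
       \<or> (k \<ge> 3 \<and> cograph_min_polar_obstruction 1 \<infinity> (with_proj H))))"
  (is "?L \<longleftrightarrow> (\<exists>H. pair_graph H \<and> ?iso H \<and> (?S1 H \<or> ?S2 H \<or> ?S3 H \<or> ?S4 H))")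
proof -
  interpret sgraph "padj G" using assms(2) pair_graph_iff by blast
  have fin: "finite (pverts G)" and wfG: "pwf G"
    using assms(2) unfolding pair_graph_iff by blast+
  have L: "?L \<longleftrightarrow> p4free (padj G) (pverts G) \<and> min_obs (polinf (padj G) k) (pverts G)"
    by (rule min_polar_infty_iff[OF assms(2)])
  have S: "?S1 H \<or> ?S2 H \<or> ?S3 H \<or> ?S4 H \<longleftrightarrow> shape1 (padj G) k X \<or> shape2 (padj G) k X \<or>
      p4free (padj G) X \<and> shape3 (padj G) k X \<or> p4free (padj G) X \<and> shape4 (padj G) k X"
    if H: "pair_graph H" "piso H (padj G) X" "finite X" for H :: "nat pair_pre_digraph" and X
  proof -
    have "?S1 H \<longleftrightarrow> shape1 (padj G) k X"
      unfolding shape1_iff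
      by (intro digraph_iso_giso[OF H(2,1)] wf_disjoint_union wf_path_graph wf_copies wf_complete_graph)
    moreover have "?S2 H \<longleftrightarrow> shape2 (padj G) k X"
      unfolding shape2_iff
      by (intro digraph_iso_giso[OF H(2,1)] wf_disjoint_union wf_graph_join wf_copies wf_complete_graph)
    moreover have "?S4 H \<longleftrightarrow> p4free (padj G) X \<and> shape4 (padj G) k X"
      unfolding shape4_def min_polar_1_infty_iff[OF H(1)]
      using giso_p4free[OF H(2)] giso_min_obs_monopolar[OF H(2)] by blast
    moreover note shape3_iff[OF H, of k]
    ultimately show ?thesis by simp
  qed
  have iso: "?iso H \<longleftrightarrow> (\<exists>a b c X. {a, b, c} \<union> X = pverts G \<and> nonadj (padj G) {a, b, c} X \<and>
      padj G a b \<and> padj G b c \<and> \<not> padj G a c \<and> a \<noteq> c \<and> piso H (padj G) X)"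
    if H: "pair_graph H" for H :: "nat pair_pre_digraph"
  proof -
    have wfH: "pwf H" using H unfolding pair_graph_iff by blast
    have "?iso H \<longleftrightarrow> piso (disjoint_union (path_graph 3) H)
        (padj G) (pverts G)"
      by (rule digraph_iso_giso[OF giso_refl assms(2) wf_disjoint_union[OF wf_path_graph wfH]])
    then show ?thesis unfolding giso_disjoint_union_iff giso_P3_iff by blast
  qed
  have shape: "?L \<longleftrightarrow> shape1 (padj G) k X \<or> shape2 (padj G) k X \<or>
      p4free (padj G) X \<and> shape3 (padj G) k X \<or> p4free (padj G) X \<and> shape4 (padj G) k X"
    if "{a, b, c} \<union> X = pverts G" "nonadj (padj G) {a, b, c} X"
      "padj G a b" "padj G b c" "\<not> padj G a c" "a \<noteq> c" for a b c X
    unfolding L using min_obs_iff_shape[OF assms(1) fin refl that(3-6) that(1,2)] .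
  show ?thesis
  proof
    assume l: ?L
    obtain C where "C \<in> pre_digraph.sccs (with_proj G)" "digraph_iso C (with_proj (path_graph 3))" using assms(3) by blast
    from P3_component[OF assms(2) this] obtain a b c where
      e: "padj G a b" "padj G b c" "\<not> padj G a c" "a \<noteq> c" and
      V: "{a, b, c} \<subseteq> pverts G" "nonadj (padj G) {a, b, c} (pverts G - {a, b, c})" by blast
    define X where "X = pverts G - {a, b, c}"
    have X: "{a, b, c} \<union> X = pverts G" "nonadj (padj G) {a, b, c} X" "finite X"
      using V fin unfolding X_def by auto
    obtain H :: "nat pair_pre_digraph" where H: "pair_graph H" "piso H (padj G) X"
      using ex_nat_graph[OF X(3)] by blast
    have "?S1 H \<or> ?S2 H \<or> ?S3 H \<or> ?S4 H" unfolding S[OF H X(3)] using shape[OF X(1,2) e] l by simp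
    moreover have "?iso H" unfolding iso[OF H(1)] using X e H(2) by blast
    ultimately show "\<exists>H. pair_graph H \<and> ?iso H \<and> (?S1 H \<or> ?S2 H \<or> ?S3 H \<or> ?S4 H)" using H(1) by blast
  next
    assume "\<exists>H. pair_graph H \<and> ?iso H \<and> (?S1 H \<or> ?S2 H \<or> ?S3 H \<or> ?S4 H)"
    then obtain H where H: "pair_graph H" "?iso H" "?S1 H \<or> ?S2 H \<or> ?S3 H \<or> ?S4 H" by blast
    \<comment> \<open>The isomorphism may pick out another \<open>P\<^sub>3\<close> component than a
      given one; \<open>shape\<close> holds for each of them.\<close>
    from H(2)[unfolded iso[OF H(1)]] obtain a b c X where
      X: "{a, b, c} \<union> X = pverts G" "nonadj (padj G) {a, b, c} X" and
      e: "padj G a b" "padj G b c" "\<not> padj G a c" "a \<noteq> c" and g: "piso H (padj G) X" by blast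
    have "finite X" using X(1) fin by (metis finite_Un)
    from H(3)[unfolded S[OF H(1) g this]] show ?L using shape[OF X e] by simp
  qed
qed

end
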